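(* OGA's theorems strictly extend RGA's: every judgment derivable in RGA is derivable in OGA, and there is $n\in\mathbb N$ such that $\emptyset\vdash(\mathrm{rrep}(\mathrm{sfApp})\cdot\underline n)\,\mathsf B$ is derivable in OGA but not derivable in RGA. The extension consists of status judgments: the rule ATI adds no grounded truths (its conclusion is always a status judgment $(\mathcal A\cdot u)\,\mathsf B$, never $\mathcal A\cdot u$ itself), yet its status judgments are new theorems.
   Context: **Syntax.** Terms: $t::=v_i\mid\bot\mid\mathbf 0\mid\mathbf S t\mid t=t\mid\neg t\mid t\lor t\mid\lambda t\mid t\cdot t\mid\mathcal R\mid\mathcal A$ ($v_i$, $i\in\mathbb N$, de Bruijn variables; $\lambda$ is the only binder; application associates to the left). A term is well-formed (wf) if generated by this grammar. $\bot$ is a divergent constant, $\mathcal R$ the primitive recursor, $\mathcal A$ the universal quantifier. Abbreviations: $t\,\mathsf N$ is $t=t$; $t\,\mathsf B$ is $t\lor\neg t$; $t\ne u$ is $\neg(t=u)$; $t\land u$ is $\neg(\neg t\lor\neg u)$; $t\to u$ is $\neg t\lor u$; $\underline n=\mathbf S^n\mathbf 0$. $\uparrow$ shifts all free indices up by one; $b[t]$ is the $\beta$-instance substituting $t$ for the outermost bound variable of $b$; $[v\mapsto s]$ is capture-avoiding substitution for a free variable; $\mathrm{fv}$ is the set of free variables. **Head steps** $\triangleright$: $(\lambda b)\cdot t\triangleright b[t]$; $\mathcal R\cdot g\cdot h\cdot\mathbf 0\triangleright g$; $\mathcal R\cdot g\cdot h\cdot(\mathbf S\underline n)\triangleright h\cdot\underline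 n\cdot(\mathcal R\cdot g\cdot h\cdot\underline n)$; if $t\triangleright t'$ then $t\cdot u\triangleright t'\cdot u$. **Rules.** Judgments are $\Gamma\vdash c$, $\Gamma$ a finite set of wf terms, $c$ a wf term (all terms in rules are wf). A proof is a finite list of judgments each following from earlier entries by one rule; $\Gamma\vdash c$ is derivable (a theorem) if it occurs in a proof. Rules ("$\Rightarrow$" from premises to conclusion, "$\Leftrightarrow$" both directions; $\Gamma$ is the context of a judgment when none is shown): $\Gamma,c\vdash c$; $\Gamma\vdash c\Rightarrow\Gamma,a\vdash c$; $\Gamma\vdash a$ and $\Gamma,a\vdash c\Rightarrow\Gamma\vdash c$; $\Gamma\vdash c\Rightarrow[v\mapsto s]\Gamma\vdash[v\mapsto s]c$; $\vdash a\Leftrightarrow\ \vdash a=\underline1$; $\vdash\neg a\Leftrightarrow\ \vdash a=\underline0$; $\vdash\neg a,\ \vdash a\Rightarrow\ \vdash c$; $\vdash a\Leftrightarrow\ \vdash\neg\neg a$; $\vdash a\Rightarrow\ \vdash a\lor b$; $\vdash b\Rightarrow\ \vdash a\lor b$; $\vdash\neg a,\ \vdash\neg b\Rightarrow\ \vdash\neg(a\lor b)$; $\vdash a\lor b,\ \Gamma,a\vdash c,\ \Gamma,b\vdash c\Rightarrow\ \vdash c$; $\vdash\neg(a\lor b)\Rightarrow\ \vdash\neg a$; $\vdash\neg(a\lor b)\Rightarrow\ \vdash\neg b$; $\vdash a\,\mathsf N\Leftrightarrow\ \vdash a=a$; $\vdash a=b\Rightarrow\ \vdash b=a$; $\vdash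 a=b,\ \vdash[v\mapsto a]p\Rightarrow\ \vdash[v\mapsto b]p$; $\vdash a\ne b\Rightarrow\ \vdash b\ne a$; $\vdash a\,\mathsf N,\ \vdash b\,\mathsf N\Rightarrow\ \vdash(a=b)\,\mathsf B$; $\vdash(a=b)\,\mathsf B\Rightarrow\ \vdash(a\,\mathsf N)\land(b\,\mathsf N)$; $\vdash\mathbf 0\,\mathsf N$; $\vdash a\,\mathsf N\Leftrightarrow\ \vdash(\mathbf S a)\,\mathsf N$; $\vdash a\,\mathsf N\Rightarrow\ \vdash\mathbf S a\ne\mathbf 0$; $\vdash a\ne b\Leftrightarrow\ \vdash\mathbf S a\ne\mathbf S b$; $\vdash\mathbf S a=\mathbf S b\Rightarrow\ \vdash a=b$; $\vdash\bot\,\mathsf N\Rightarrow\ \vdash p$; induction: $\vdash[v_i\mapsto\mathbf 0]c$, $\ v_i\,\mathsf N,c,\Gamma\vdash[v_i\mapsto\mathbf S v_i]c$, $\ \vdash a\,\mathsf N\Rightarrow\ \vdash[v_i\mapsto a]c$ if $v_i\notin\mathrm{fv}(\Gamma)$; conversion, for $c\triangleright c'$: $\vdash c'\Rightarrow\ \vdash c$; $\vdash c\Rightarrow\ \vdash c'$; $\vdash\neg c\Rightarrow\ \vdash\neg c'$; $\vdash c'\,\mathsf N\Rightarrow\ \vdash c=c'$; $\vdash m\,\mathsf N,\ \vdash(h\cdot m\cdot(\mathcal R\cdot g\cdot h\cdot m))\,\mathsf N\Rightarrow\ \vdash\mathcal R\cdot g\cdot h\cdot(\mathbf S m)=h\cdot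 m\cdot(\mathcal R\cdot g\cdot h\cdot m)$; $v_0\,\mathsf N,\uparrow\Gamma\vdash\uparrow f\cdot v_0\Rightarrow\Gamma\vdash\mathcal A\cdot f$; $\vdash\mathcal A\cdot f,\ \vdash a\,\mathsf N\Rightarrow\ \vdash f\cdot a$; $\vdash\neg(f\cdot a),\ \vdash a\,\mathsf N\Rightarrow\ \vdash\neg(\mathcal A\cdot f)$; $\Gamma\vdash\neg(\mathcal A\cdot f)$ and $v_0\,\mathsf N,\neg(\uparrow f\cdot v_0),\uparrow\Gamma\vdash\uparrow c\Rightarrow\Gamma\vdash c$. These are the rules of RGA. OGA has these and the rule ATI: $\Gamma\vdash\mathcal A\cdot(\lambda((\uparrow u\cdot v_0)\,\mathsf B))\Rightarrow\Gamma\vdash(\mathcal A\cdot u)\,\mathsf B$. **Status and grounded truth.** A status judgment is a decidedness judgment, one asserting $t\,\mathsf B$, i.e. that $t$ has a definite yes-or-no answer (Boolean status), without asserting $t$ or $\neg t$. Grounded truth is the semantic notion of the grounded family: a sentence is grounded true when a terminating semantic process grounds it, false when such a process refutes it, and otherwise ungrounded (no truth value); in RGA's version a universal counts true when the system's own proof search certifies its schematic instance, and false when the system refutes a particular numeral instance. For well-formed sentences RGA's grounded truth coincides with RGA-provability. That ATI adds no grounded truths means that the rule on its own contributes only Boolean status to quantified sentences, never their truth. **Search sentences.** A step function is a primitive recursive $f:\mathbb N^2\to\mathbb N$ presented by a primitive recursive definition (from zero, successor, projections by composition and primitive recursion). Its search at $n$ hits at step $k$ if $f(n,k)\neq0$,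 and hits if it hits at some step. $\mathrm{cmp}(f)$ is the closed term obtained by compiling the definition into curried $\lambda$-terms: zero functions to $\lambda\cdots\lambda\,\mathbf 0$, successor to $\lambda\,\mathbf S v_0$, projections to $\lambda\cdots\lambda\,v_i$, composition to the corresponding applications, and $F(0,\vec x)=G(\vec x)$, $F(m+1,\vec x)=H(m,F(m,\vec x),\vec x)$ to the curried term sending $y,\vec x$ to $\mathcal R\cdot(\mathrm{cmp}(G)\cdot\vec x)\cdot(\lambda\lambda\,\mathrm{cmp}(H)\cdot v_1\cdot v_0\cdot\vec x)\cdot y$ (indices of $\vec x$ shifted under the $\lambda$s). Put $\mathrm{rmat}(f,n)=\lambda(\mathrm{cmp}(f)\cdot\underline n\cdot v_0=\mathbf 0)$ and $\mathrm{rrep}(f)=\lambda\,\neg(\mathcal A\cdot\lambda(\mathrm{cmp}(f)\cdot v_1\cdot v_0=\mathbf 0))$. So $\mathrm{rrep}(f)\cdot\underline n\triangleright\neg(\mathcal A\cdot\mathrm{rmat}(f,n))$ expresses that the search of $f$ at $n$ hits. **Halting search.** Fix a standard enumeration $(\varphi_x)_{x\in\mathbb N}$ of the unary partial recursive functions with a primitive recursive step predicate, and a primitive recursive pairing $\langle\cdot,\cdot\rangle$. $\mathrm{sfApp}$ is the step function with $\mathrm{sfApp}(\langle x,y\rangle,k)=1$ if the computation of $\varphi_x(y)$ halts within $k$ steps, and $0$ otherwise. *)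

theory Defs
  imports "HOL-Library.FSet" "HOL-Library.Nat_Bijection"
begin

section \<open>Terms\<close>

text \<open>The datatype consists of exactly the well-formed terms; variables are de Bruijn indices and
  \<open>Lam\<close> is the only binder.\<close>

datatype tm =
    Var nat
  | Bot
  | Zr
  | Sc tm
  | Eq tm tm
  | Neg tm
  | Or tm tm
  | Lam tm
  | App tm tm  (infixl \<open>\<cdot>\<close> 80)
  | Rec
  | Univ

abbreviation isN :: "tm \<Rightarrow> tm" where "isN t \<equiv> Eq t t"
abbreviation isB :: "tm \<Rightarrow> tm" where "isB t \<equiv> Or t (Neg t)"
abbreviation Neq :: "tm \<Rightarrow> tm \<Rightarrow> tm" where "Neq t u \<equiv> Neg (Eq t u)"
abbreviation And :: "tm \<Rightarrow> tm \<Rightarrow> tm" where "And t u \<equiv> Neg (Or (Neg t) (Neg u))"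

definition num :: "nat \<Rightarrow> tm" where "num n = (Sc ^^ n) Zr"

text \<open>\<open>shift k\<close> raises by one the indices not bound by the \<open>k\<close> innermost enclosing binders.\<close>

primrec shift :: "nat \<Rightarrow> tm \<Rightarrow> tm" where
  "shift k (Var i) = Var (if i < k then i else Suc i)"
| "shift k Bot = Bot"
| "shift k Zr = Zr"
| "shift k (Sc t) = Sc (shift k t)"
| "shift k (Eq t u) = Eq (shift k t) (shift k u)"
| "shift k (Neg t) = Neg (shift k t)"
| "shift k (Or t u) = Or (shift k t) (shift k u)"
| "shift k (Lam t) = Lam (shift (Suc k) t)"
| "shift k (t \<cdot> u) = shift k t \<cdot> shift k u"
| "shift k Rec = Rec"
| "shift k Univ = Univ"

abbreviation up :: "tm \<Rightarrow> tm" where "up \<equiv> shift 0"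

text \<open>\<open>inst k s t\<close> removes the binder of index \<open>k\<close>: it becomes \<open>s\<close>, and higher indices drop by one.\<close>

primrec inst :: "nat \<Rightarrow> tm \<Rightarrow> tm \<Rightarrow> tm" where
  "inst k s (Var i) = (if i < k then Var i else if i = k then s else Var (i - 1))"
| "inst k s Bot = Bot"
| "inst k s Zr = Zr"
| "inst k s (Sc t) = Sc (inst k s t)"
| "inst k s (Eq t u) = Eq (inst k s t) (inst k s u)"
| "inst k s (Neg t) = Neg (inst k s t)"
| "inst k s (Or t u) = Or (inst k s t) (inst k s u)"
| "inst k s (Lam t) = Lam (inst (Suc k) (up s) t)"
| "inst k s (t \<cdot> u) = inst k s t \<cdot> inst k s u"
| "inst k s Rec = Rec"
| "inst k s Univ = Univ"

text \<open>\<open>fsub i s t\<close> is $[v_i \mapsto s]t$; unlike \<open>inst\<close> it leaves all other indices alone.\<close>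

primrec fsub :: "nat \<Rightarrow> tm \<Rightarrow> tm \<Rightarrow> tm" where
  "fsub i s (Var j) = (if j = i then s else Var j)"
| "fsub i s Bot = Bot"
| "fsub i s Zr = Zr"
| "fsub i s (Sc t) = Sc (fsub i s t)"
| "fsub i s (Eq t u) = Eq (fsub i s t) (fsub i s u)"
| "fsub i s (Neg t) = Neg (fsub i s t)"
| "fsub i s (Or t u) = Or (fsub i s t) (fsub i s u)"
| "fsub i s (Lam t) = Lam (fsub (Suc i) (up s) t)"
| "fsub i s (t \<cdot> u) = fsub i s t \<cdot> fsub i s u"
| "fsub i s Rec = Rec"
| "fsub i s Univ = Univ"

primrec fv :: "tm \<Rightarrow> nat set" where
  "fv (Var i) = {i}"
| "fv Bot = {}"
| "fv Zr = {}"
| "fv (Sc t) = fv t"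
| "fv (Eq t u) = fv t \<union> fv u"
| "fv (Neg t) = fv t"
| "fv (Or t u) = fv t \<union> fv u"
| "fv (Lam t) = {i. Suc i \<in> fv t}"
| "fv (t \<cdot> u) = fv t \<union> fv u"
| "fv Rec = {}"
| "fv Univ = {}"

inductive head_step :: "tm \<Rightarrow> tm \<Rightarrow> bool"  (infix \<open>\<triangleright>\<close> 50) where
  beta: "Lam b \<cdot> t \<triangleright> inst 0 t b"
| rec_zero: "Rec \<cdot> g \<cdot> h \<cdot> Zr \<triangleright> g"
| rec_suc: "Rec \<cdot> g \<cdot> h \<cdot> Sc (num n) \<triangleright> h \<cdot> num n \<cdot> (Rec \<cdot> g \<cdot> h \<cdot> num n)"
| app: "t \<triangleright> t' \<Longrightarrow> t \<cdot> u \<triangleright> t' \<cdot> u"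

section \<open>Judgments, rules and proofs\<close>

datatype sequent = Sequent "tm fset" tm  (infix \<open>\<turnstile>\<close> 40)

text \<open>\<open>rga_rule ps j\<close>: the premises \<open>ps\<close> and conclusion \<open>j\<close> form an instance of a rule of RGA.
  The rule between \<open>isN a\<close> and \<open>Eq a a\<close> is the identity, both sides being the same term.\<close>

inductive rga_rule :: "sequent list \<Rightarrow> sequent \<Rightarrow> bool" where
  hyp: "rga_rule [] (finsert c \<Gamma> \<turnstile> c)"
| weaken: "rga_rule [\<Gamma> \<turnstile> c] (finsert a \<Gamma> \<turnstile> c)"
| cut: "rga_rule [\<Gamma> \<turnstile> a, finsert a \<Gamma> \<turnstile> c] (\<Gamma> \<turnstile> c)"
| subst: "rga_rule [\<Gamma> \<turnstile> c] (fsub i s |`| \<Gamma> \<turnstile> fsub i s c)"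
| true_one: "rga_rule [\<Gamma> \<turnstile> a] (\<Gamma> \<turnstile> Eq a (num 1))"
| one_true: "rga_rule [\<Gamma> \<turnstile> Eq a (num 1)] (\<Gamma> \<turnstile> a)"
| false_zero: "rga_rule [\<Gamma> \<turnstile> Neg a] (\<Gamma> \<turnstile> Eq a (num 0))"
| zero_false: "rga_rule [\<Gamma> \<turnstile> Eq a (num 0)] (\<Gamma> \<turnstile> Neg a)"
| explode: "rga_rule [\<Gamma> \<turnstile> Neg a, \<Gamma> \<turnstile> a] (\<Gamma> \<turnstile> c)"
| dnegI: "rga_rule [\<Gamma> \<turnstile> a] (\<Gamma> \<turnstile> Neg (Neg a))"
| dnegE: "rga_rule [\<Gamma> \<turnstile> Neg (Neg a)] (\<Gamma> \<turnstile> a)"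
| orI1: "rga_rule [\<Gamma> \<turnstile> a] (\<Gamma> \<turnstile> Or a b)"
| orI2: "rga_rule [\<Gamma> \<turnstile> b] (\<Gamma> \<turnstile> Or a b)"
| norI: "rga_rule [\<Gamma> \<turnstile> Neg a, \<Gamma> \<turnstile> Neg b] (\<Gamma> \<turnstile> Neg (Or a b))"
| orE: "rga_rule [\<Gamma> \<turnstile> Or a b, finsert a \<Gamma> \<turnstile> c, finsert b \<Gamma> \<turnstile> c] (\<Gamma> \<turnstile> c)"
| norE1: "rga_rule [\<Gamma> \<turnstile> Neg (Or a b)] (\<Gamma> \<turnstile> Neg a)"
| norE2: "rga_rule [\<Gamma> \<turnstile> Neg (Or a b)] (\<Gamma> \<turnstile> Neg b)"
| nat_refl: "rga_rule [\<Gamma> \<turnstile> isN a] (\<Gamma> \<turnstile> Eq a a)"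
| eq_sym: "rga_rule [\<Gamma> \<turnstile> Eq a b] (\<Gamma> \<turnstile> Eq b a)"
| eq_subst: "rga_rule [\<Gamma> \<turnstile> Eq a b, \<Gamma> \<turnstile> fsub i a p] (\<Gamma> \<turnstile> fsub i b p)"
| neq_sym: "rga_rule [\<Gamma> \<turnstile> Neq a b] (\<Gamma> \<turnstile> Neq b a)"
| eq_bool: "rga_rule [\<Gamma> \<turnstile> isN a, \<Gamma> \<turnstile> isN b] (\<Gamma> \<turnstile> isB (Eq a b))"
| eq_boolE: "rga_rule [\<Gamma> \<turnstile> isB (Eq a b)] (\<Gamma> \<turnstile> And (isN a) (isN b))"
| zero_nat: "rga_rule [] (\<Gamma> \<turnstile> isN Zr)"
| suc_natI: "rga_rule [\<Gamma> \<turnstile> isN a] (\<Gamma> \<turnstile> isN (Sc a))"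
| suc_natE: "rga_rule [\<Gamma> \<turnstile> isN (Sc a)] (\<Gamma> \<turnstile> isN a)"
| suc_neq_zero: "rga_rule [\<Gamma> \<turnstile> isN a] (\<Gamma> \<turnstile> Neq (Sc a) Zr)"
| suc_neqI: "rga_rule [\<Gamma> \<turnstile> Neq a b] (\<Gamma> \<turnstile> Neq (Sc a) (Sc b))"
| suc_neqE: "rga_rule [\<Gamma> \<turnstile> Neq (Sc a) (Sc b)] (\<Gamma> \<turnstile> Neq a b)"
| suc_inj: "rga_rule [\<Gamma> \<turnstile> Eq (Sc a) (Sc b)] (\<Gamma> \<turnstile> Eq a b)"
| bot_nat: "rga_rule [\<Gamma> \<turnstile> isN Bot] (\<Gamma> \<turnstile> p)"
| nat_ind: "\<forall>t |\<in>| \<Gamma>. i \<notin> fv t \<Longrightarrow>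
    rga_rule [\<Gamma> \<turnstile> fsub i Zr c,
              finsert (isN (Var i)) (finsert c \<Gamma>) \<turnstile> fsub i (Sc (Var i)) c,
              \<Gamma> \<turnstile> isN a]
             (\<Gamma> \<turnstile> fsub i a c)"
| conv_expand: "c \<triangleright> c' \<Longrightarrow> rga_rule [\<Gamma> \<turnstile> c'] (\<Gamma> \<turnstile> c)"
| conv_reduce: "c \<triangleright> c' \<Longrightarrow> rga_rule [\<Gamma> \<turnstile> c] (\<Gamma> \<turnstile> c')"
| conv_neg: "c \<triangleright> c' \<Longrightarrow> rga_rule [\<Gamma> \<turnstile> Neg c] (\<Gamma> \<turnstile> Neg c')"
| conv_eq: "c \<triangleright> c' \<Longrightarrow> rga_rule [\<Gamma> \<turnstile> isN c'] (\<Gamma> \<turnstile> Eq c c')"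
| rec_eq: "rga_rule [\<Gamma> \<turnstile> isN m, \<Gamma> \<turnstile> isN (h \<cdot> m \<cdot> (Rec \<cdot> g \<cdot> h \<cdot> m))]
                    (\<Gamma> \<turnstile> Eq (Rec \<cdot> g \<cdot> h \<cdot> Sc m) (h \<cdot> m \<cdot> (Rec \<cdot> g \<cdot> h \<cdot> m)))"
| allI: "rga_rule [finsert (isN (Var 0)) (up |`| \<Gamma>) \<turnstile> up f \<cdot> Var 0] (\<Gamma> \<turnstile> Univ \<cdot> f)"
| allE: "rga_rule [\<Gamma> \<turnstile> Univ \<cdot> f, \<Gamma> \<turnstile> isN a] (\<Gamma> \<turnstile> f \<cdot> a)"
| nallI: "rga_rule [\<Gamma> \<turnstile> Neg (f \<cdot> a), \<Gamma> \<turnstile> isN a] (\<Gamma> \<turnstile> Neg (Univ \<cdot> f))"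
| nallE: "rga_rule [\<Gamma> \<turnstile> Neg (Univ \<cdot> f),
                    finsert (isN (Var 0)) (finsert (Neg (up f \<cdot> Var 0)) (up |`| \<Gamma>)) \<turnstile> up c]
                   (\<Gamma> \<turnstile> c)"

inductive ati_rule :: "sequent list \<Rightarrow> sequent \<Rightarrow> bool" where
  ati: "ati_rule [\<Gamma> \<turnstile> Univ \<cdot> Lam (isB (up u \<cdot> Var 0))] (\<Gamma> \<turnstile> isB (Univ \<cdot> u))"

definition oga_rule :: "sequent list \<Rightarrow> sequent \<Rightarrow> bool" where
  "oga_rule ps j \<longleftrightarrow> rga_rule ps j \<or> ati_rule ps j"

definition is_proof :: "(sequent list \<Rightarrow> sequent \<Rightarrow> bool) \<Rightarrow> sequent list \<Rightarrow> bool" where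
  "is_proof R js \<longleftrightarrow>
     (\<forall>i < length js. \<exists>ps. set ps \<subseteq> set (take i js) \<and> R ps (js ! i))"

definition derivable :: "(sequent list \<Rightarrow> sequent \<Rightarrow> bool) \<Rightarrow> sequent \<Rightarrow> bool" where
  "derivable R j \<longleftrightarrow> (\<exists>js. is_proof R js \<and> j \<in> set js)"

abbreviation RGA :: "sequent \<Rightarrow> bool" where "RGA \<equiv> derivable rga_rule"
abbreviation OGA :: "sequent \<Rightarrow> bool" where "OGA \<equiv> derivable oga_rule"

text \<open>Status judgments of quantified terms: they assert that \<open>Univ \<cdot> u\<close> is decided, without
  asserting \<open>Univ \<cdot> u\<close> or its negation.\<close>

definition all_status :: "sequent \<Rightarrow> bool" where
  "all_status j \<longleftrightarrow> (\<exists>\<Gamma> u. j = (\<Gamma> \<turnstile> isB (Univ \<cdot> u)))"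

section \<open>Primitive recursive definitions and their compilation\<close>

text \<open>The first argument of \<open>PZero\<close>, \<open>PProj\<close> and \<open>PComp\<close> is the arity of the function defined;
  \<open>PProj n i\<close> selects the argument at position \<open>i < n\<close>, counted from 0. \<open>PRec n g h\<close> has arity
  \<open>Suc n\<close>, with the recursion argument in front.\<close>

datatype pdef =
    PZero nat
  | PSuc
  | PProj nat nat
  | PComp nat pdef "pdef list"
  | PRec nat pdef pdef

fun pr_wf :: "nat \<Rightarrow> pdef \<Rightarrow> bool" where
  "pr_wf n (PZero m) \<longleftrightarrow> m = n"
| "pr_wf n PSuc \<longleftrightarrow> n = 1"
| "pr_wf n (PProj m i) \<longleftrightarrow> m = n \<and> i < n"
| "pr_wf n (PComp m g hs) \<longleftrightarrow> m = n \<and> pr_wf (length hs) g \<and> (\<forall>h \<in> set hs. pr_wf n h)"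
| "pr_wf n (PRec m g h) \<longleftrightarrow> n = Suc m \<and> pr_wf m g \<and> pr_wf (m + 2) h"

fun pr_eval :: "pdef \<Rightarrow> nat list \<Rightarrow> nat" where
  "pr_eval (PZero n) xs = 0"
| "pr_eval PSuc xs = Suc (xs ! 0)"
| "pr_eval (PProj n i) xs = xs ! i"
| "pr_eval (PComp n g hs) xs = pr_eval g (map (\<lambda>h. pr_eval h xs) hs)"
| "pr_eval (PRec n g h) xs =
     rec_nat (pr_eval g (tl xs)) (\<lambda>m r. pr_eval h (m # r # tl xs)) (hd xs)"

definition lams :: "nat \<Rightarrow> tm \<Rightarrow> tm" where "lams n t = (Lam ^^ n) t"

definition apps :: "tm \<Rightarrow> tm list \<Rightarrow> tm" where "apps t us = foldl App t us"

text \<open>\<open>args n k\<close> lists the variables bound by \<open>n\<close> consecutive abstractions, outermost (first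
  argument) first, as seen from below \<open>k\<close> further abstractions.\<close>

definition args :: "nat \<Rightarrow> nat \<Rightarrow> tm list" where
  "args n k = map (\<lambda>i. Var (n - 1 - i + k)) [0..<n]"

text \<open>Compiled terms are closed, so they need no shifting under the new abstractions.\<close>

fun cmp :: "pdef \<Rightarrow> tm" where
  "cmp (PZero n) = lams n Zr"
| "cmp PSuc = Lam (Sc (Var 0))"
| "cmp (PProj n i) = lams n (Var (n - 1 - i))"
| "cmp (PComp n g hs) = lams n (apps (cmp g) (map (\<lambda>h. apps (cmp h) (args n 0)) hs))"
| "cmp (PRec n g h) =
     lams (Suc n)
       (Rec \<cdot> apps (cmp g) (args n 0)
            \<cdot> Lam (Lam (apps (cmp h \<cdot> Var 1 \<cdot> Var 0) (args n 2)))
            \<cdot> Var n)"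

definition presents :: "pdef \<Rightarrow> (nat \<Rightarrow> nat \<Rightarrow> nat) \<Rightarrow> bool" where
  "presents d f \<longleftrightarrow> pr_wf 2 d \<and> (\<forall>n k. pr_eval d [n, k] = f n k)"

definition rrep :: "pdef \<Rightarrow> tm" where
  "rrep d = Lam (Neg (Univ \<cdot> Lam (Eq (cmp d \<cdot> Var 1 \<cdot> Var 0) Zr)))"

section \<open>Partial recursive functions and the halting search\<close>

definition mu_at :: "(nat list \<Rightarrow> nat option) \<Rightarrow> nat list \<Rightarrow> nat \<Rightarrow> bool" where
  "mu_at f xs k \<longleftrightarrow> f (k # xs) = Some 0 \<and> (\<forall>j < k. \<exists>v. f (j # xs) = Some (Suc v))"

text \<open>\<open>partrec n f\<close>: \<open>f\<close> is an \<open>n\<close>-ary partial recursive function. Only the values of \<open>f\<close> on lists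
  of length \<open>n\<close> are meaningful.\<close>

inductive partrec :: "nat \<Rightarrow> (nat list \<Rightarrow> nat option) \<Rightarrow> bool" where
  zero: "partrec n (\<lambda>xs. Some 0)"
| succ: "partrec 1 (\<lambda>xs. Some (Suc (xs ! 0)))"
| proj: "i < n \<Longrightarrow> partrec n (\<lambda>xs. Some (xs ! i))"
| comp: "partrec (length gs) f \<Longrightarrow> \<forall>g \<in> set gs. partrec n g \<Longrightarrow>
    partrec n (\<lambda>xs. if \<forall>g \<in> set gs. g xs \<noteq> None
                    then f (map (\<lambda>g. the (g xs)) gs) else None)"
| prec: "partrec n g \<Longrightarrow> partrec (n + 2) h \<Longrightarrow>
    partrec (Suc n)
      (\<lambda>xs. rec_nat (g (tl xs))
              (\<lambda>m r. case r of None \<Rightarrow> None | Some v \<Rightarrow> h (m # v # tl xs)) (hd xs))"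
| mu: "partrec (Suc n) f \<Longrightarrow>
    partrec n (\<lambda>xs. if \<exists>k. mu_at f xs k then Some (THE k. mu_at f xs k) else None)"

definition partrec1 :: "(nat \<Rightarrow> nat option) \<Rightarrow> bool" where
  "partrec1 \<psi> \<longleftrightarrow> (\<exists>F. partrec 1 F \<and> (\<forall>y. \<psi> y = F [y]))"

text \<open>A standard enumeration of the unary partial recursive functions is taken to be an acceptable
  numbering in the sense of Rogers: it has a partial recursive universal function and admits
  effective parametrization (s-m-n).\<close>

definition standard_enumeration :: "(nat \<Rightarrow> nat \<Rightarrow> nat option) \<Rightarrow> bool" where
  "standard_enumeration \<phi> \<longleftrightarrow>
     range \<phi> = {\<psi>. partrec1 \<psi>}
   \<and> (\<exists>U. partrec 2 U \<and> (\<forall>x y. U [x, y] = \<phi> x y))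
   \<and> (\<forall>F. partrec 2 F \<longrightarrow>
        (\<exists>s. partrec1 (\<lambda>x. Some (s x)) \<and> (\<forall>x y. \<phi> (s x) y = F [x, y])))"

text \<open>\<open>H x y k\<close> reads: the computation of \<open>\<phi> x y\<close> halts within \<open>k\<close> steps.\<close>

definition step_predicate ::
  "(nat \<Rightarrow> nat \<Rightarrow> nat option) \<Rightarrow> (nat \<Rightarrow> nat \<Rightarrow> nat \<Rightarrow> bool) \<Rightarrow> bool" where
  "step_predicate \<phi> H \<longleftrightarrow>
     (\<exists>d. pr_wf 3 d \<and> (\<forall>x y k. pr_eval d [x, y, k] = (if H x y k then 1 else 0)))
   \<and> (\<forall>x y k l. H x y k \<and> k \<le> l \<longrightarrow> H x y l)
   \<and> (\<forall>x y. (\<exists>k. H x y k) \<longleftrightarrow> \<phi> x y \<noteq> None)"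

text \<open>The pairing $\langle x, y \rangle$ is the library's Cantor pairing \<open>prod_encode\<close>, a bijection.\<close>

definition sfApp :: "(nat \<Rightarrow> nat \<Rightarrow> nat \<Rightarrow> bool) \<Rightarrow> nat \<Rightarrow> nat \<Rightarrow> nat" where
  "sfApp H p k = (case prod_decode p of (x, y) \<Rightarrow> if H x y k then 1 else 0)"

end

theory Submission
  imports Defs
begin

text \<open>
  The separating status judgments are found by diagonalization. Evaluate closed terms by head
  reduction, counting \<open>Univ \<cdot> f\<close> as true when all numeral instances of \<open>f\<close> are true \<^emph>\<open>and\<close> RGA proves
  \<open>Univ \<cdot> f\<close>. RGA is sound for this evaluation, and conversely every closed term that evaluates to
  \<open>n\<close> is provably equal to \<open>num n\<close>. So if RGA proves \<open>isB c\<close>, it proves \<open>c\<close> or \<open>Neg c\<close>, and for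
  \<open>c = rrep sf \<cdot> num n\<close> the answer tells correctly whether the search at \<open>n\<close> hits. If RGA proved the
  status of all these sentences, then the diagonal search at \<open>\<langle>x, x\<rangle>\<close> would fail exactly when RGA
  proves \<open>Neg (rrep sf \<cdot> num \<langle>x, x\<rangle>)\<close>. Derivability in RGA is recursively enumerable, so the
  complement of the halting problem would be, too. In OGA the status judgments are derivable because RGA
  proves by induction that compiled primitive recursive functions take numerical values, so that
  every instance of the matrix is decided and ATI applies.
\<close>

section \<open>Total computable functions\<close>

text \<open>The provability clause is what separates the two systems: a universal all of whose
  instances are true, but which RGA does not prove, has no value at all, so ATI can lead from a
  valid premise to an invalid conclusion. The clause also makes soundness a statement about
  derivations rather than about single rules: at \<open>allI\<close> one needs that the conclusion
  has itself been derived. The main obstacle is \<open>eq_subst\<close>, which replaces equal terms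
  anywhere, under binders and inside the arguments of recursors; its soundness rests on a simulation
  between evaluations and on the fact that a term with a numerical value cannot also act as a
  function.

  That derivability is recursively enumerable has to be established from the definition of partial
  recursive functions. Types are coded bijectively by numbers, and relations are written as formulas
  whose connectives preserve decidability or semidecidability. Total functions whose graph is
  semidecidable are computable, so substitution and the rules can be described rather than
  programmed. The number \<open>n\<close> is obtained by contradiction; no particular sentence is
  exhibited.\<close>

definition tc :: "nat \<Rightarrow> (nat list \<Rightarrow> nat) \<Rightarrow> bool" where
  "tc n f \<longleftrightarrow> (\<exists>F. partrec n F \<and> (\<forall>xs. length xs = n \<longrightarrow> F xs = Some (f xs)))"

lemma tcI: "partrec n F \<Longrightarrow> (\<And>xs. length xs = n \<Longrightarrow> F xs = Some (f xs)) \<Longrightarrow> tc n f"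
  unfolding tc_def by blast

lemma tc_cong: "tc n f \<Longrightarrow> (\<And>xs. length xs = n \<Longrightarrow> f xs = g xs) \<Longrightarrow> tc n g"
  unfolding tc_def by metis

lemma tc_zero: "tc n (\<lambda>xs. 0)"
  unfolding tc_def using partrec.zero by blast

lemma tc_succ: "tc 1 (\<lambda>xs. Suc (xs ! 0))"
  unfolding tc_def using partrec.succ by blast

lemma tc_proj: "i < n \<Longrightarrow> tc n (\<lambda>xs. xs ! i)"
  unfolding tc_def using partrec.proj by blast

lemma tc_comp:
  assumes "tc (length gs) f" "\<forall>g \<in> set gs. tc n g"
  shows "tc n (\<lambda>xs. f (map (\<lambda>g. g xs) gs))"
proof -
  obtain F where F: "partrec (length gs) F" "\<And>xs. length xs = length gs \<Longrightarrow> F xs = Some (f xs)"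
    using assms(1) unfolding tc_def by auto
  obtain G where G: "\<And>g. g \<in> set gs \<Longrightarrow> partrec n (G g) \<and> (\<forall>xs. length xs = n \<longrightarrow> G g xs = Some (g xs))"
    using assms(2) unfolding tc_def by metis
  let ?gs = "map G gs"
  have "partrec n (\<lambda>xs. if \<forall>g \<in> set ?gs. g xs \<noteq> None
                    then F (map (\<lambda>g. the (g xs)) ?gs) else None)"
    using F(1) G by (intro partrec.comp) auto
  moreover have "map (\<lambda>g. the (g xs)) ?gs = map (\<lambda>g. g xs) gs" if "length xs = n" for xs
    using G that by auto
  ultimately show ?thesis
    using F(2) G by (elim tcI) (auto simp del: map_map)
qed

lemma tc_comp1: "tc 1 f \<Longrightarrow> tc n g \<Longrightarrow> tc n (\<lambda>xs. f [g xs])"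
  using tc_comp[of "[g]" f n] by simp

lemma tc_prec:
  assumes "tc n g" "tc (n + 2) h"
  shows "tc (Suc n) (\<lambda>xs. rec_nat (g (tl xs)) (\<lambda>m r. h (m # r # tl xs)) (hd xs))"
proof -
  obtain G where G: "partrec n G" "\<And>xs. length xs = n \<Longrightarrow> G xs = Some (g xs)"
    using assms(1) unfolding tc_def by auto
  obtain H where H: "partrec (n + 2) H" "\<And>xs. length xs = n + 2 \<Longrightarrow> H xs = Some (h xs)"
    using assms(2) unfolding tc_def by auto
  have "rec_nat (G ys) (\<lambda>m r. case r of None \<Rightarrow> None | Some v \<Rightarrow> H (m # v # ys)) k
      = Some (rec_nat (g ys) (\<lambda>m r. h (m # r # ys)) k)" if "length ys = n" for k ys
    by (induction k) (use G(2) H(2) that in auto)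
  then show ?thesis
    by (intro tcI[OF partrec.prec[OF G(1) H(1)]]) auto
qed

text \<open>On a total function every value below the least zero is defined and positive, as
  \<open>mu_at\<close> demands, and two numbers satisfying \<open>mu_at\<close> would contradict
  each other at the smaller one. So its \<open>THE\<close> is the \<open>LEAST\<close>.\<close>

lemma tc_least:
  assumes "tc (Suc n) f" "\<And>xs. length xs = n \<Longrightarrow> \<exists>k. f (k # xs) = 0"
  shows "tc n (\<lambda>xs. LEAST k. f (k # xs) = 0)"
proof -
  obtain F where F: "partrec (Suc n) F" "\<And>xs. length xs = Suc n \<Longrightarrow> F xs = Some (f xs)"
    using assms(1) unfolding tc_def by auto
  have *: "mu_at F xs (LEAST k. f (k # xs) = 0)" if "length xs = n" for xs
    unfolding mu_at_def using F(2) that LeastI_ex[OF assms(2)[OF that]] not_less_Least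
    by (auto intro!: not0_implies_Suc)
  have **: "k = l" if "mu_at F xs k" "mu_at F xs l" for xs k l
  proof (rule linorder_cases[of k l])
    assume "k < l" then show ?thesis using that unfolding mu_at_def by fastforce
  next
    assume "l < k" then show ?thesis using that unfolding mu_at_def by fastforce
  qed
  have "(THE k. mu_at F xs k) = (LEAST k. f (k # xs) = 0)" if "length xs = n" for xs
    using * ** that by blast
  then show ?thesis
    using * by (intro tcI[OF partrec.mu[OF F(1)]]) auto
qed

lemma tc_Suc: "tc n f \<Longrightarrow> tc n (\<lambda>xs. Suc (f xs))"
  using tc_comp1[OF tc_succ] by simp

lemma tc_const: "tc n (\<lambda>xs. c)"
  by (induction c) (auto intro: tc_zero tc_Suc)

text \<open>The scheme of \<open>prec\<close> takes the recursion depth as its first argument; here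
  the depth may be any computable function of the arguments, and the step still sees all of
  them.\<close>

lemma tc_rec_nat:
  assumes "tc n g" "tc n f" "tc (n + 2) (\<lambda>xs. h (xs ! 0) (xs ! 1) (drop 2 xs))"
  shows "tc n (\<lambda>xs. rec_nat (g xs) (\<lambda>m r. h m r xs) (f xs))"
proof -
  \<comment> \<open>Composition with these functions puts the computed depth in front of an
    unchanged copy of the argument list.\<close>
  let ?ps = "f # map (\<lambda>i xs. xs ! i) [0..<n]"
  have "tc (Suc n) (\<lambda>xs. rec_nat (g (tl xs)) (\<lambda>m r. h m r (tl xs)) (hd xs))"
    using tc_prec[OF assms(1,3)] by simp
  then have "tc (length ?ps) (\<lambda>xs. rec_nat (g (tl xs)) (\<lambda>m r. h m r (tl xs)) (hd xs))"
    by simp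
  from tc_comp[OF this, of n] have
    "tc n (\<lambda>xs. rec_nat (g (map (\<lambda>i. xs ! i) [0..<n])) (\<lambda>m r. h m r (map (\<lambda>i. xs ! i) [0..<n])) (f xs))"
    using assms(2) by (auto simp: tc_proj comp_def)
  then show ?thesis
    by (rule tc_cong) (use map_nth in metis)
qed

lemma tc_add: "tc n f \<Longrightarrow> tc n g \<Longrightarrow> tc n (\<lambda>xs. f xs + g xs)"
proof -
  assume *: "tc n f" "tc n g"
  have "rec_nat a (\<lambda>m r. Suc r) b = a + b" for a b by (induction b) auto
  then show ?thesis
    using tc_rec_nat[OF *, of "\<lambda>m r xs. Suc r"] by (simp add: tc_Suc tc_proj)
qed

lemma tc_diff: "tc n f \<Longrightarrow> tc n g \<Longrightarrow> tc n (\<lambda>xs. f xs - g xs)"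
proof -
  have p: "rec_nat 0 (\<lambda>m r. m) b = b - 1" for b :: nat by (cases b) auto
  have pred: "tc n (\<lambda>xs. f xs - 1)" if "tc n f" for n f
    using tc_rec_nat[OF tc_zero that, of "\<lambda>m r xs. m"] unfolding p by (simp add: tc_proj)
  assume *: "tc n f" "tc n g"
  have "rec_nat a (\<lambda>m r. r - 1) b = a - b" for a b :: nat by (induction b) auto
  then show ?thesis
    using tc_rec_nat[OF *, of "\<lambda>m r xs. r - 1"] pred by (simp add: tc_proj)
qed

lemma tc_triangle: "tc n f \<Longrightarrow> tc n (\<lambda>xs. triangle (f xs))"
proof -
  assume *: "tc n f"
  have "rec_nat 0 (\<lambda>m r. r + Suc m) b = triangle b" for b by (induction b) auto
  then show ?thesis
    using tc_rec_nat[OF tc_zero *, of "\<lambda>m r xs. r + Suc m"] by (simp add: tc_add tc_Suc tc_proj)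
qed

lemma tc_prod_encode: "tc n f \<Longrightarrow> tc n g \<Longrightarrow> tc n (\<lambda>xs. prod_encode (f xs, g xs))"
  by (simp add: prod_encode_def tc_triangle tc_add)

text \<open>The index \<open>a + b\<close> of the diagonal containing \<open>n = prod_encode (a, b)\<close> is the least \<open>s\<close> with
  \<open>n < triangle (s + 1)\<close>.\<close>

lemma prod_decode_least:
  fixes n
  defines "s \<equiv> LEAST s. Suc n - triangle (Suc s) = 0"
  shows "prod_decode n = (n - triangle s, s - (n - triangle s))"
proof -
  obtain a b where ab: "prod_decode n = (a, b)" by force
  then have n: "n = triangle (a + b) + a"
    using prod_decode_inverse[of n] by (simp add: prod_encode_def)
  have mono: "triangle i \<le> triangle j" if "i \<le> j" for i j
    using that by (induction rule: dec_induct) auto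
  have "s = a + b" unfolding s_def
  proof (rule Least_equality)
    fix y assume "Suc n - triangle (Suc y) = 0"
    then have "n < triangle (Suc y)" by simp
    then show "a + b \<le> y"
      using mono[of "Suc y" "a + b"] n by (cases "a + b \<le> y") auto
  qed (use n in auto)
  then show ?thesis using ab n by simp
qed

lemma tc_prod_decode:
  assumes "tc n f"
  shows "tc n (\<lambda>xs. fst (prod_decode (f xs)))" "tc n (\<lambda>xs. snd (prod_decode (f xs)))"
proof -
  define s where "s n = (LEAST s. Suc n - triangle (Suc s) = 0)" for n
  have ex: "\<exists>k. Suc n - triangle (Suc k) = 0" for n
    by (rule exI[of _ n]) simp
  have "tc 1 (\<lambda>xs. s (xs ! 0))"
    unfolding s_def
    using tc_least[of 1 "\<lambda>xs. Suc (xs ! 1) - triangle (Suc (xs ! 0))"] ex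
    by (simp add: tc_diff tc_triangle tc_Suc tc_proj del: triangle_Suc)
  from tc_comp1[OF this assms] have s: "tc n (\<lambda>xs. s (f xs))" by simp
  show "tc n (\<lambda>xs. fst (prod_decode (f xs)))" "tc n (\<lambda>xs. snd (prod_decode (f xs)))"
    unfolding prod_decode_least[folded s_def] using s assms
    by (simp_all add: tc_diff tc_triangle)
qed

section \<open>Computable functions and semidecidable predicates on coded types\<close>

text \<open>The coding is a bijection, so \<open>dec\<close> needs no default value and an
  existential over the type is a search through all numbers.\<close>

class coded =
  fixes enc :: "'a \<Rightarrow> nat"
  assumes bij_enc: "bij enc"

definition dec :: "nat \<Rightarrow> 'a::coded" where "dec = inv enc"

lemma dec_enc [simp]: "dec (enc x) = x"
  unfolding dec_def by (rule inv_f_f[OF bij_is_inj[OF bij_enc]])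

lemma enc_dec [simp]: "enc (dec n) = n"
  unfolding dec_def by (rule surj_f_inv_f[OF bij_is_surj[OF bij_enc]])

lemma enc_eq_iff [simp]: "enc x = enc y \<longleftrightarrow> x = y"
  by (metis dec_enc)

instantiation nat :: coded
begin
definition enc_nat :: "nat \<Rightarrow> nat" where [simp]: "enc_nat n = n"
instance by standard (simp add: bij_def inj_def surj_def)
end

lemma dec_nat [simp]: "dec n = (n :: nat)"
  by (metis enc_dec enc_nat_def)

instantiation prod :: (coded, coded) coded
begin
definition enc_prod :: "'a \<times> 'b \<Rightarrow> nat" where "enc_prod p = prod_encode (enc (fst p), enc (snd p))"
instance
proof
  show "bij (enc :: 'a \<times> 'b \<Rightarrow> nat)"
    by (rule bij_betw_byWitness[where f' = "\<lambda>n. (dec (fst (prod_decode n)), dec (snd (prod_decode n)))"])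
       (auto simp: enc_prod_def)
qed
end

instantiation list :: (coded) coded
begin
definition enc_list :: "'a list \<Rightarrow> nat" where "enc_list xs = list_encode (map enc xs)"
instance
proof
  show "bij (enc :: 'a list \<Rightarrow> nat)"
    by (rule bij_betw_byWitness[where f' = "\<lambda>n. map dec (list_decode n)"])
       (auto simp: enc_list_def comp_def)
qed
end

text \<open>The code of a set has binary digit 1 exactly at the codes of its members, which makes it
  independent of any order of listing.\<close>

instantiation fset :: (coded) coded
begin
definition enc_fset :: "'a fset \<Rightarrow> nat" where "enc_fset A = set_encode (enc ` fset A)"
instance
proof
  show "bij (enc :: 'a fset \<Rightarrow> nat)"
    by (rule bij_betw_byWitness[where f' = "\<lambda>n. Abs_fset (dec ` set_decode n)"])
       (auto simp: enc_fset_def image_image fset_inverse Abs_fset_inverse)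
qed
end

text \<open>Four constants take the codes 0 to 3, and the other seven constructors share the numbers
  from 4 on by their residue modulo 7. Hence every number is a code.\<close>

primrec tm_code :: "tm \<Rightarrow> nat" where
  "tm_code (Var i) = 4 + 7 * i"
| "tm_code Bot = 0"
| "tm_code Zr = 1"
| "tm_code (Sc t) = 5 + 7 * tm_code t"
| "tm_code (Eq t u) = 6 + 7 * prod_encode (tm_code t, tm_code u)"
| "tm_code (Neg t) = 7 + 7 * tm_code t"
| "tm_code (Or t u) = 8 + 7 * prod_encode (tm_code t, tm_code u)"
| "tm_code (Lam t) = 9 + 7 * tm_code t"
| "tm_code (t \<cdot> u) = 10 + 7 * prod_encode (tm_code t, tm_code u)"
| "tm_code Rec = 2"
| "tm_code Univ = 3"

lemma tm_code_inj: "tm_code t = tm_code u \<Longrightarrow> t = u"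
proof (induction t arbitrary: u)
  case (Var i) then show ?case by (cases u; simp; presburger?)
next
  case Bot then show ?case by (cases u; simp)
next
  case Zr then show ?case by (cases u; simp)
next
  case (Sc t) then show ?case by (cases u; simp; presburger?)
next
  case (Eq t u') then show ?case by (cases u; simp; presburger?)
next
  case (Neg t) then show ?case by (cases u; simp; presburger?)
next
  case (Or t u') then show ?case by (cases u; simp; presburger?)
next
  case (Lam t) then show ?case by (cases u; simp; presburger?)
next
  case (App t u') then show ?case by (cases u; simp; presburger?)
next
  case Rec then show ?case by (cases u; simp)
next
  case Univ then show ?case by (cases u; simp)
qed

lemma tm_code_surj: "\<exists>t. tm_code t = n"
proof (induction n rule: less_induct)
  case (less n)
  show ?case
  proof (cases "n < 4")
    case True
    then consider "n = 0" | "n = 1" | "n = 2" | "n = 3" by linarith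
    then show ?thesis
      by cases (use tm_code.simps(2,3,10,11) in \<open>blast+\<close>)
  next
    case False
    \<comment> \<open>The quotient is read as an index, as the code of one subterm, or as a pair of
      codes; the residue of \<open>n\<close> decides which reading applies.\<close>
    define m where "m = (n - 4) div 7"
    obtain a b where ab: "m = prod_encode (a, b)"
      by (metis prod_decode_inverse surj_pair)
    have m: "m < n" "a < n" "b < n"
      using False le_prod_encode_1[of a b] le_prod_encode_2[of b a] ab unfolding m_def by linarith+
    obtain t where t: "tm_code t = m" using less m by blast
    obtain u where u: "tm_code u = a" using less m by blast
    obtain v where v: "tm_code v = b" using less m by blast
    have "n = 4 + 7 * m \<or> n = 5 + 7 * m \<or> n = 6 + 7 * m \<or> n = 7 + 7 * m \<or>
          n = 8 + 7 * m \<or> n = 9 + 7 * m \<or> n = 10 + 7 * m"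
      using False unfolding m_def by presburger
    then show ?thesis
      using t u v ab tm_code.simps(1)[of m] tm_code.simps(4,6,8)[of t]
        tm_code.simps(5,7,9)[of u v] by metis
  qed
qed

instantiation tm :: coded
begin
definition enc_tm :: "tm \<Rightarrow> nat" where "enc_tm = tm_code"
instance
proof
  show "bij (enc :: tm \<Rightarrow> nat)"
    unfolding enc_tm_def by (metis bijI' tm_code_inj tm_code_surj)
qed
end

instantiation sequent :: coded
begin
definition enc_sequent :: "sequent \<Rightarrow> nat" where
  "enc_sequent j = (case j of (\<Gamma> \<turnstile> c) \<Rightarrow> prod_encode (enc \<Gamma>, enc c))"
instance
proof
  show "bij (enc :: sequent \<Rightarrow> nat)"
    by (rule bij_betw_byWitness[where f' = "\<lambda>n. dec (fst (prod_decode n)) \<turnstile> dec (snd (prod_decode n))"])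
       (auto simp: enc_sequent_def split: sequent.split)
qed
end

text \<open>A single argument suffices, since further ones become components of a pair. Closure
  rules can then follow the structure of the function body, without bookkeeping of arities.\<close>

definition comput :: "('a::coded \<Rightarrow> 'b::coded) \<Rightarrow> bool" where
  "comput f \<longleftrightarrow> tc 1 (\<lambda>xs. enc (f (dec (xs ! 0))))"

named_theorems comput_intros

lemma comput_comp: "comput f \<Longrightarrow> comput g \<Longrightarrow> comput (\<lambda>x. f (g x))"
  unfolding comput_def using tc_comp1 by fastforce

lemma comput_id [comput_intros]: "comput (\<lambda>x. x)"
  unfolding comput_def by (simp add: tc_proj)

lemma comput_const [comput_intros]: "comput (\<lambda>x. c)"
  unfolding comput_def by (rule tc_const)

lemma comput_Pair [comput_intros]: "comput f \<Longrightarrow> comput g \<Longrightarrow> comput (\<lambda>x. (f x, g x))"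
  unfolding comput_def by (simp add: enc_prod_def tc_prod_encode)

lemma dec_prod: "dec n = (dec (fst (prod_decode n)), dec (snd (prod_decode n)))"
proof -
  have "n = enc (dec (fst (prod_decode n)) :: 'a, dec (snd (prod_decode n)) :: 'b)"
    by (simp add: enc_prod_def)
  then show ?thesis by (metis dec_enc)
qed

lemma comput_fst [comput_intros]: "comput f \<Longrightarrow> comput (\<lambda>x. fst (f x))"
  by (rule comput_comp[of fst]) (auto simp: comput_def dec_prod tc_prod_decode tc_proj)

lemma comput_snd [comput_intros]: "comput f \<Longrightarrow> comput (\<lambda>x. snd (f x))"
  by (rule comput_comp[of snd]) (auto simp: comput_def dec_prod tc_prod_decode tc_proj)

lemma comput_enc [comput_intros]: "comput f \<Longrightarrow> comput (\<lambda>x. enc (f x))"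
  by (simp add: comput_def)

lemma comput_dec [comput_intros]: "comput f \<Longrightarrow> comput (\<lambda>x. dec (f x))"
  by (simp add: comput_def)

lemma comput_Suc [comput_intros]: "comput f \<Longrightarrow> comput (\<lambda>x. Suc (f x))"
  by (simp add: comput_def tc_Suc)

lemma comput_add [comput_intros]: "comput f \<Longrightarrow> comput g \<Longrightarrow> comput (\<lambda>x. f x + g x :: nat)"
  by (simp add: comput_def tc_add)

lemma comput_diff [comput_intros]: "comput f \<Longrightarrow> comput g \<Longrightarrow> comput (\<lambda>x. f x - g x :: nat)"
  by (simp add: comput_def tc_diff)

lemma comput_rec_nat [comput_intros]:
  fixes g :: "'a::coded \<Rightarrow> 'b::coded"
  assumes "comput f" "comput g" "comput (\<lambda>z. h (fst z) (fst (snd z)) (snd (snd z)))"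
  shows "comput (\<lambda>x. rec_nat (g x) (h x) (f x))"
proof -
  define k where "k z = h (fst z) (fst (snd z)) (snd (snd z))" for z
  \<comment> \<open>\<open>tc_rec_nat\<close> passes counter, previous value and parameters in this
    order, whereas \<open>h\<close> expects the parameter first; the nested pair reorders
    them.\<close>
  have "tc 3 (\<lambda>xs. prod_encode (xs ! 2, prod_encode (xs ! 0, xs ! 1)))"
    by (simp add: tc_prod_encode tc_proj)
  from tc_comp1[OF assms(3)[unfolded comput_def] this]
  have 1: "tc 3 (\<lambda>xs. enc (h (dec (xs ! 2)) (xs ! 0) (dec (xs ! 1))))"
    by (simp add: dec_prod)
  have 2: "tc (1 + 2) (\<lambda>xs. enc (h (dec (drop 2 xs ! 0)) (xs ! 0) (dec (xs ! 1))))"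
    unfolding one_plus_numeral by (simp only: semiring_norm, rule tc_cong[OF 1]) simp
  \<comment> \<open>Each intermediate value is decoded before and encoded after a step, so a
    recursion on values becomes one on their codes.\<close>
  have 3: "enc (rec_nat a h' n) = rec_nat (enc a) (\<lambda>m r. enc (h' m (dec r))) n" for a :: 'b and h' n
    by (induction n) (auto, metis dec_enc)
  show ?thesis
    unfolding comput_def 3
    by (rule tc_rec_nat[OF _ _ 2]) (use assms(1,2) in \<open>simp_all add: comput_def\<close>)
qed

lemma comput_Least:
  fixes q :: "'a::coded \<Rightarrow> nat \<Rightarrow> nat"
  assumes "comput (\<lambda>z. q (fst z) (snd z) :: nat)" "\<And>x. \<exists>k. q x k = 0"
  shows "comput (\<lambda>x. LEAST k. q x k = 0)"
proof -
  \<comment> \<open>Minimization varies the first argument, while \<open>q\<close> has the searched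
    number as its second one.\<close>
  have "tc 2 (\<lambda>xs. prod_encode (xs ! 1, xs ! 0))"
    by (simp add: tc_prod_encode tc_proj)
  from tc_comp1[OF assms(1)[unfolded comput_def] this]
  have "tc (Suc 1) (\<lambda>xs. q (dec (xs ! 1)) (xs ! 0))"
    by (simp add: dec_prod numeral_2_eq_2)
  from tc_least[OF this] show ?thesis
    unfolding comput_def using assms(2) by simp
qed

text \<open>Truth is the value 0, so that minimization finds the least number with the
  property.\<close>

definition decid :: "('a::coded \<Rightarrow> bool) \<Rightarrow> bool" where
  "decid P \<longleftrightarrow> comput (\<lambda>x. if P x then 0 else 1 :: nat)"

named_theorems decid_intros

lemma comput_if [comput_intros]:
  assumes "decid P" "comput f" "comput g"
  shows "comput (\<lambda>x. if P x then f x else g x)"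
proof -
  have *: "comput (\<lambda>z. g (fst z))" by (rule comput_comp[OF assms(3)]) (intro comput_intros)
  \<comment> \<open>Recursion of length 0 or 1 acts as a conditional: no step leaves
    \<open>f x\<close>, one step replaces it by \<open>g x\<close>.\<close>
  have "comput (\<lambda>x. rec_nat (f x) (\<lambda>_ _. g x) (if P x then 0 else 1))"
    using assms * unfolding decid_def by (intro comput_rec_nat)
  moreover have "rec_nat (f x) (\<lambda>_ _. g x) (if P x then 0 else 1) = (if P x then f x else g x)" for x
    by simp
  ultimately show ?thesis by simp
qed

lemma decid_comp: "decid P \<Longrightarrow> comput f \<Longrightarrow> decid (\<lambda>x. P (f x))"
  unfolding decid_def by (rule comput_comp)

lemma decid_eq0: "comput f \<Longrightarrow> decid (\<lambda>x. f x = (0::nat))"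
proof -
  assume "comput f"
  then have "comput (\<lambda>x. 1 - (1 - f x))" by (intro comput_intros)
  moreover have "1 - (1 - f x) = (if f x = 0 then 0 else 1)" for x by simp
  ultimately show ?thesis unfolding decid_def by simp
qed

lemma decid_not [decid_intros]: "decid P \<Longrightarrow> decid (\<lambda>x. \<not> P x)"
proof -
  assume "decid P"
  then have "comput (\<lambda>x. if P x then 1 else 0 :: nat)" by (intro comput_intros)
  moreover have "(if P x then 1 else 0 :: nat) = (if \<not> P x then 0 else 1)" for x by simp
  ultimately show ?thesis unfolding decid_def by simp
qed

lemma decid_conj [decid_intros]: "decid P \<Longrightarrow> decid Q \<Longrightarrow> decid (\<lambda>x. P x \<and> Q x)"
proof -
  assume *: "decid P" "decid Q"
  have "comput (\<lambda>x. if P x then if Q x then 0 else 1 else 1 :: nat)"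
    using * by (intro comput_intros)
  moreover have "(if P x then if Q x then 0 else 1 else 1 :: nat) = (if P x \<and> Q x then 0 else 1)" for x
    by simp
  ultimately show ?thesis unfolding decid_def by simp
qed

lemma decid_disj [decid_intros]: "decid P \<Longrightarrow> decid Q \<Longrightarrow> decid (\<lambda>x. P x \<or> Q x)"
  using decid_not[OF decid_conj[OF decid_not[of P] decid_not[of Q]]] by simp

lemma decid_const [decid_intros]: "decid (\<lambda>x. P)"
  unfolding decid_def by (rule comput_const)

lemma decid_less [decid_intros]: "comput f \<Longrightarrow> comput g \<Longrightarrow> decid (\<lambda>x. f x < (g x :: nat))"
  using decid_eq0[of "\<lambda>x. Suc (f x) - g x"] by (simp add: comput_intros Suc_le_eq)

lemma decid_eq [decid_intros]: "comput f \<Longrightarrow> comput g \<Longrightarrow> decid (\<lambda>x. f x = g x)"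
proof -
  assume "comput f" "comput g"
  then have "decid (\<lambda>x. (enc (f x) - enc (g x)) + (enc (g x) - enc (f x)) = 0)"
    by (intro decid_eq0 comput_intros)
  moreover have "(enc (f x) - enc (g x)) + (enc (g x) - enc (f x)) = 0 \<longleftrightarrow> f x = g x" for x
    using enc_eq_iff[of "f x" "g x"] by linarith
  ultimately show ?thesis by simp
qed

lemma decid_bex [decid_intros]:
  assumes "comput b" "decid (\<lambda>z. P (fst z) (snd z))"
  shows "decid (\<lambda>x. \<exists>i < b x :: nat. P x i)"
proof -
  have *: "rec_nat 1 (\<lambda>m r. if P x m then 0 else r) n = (if \<exists>i<n. P x i then 0 else 1 :: nat)" for x n
    by (induction n) (auto simp: less_Suc_eq)
  have "decid (\<lambda>z. P (fst z) (fst (snd z)))"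
    using decid_comp[OF assms(2), of "\<lambda>z. (fst z, fst (snd z))"] by (simp add: comput_intros)
  then have "comput (\<lambda>x. rec_nat (1::nat) (\<lambda>m r. if P x m then 0 else r) (b x))"
    by (intro comput_intros assms(1))
  then show ?thesis unfolding decid_def * .
qed

lemma decid_ball [decid_intros]:
  assumes "comput b" "decid (\<lambda>z. P (fst z) (snd z))"
  shows "decid (\<lambda>x. \<forall>i < b x :: nat. P x i)"
  using decid_not[OF decid_bex[OF assms(1) decid_not[OF assms(2)]]] by simp

lemma comput_choose:
  fixes q :: "'a::coded \<Rightarrow> 'b::coded \<Rightarrow> bool"
  assumes "decid (\<lambda>z. q (fst z) (snd z))" "\<And>x. \<exists>y. q x y"
  shows "\<exists>g. comput g \<and> (\<forall>x. q x (g x))"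
proof -
  define r where "r x n = (if q x (dec n) then 0 else 1 :: nat)" for x n
  have ex: "\<exists>k. r x k = 0" for x
    using assms(2)[of x] unfolding r_def by (metis dec_enc)
  have "decid (\<lambda>z. q (fst z) (dec (snd z)))"
    using decid_comp[OF assms(1), of "\<lambda>z. (fst z, dec (snd z))"] by (simp add: comput_intros)
  then have "comput (\<lambda>z. r (fst z) (snd z))" unfolding r_def decid_def .
  then have "comput (\<lambda>x. dec (LEAST k. r x k = 0) :: 'b)"
    by (intro comput_dec comput_Least ex)
  moreover have "q x (dec (LEAST k. r x k = 0))" for x
    using LeastI_ex[OF ex[of x]] unfolding r_def by (metis zero_neq_one)
  ultimately show ?thesis by blast
qed

section \<open>Semidecidable predicates and their closure properties\<close>

definition semi :: "('a::coded \<Rightarrow> bool) \<Rightarrow> bool" where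
  "semi P \<longleftrightarrow> (\<exists>q :: 'a \<times> nat \<Rightarrow> bool. decid q \<and> (\<forall>x. P x \<longleftrightarrow> (\<exists>k. q (x, k))))"

named_theorems semi_intros

lemma semiI:
  fixes q :: "'a::coded \<times> 'b::coded \<Rightarrow> bool"
  assumes "decid q" "\<And>x. P x \<longleftrightarrow> (\<exists>y. q (x, y))"
  shows "semi P"
proof -
  have "decid (\<lambda>z. q (fst z, dec (snd z)))"
    by (rule decid_comp[OF assms(1)]) (intro comput_intros)
  moreover have "P x \<longleftrightarrow> (\<exists>k. q (x, dec k))" for x
    using assms(2) by (metis dec_enc)
  ultimately show ?thesis unfolding semi_def by fastforce
qed

lemma semiE:
  assumes "semi P"
  obtains q :: "'a::coded \<times> nat \<Rightarrow> bool" where "decid q" "\<And>x. P x \<longleftrightarrow> (\<exists>k. q (x, k))"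
  using assms unfolding semi_def by blast

lemma semi_decid: "decid P \<Longrightarrow> semi P"
  by (rule semiI[where q = "\<lambda>z. P (fst z)" and 'b = nat], rule decid_comp)
     (auto intro: comput_intros)

lemmas [semi_intros] = semi_decid[OF decid_eq] semi_decid[OF decid_not[OF decid_eq]]
  semi_decid[OF decid_less] semi_decid[OF decid_const]

lemma semi_comp:
  assumes "semi P" "comput f"
  shows "semi (\<lambda>x. P (f x))"
proof -
  obtain q where q: "decid q" "\<And>x. P x \<longleftrightarrow> (\<exists>k::nat. q (x, k))" using semiE[OF assms(1)] by blast
  have f: "comput (\<lambda>z. f (fst z))" by (rule comput_comp[OF assms(2)]) (intro comput_intros)
  have "decid (\<lambda>z. q (f (fst z), snd z))"
    by (rule decid_comp[OF q(1)]) (intro comput_intros f)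
  then show ?thesis by (rule semiI) (simp add: q(2))
qed

lemma semi_comp2:
  "semi (\<lambda>z. P (fst z) (snd z)) \<Longrightarrow> comput f \<Longrightarrow> comput g \<Longrightarrow> semi (\<lambda>x. P (f x) (g x))"
  by (drule semi_comp[of _ "\<lambda>x. (f x, g x)"]) (auto intro: comput_intros)

lemma semi_ex [semi_intros]:
  fixes P :: "'a::coded \<Rightarrow> 'b::coded \<Rightarrow> bool"
  assumes "semi (\<lambda>z. P (fst z) (snd z))"
  shows "semi (\<lambda>x. \<exists>y. P x y)"
proof -
  obtain q where q: "decid q" "\<And>z. P (fst z) (snd z) \<longleftrightarrow> (\<exists>k::nat. q (z, k))"
    using semiE[OF assms] by metis
  have "decid (\<lambda>z. q ((fst z, fst (snd z)), snd (snd z)))"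
    by (rule decid_comp[OF q(1)]) (intro comput_intros)
  moreover have "P x y \<longleftrightarrow> (\<exists>k. q ((x, y), k))" for x y
    using q(2)[of "(x, y)"] by simp
  ultimately show ?thesis by (elim semiI) auto
qed

lemma semi_conj [semi_intros]:
  assumes "semi P" "semi Q"
  shows "semi (\<lambda>x. P x \<and> Q x)"
proof -
  obtain p where p: "decid p" "\<And>x. P x \<longleftrightarrow> (\<exists>k::nat. p (x, k))" using semiE[OF assms(1)] by blast
  obtain q where q: "decid q" "\<And>x. Q x \<longleftrightarrow> (\<exists>k::nat. q (x, k))" using semiE[OF assms(2)] by blast
  have "decid (\<lambda>z. p (fst z, fst (snd z)) \<and> q (fst z, snd (snd z)))"
    by (intro decid_conj decid_comp[OF p(1)] decid_comp[OF q(1)] comput_intros)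
  then show ?thesis by (rule semiI) (auto simp: p(2) q(2))
qed

lemma semi_disj [semi_intros]:
  assumes "semi P" "semi Q"
  shows "semi (\<lambda>x. P x \<or> Q x)"
proof -
  obtain p where p: "decid p" "\<And>x. P x \<longleftrightarrow> (\<exists>k::nat. p (x, k))" using semiE[OF assms(1)] by blast
  obtain q where q: "decid q" "\<And>x. Q x \<longleftrightarrow> (\<exists>k::nat. q (x, k))" using semiE[OF assms(2)] by blast
  have "decid (\<lambda>z. p z \<or> q z)"
    by (intro decid_disj p(1) q(1))
  then show ?thesis by (rule semiI) (auto simp: p(2) q(2))
qed

text \<open>Finitely many witnesses have a common bound, so the bounded universal and the
  existential quantifier can be exchanged: a single number \<open>K\<close> is searched for, and the
  witness for each \<open>i\<close> is sought below it.\<close>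

lemma semi_ball [semi_intros]:
  assumes "comput b" "semi (\<lambda>z. P (fst z) (snd z))"
  shows "semi (\<lambda>x. \<forall>i < b x :: nat. P x i)"
proof -
  obtain q where q: "decid q" "\<And>z. P (fst z) (snd z) \<longleftrightarrow> (\<exists>k::nat. q (z, k))"
    using semiE[OF assms(2)] by metis
  have q': "P x i \<longleftrightarrow> (\<exists>k. q ((x, i), k))" for x i
    using q(2)[of "(x, i)"] by simp
  have b: "comput (\<lambda>z. b (fst z))" by (rule comput_comp[OF assms(1)]) (intro comput_intros)
  have "decid (\<lambda>z. \<forall>i < b (fst z). \<exists>k < snd z. q ((fst z, i), k))"
    by (intro decid_ball decid_bex decid_comp[OF q(1)] b comput_intros)
  then show ?thesis
  proof (rule semiI)
    fix x
    show "(\<forall>i < b x. P x i) \<longleftrightarrow> (\<exists>K. \<forall>i < b (fst (x, K)). \<exists>k < snd (x, K). q ((fst (x, K), i), k))"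
    proof
      assume "\<forall>i < b x. P x i"
      then have "\<forall>i < b x. \<exists>k. q ((x, i), k)" unfolding q' .
      then obtain k where k: "\<And>i. i < b x \<Longrightarrow> q ((x, i), k i)" by metis
      obtain K where K: "\<And>i. i < b x \<Longrightarrow> k i < K"
        using finite_nat_set_iff_bounded[of "k ` {..<b x}"] by auto
      show "\<exists>K. \<forall>i < b (fst (x, K)). \<exists>k < snd (x, K). q ((fst (x, K), i), k)"
        by (rule exI[of _ K]) (use k K in auto)
    next
      assume "\<exists>K. \<forall>i < b (fst (x, K)). \<exists>k < snd (x, K). q ((fst (x, K), i), k)"
      then show "\<forall>i < b x. P x i" unfolding q' by auto
    qed
  qed
qed

text \<open>Search simultaneously for the value and for a witness that it is the value; totality
  makes the search succeed. This reduces the computability of many functions below to a formula for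
  their graph.\<close>

lemma comput_graph:
  assumes "semi (\<lambda>z. f (fst z) = snd z)"
  shows "comput f"
proof -
  obtain q where q: "decid q" "\<And>z. f (fst z) = snd z \<longleftrightarrow> (\<exists>k::nat. q (z, k))"
    using semiE[OF assms] by metis
  have "decid (\<lambda>z. q ((fst z, fst (snd z)), snd (snd z)))"
    by (rule decid_comp[OF q(1)]) (intro comput_intros)
  moreover have "\<exists>y. q ((x, fst y), snd y)" for x
    using q(2)[of "(x, f x)"] by auto
  ultimately obtain g where g: "comput g" "\<And>x. q ((x, fst (g x)), snd (g x))"
    using comput_choose[of "\<lambda>x y. q ((x, fst y), snd y)"] by auto
  have "f = (\<lambda>x. fst (g x))" using g(2) q(2) by fastforce
  then show ?thesis using g(1) by (simp add: comput_intros)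
qed

section \<open>Computability of list operations\<close>

lemma comput_Cons [comput_intros]: "comput f \<Longrightarrow> comput g \<Longrightarrow> comput (\<lambda>x. f x # g x)"
  unfolding comput_def by (simp add: enc_list_def tc_Suc tc_prod_encode)

lemma comput_tl [comput_intros]: "comput f \<Longrightarrow> comput (\<lambda>x. tl (f x))"
proof (rule comput_comp[of tl])
  have *: "tl xs = ys \<longleftrightarrow> xs = [] \<and> ys = [] \<or> (\<exists>x. xs = x # ys)" for xs ys :: "'b list"
    by (cases xs) auto
  show "comput (tl :: 'b list \<Rightarrow> _)"
    by (rule comput_graph, subst *) (intro semi_intros comput_intros)
qed

lemma comput_drop [comput_intros]: "comput f \<Longrightarrow> comput g \<Longrightarrow> comput (\<lambda>x. drop (f x) (g x))"
proof -
  assume *: "comput f" "comput g"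
  have "rec_nat xs (\<lambda>_ r. tl r) n = drop n xs" for n and xs :: "'b list"
    by (induction n) (auto simp: drop_Suc tl_drop)
  moreover have "comput (\<lambda>x. rec_nat (g x) (\<lambda>_ r. tl r) (f x))"
    by (intro comput_intros *)
  ultimately show ?thesis by simp
qed

lemma comput_length [comput_intros]: "comput f \<Longrightarrow> comput (\<lambda>x. length (f x))"
proof (rule comput_comp[of length])
  have *: "length xs = n \<longleftrightarrow> drop n xs = [] \<and> (\<forall>i<n. drop i xs \<noteq> [])" for xs :: "'b list" and n
    by auto (metis le_antisym linorder_not_less le_refl)
  show "comput (length :: 'b list \<Rightarrow> _)"
    by (rule comput_graph, subst *) (intro semi_intros comput_intros)
qed

section \<open>Sets generated by finitary rules\<close>

text \<open>Rule induction is available in this form, while \<open>deriv\<close> below describes the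
  same set by finite lists that can be searched for. Both are generic because they serve sequents,
  substitution and head steps alike.\<close>

inductive gen :: "('a list \<Rightarrow> 'a \<Rightarrow> bool) \<Rightarrow> 'a \<Rightarrow> bool" for R where
  gen: "R ps x \<Longrightarrow> \<forall>p \<in> set ps. gen R p \<Longrightarrow> gen R x"

definition deriv :: "('a list \<Rightarrow> 'a \<Rightarrow> bool) \<Rightarrow> 'a list \<Rightarrow> bool" where
  "deriv R js \<longleftrightarrow> (\<forall>i < length js. \<exists>ps. set ps \<subseteq> set (take i js) \<and> R ps (js ! i))"

lemma deriv_append: "deriv R xs \<Longrightarrow> deriv R ys \<Longrightarrow> deriv R (xs @ ys)"
  unfolding deriv_def[of _ "xs @ ys"]
proof (intro HOL.allI impI)
  fix i assume "deriv R xs" "deriv R ys" "i < length (xs @ ys)"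
  then have *: "\<forall>i < length xs. \<exists>ps. set ps \<subseteq> set (take i xs) \<and> R ps (xs ! i)"
    "\<forall>i < length ys. \<exists>ps. set ps \<subseteq> set (take i ys) \<and> R ps (ys ! i)" "i < length (xs @ ys)"
    unfolding deriv_def by simp_all
  show "\<exists>ps. set ps \<subseteq> set (take i (xs @ ys)) \<and> R ps ((xs @ ys) ! i)"
  proof (cases "i < length xs")
    case True
    then show ?thesis using *(1) by (auto simp: nth_append)
  next
    case False
    then have "i - length xs < length ys" using *(3) by simp
    then obtain ps where "set ps \<subseteq> set (take (i - length xs) ys)" "R ps (ys ! (i - length xs))"
      using *(2) by blast
    then show ?thesis using False by (intro exI[of _ ps]) (auto simp: nth_append)
  qed
qed

lemma gen_iff_deriv: "gen R x \<longleftrightarrow> (\<exists>js. deriv R js \<and> x \<in> set js)"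
proof
  show "\<exists>js. deriv R js \<and> x \<in> set js" if "gen R x"
    using that
  proof induction
    case (gen ps x)
    have "\<exists>js. deriv R js \<and> set qs \<subseteq> set js" if "set qs \<subseteq> set ps" for qs
      using that
    proof (induction qs)
      case Nil
      then show ?case by (auto simp: deriv_def intro: exI[of _ "[]"])
    next
      case (Cons q qs)
      then obtain js js' where "deriv R js" "set qs \<subseteq> set js" "deriv R js'" "q \<in> set js'"
        using gen by auto
      then show ?case by (intro exI[of _ "js @ js'"]) (auto intro: deriv_append)
    qed
    then obtain js where js: "deriv R js" "set ps \<subseteq> set js" by blast
    have "deriv R (js @ [x])"
      using js gen(1) unfolding deriv_def by (auto simp: nth_append less_Suc_eq)
    then show ?case by (intro exI[of _ "js @ [x]"]) simp
  qed
next
  assume "\<exists>js. deriv R js \<and> x \<in> set js"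
  then obtain js where js: "deriv R js" "x \<in> set js" by blast
  have "i < length js \<Longrightarrow> gen R (js ! i)" for i
  proof (induction i rule: less_induct)
    case (less i)
    then obtain ps where ps: "set ps \<subseteq> set (take i js)" "R ps (js ! i)"
      using js(1) unfolding deriv_def by blast
    have "gen R p" if "p \<in> set ps" for p
    proof -
      have "p \<in> set (take i js)" using ps(1) that by blast
      then obtain k where "k < i" "k < length js" "p = js ! k" by (auto simp: in_set_conv_nth)
      then show ?thesis using less.IH by blast
    qed
    then show ?case using ps(2) by (auto intro: gen.gen)
  qed
  then show "gen R x" using js(2) by (auto simp: in_set_conv_nth)
qed

lemma derivable_iff_gen: "derivable R j \<longleftrightarrow> gen R j"
  unfolding derivable_def is_proof_def gen_iff_deriv deriv_def ..

text \<open>A generated element is recognized by searching for a derivation list. All references to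
  lists are rewritten into equations with \<open>drop\<close> and quantifiers over positions, for
  which closure rules are available.\<close>

lemma semi_gen:
  assumes "semi (\<lambda>z. R (fst z) (snd z))"
  shows "semi (gen R)"
proof -
  \<comment> \<open>Such an equation fixes the entry and also certifies that the position lies
    within the list.\<close>
  have nth: "(i < length xs \<and> xs ! i = x) \<longleftrightarrow> (\<exists>ys. drop i xs = x # ys)" for i x and xs :: "'a list"
    by (metis Cons_nth_drop_Suc drop_eq_Nil linorder_not_less list.distinct(1) list.inject)
  have sub: "set ps \<subseteq> set (take i js) \<longleftrightarrow>
      (\<forall>l < length ps. \<exists>k p. k < i \<and> (\<exists>ys. drop k js = p # ys) \<and> (\<exists>ys. drop l ps = p # ys))"
    for ps js :: "'a list" and i
  proof -
    have "y \<in> set (take i js) \<longleftrightarrow> (\<exists>k < length js. k < i \<and> js ! k = y)" for y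
      by (fastforce simp: in_set_conv_nth)
    then show ?thesis
      unfolding nth[symmetric] subset_iff by (auto, metis nth_mem, metis in_set_conv_nth)
  qed
  have deriv: "deriv R js \<longleftrightarrow> (\<forall>i < length js. \<exists>j. (\<exists>ys. drop i js = j # ys) \<and>
        (\<exists>ps. (\<forall>l < length ps. \<exists>k p. k < i \<and> (\<exists>ys. drop k js = p # ys) \<and> (\<exists>ys. drop l ps = p # ys))
          \<and> R ps j))" for js
    unfolding deriv_def sub nth[symmetric] by simp
  have mem: "x \<in> set js \<longleftrightarrow> (\<exists>i ys. drop i js = x # ys)" for x and js :: "'a list"
    unfolding nth[symmetric] by (auto simp: in_set_conv_nth)
  have "semi (\<lambda>x. \<exists>js. deriv R js \<and> x \<in> set js)"
    unfolding deriv mem by (intro semi_intros comput_intros semi_comp2[OF assms])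
  then show ?thesis
    unfolding gen_iff_deriv[abs_def] .
qed

section \<open>Computability of operations on finite sets, terms and sequents\<close>

lemma comput_div2 [comput_intros]: "comput f \<Longrightarrow> comput (\<lambda>x. f x div 2 :: nat)"
proof (rule comput_comp[of "\<lambda>n. n div 2"])
  have *: "n div 2 = m \<longleftrightarrow> n = m + m \<or> n = Suc (m + m)" for n m :: nat by presburger
  show "comput (\<lambda>n. n div 2 :: nat)"
    by (rule comput_graph, subst *) (intro semi_intros comput_intros)
qed

text \<open>Halving the code of the set \<open>n\<close> times brings its binary digit at position
  \<open>n\<close> to the end, so membership is a test for oddness.\<close>

lemma decid_fmember [decid_intros]: "comput f \<Longrightarrow> comput g \<Longrightarrow> decid (\<lambda>x. f x |\<in>| g x)"
proof -
  assume *: "comput f" "comput g"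
  have h: "rec_nat (x div 2) (\<lambda>_ r. r div 2) n = rec_nat x (\<lambda>_ r. r div 2) n div 2" for n x :: nat
    by (induction n) auto
  have "n \<in> set_decode x \<longleftrightarrow> \<not> (rec_nat x (\<lambda>_ r. r div 2) n =
      rec_nat x (\<lambda>_ r. r div 2) n div 2 + rec_nat x (\<lambda>_ r. r div 2) n div 2)" for n x
  proof (induction n arbitrary: x)
    case 0
    show ?case by simp presburger
  next
    case (Suc n)
    show ?case unfolding set_decode_Suc Suc by (simp add: h)
  qed
  moreover have "x |\<in>| A \<longleftrightarrow> enc x \<in> set_decode (enc A)" for x :: 'b and A
    unfolding enc_fset_def by (auto simp: inj_image_mem_iff inj_def)
  ultimately show ?thesis
    by (simp only:) (intro decid_intros comput_intros *)
qed

text \<open>The digit of a member alone contributes \<open>2 ^ enc x\<close> to the code of the set,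
  and this exceeds \<open>enc x\<close>. It turns quantifiers over a finite set into bounded
  ones.\<close>

lemma enc_less_if_fmember: "x |\<in>| A \<Longrightarrow> enc x < enc A"
proof -
  assume "x |\<in>| A"
  then have "enc x \<in> set_decode (enc A)"
    unfolding enc_fset_def by (auto simp: inj_image_mem_iff inj_def)
  then have "{enc x} \<subseteq> set_decode (enc A)" by simp
  then have "set_encode {enc x} \<le> enc A"
    using subset_decode_imp_le[of "set_encode {enc x}" "enc A"] set_encode_inverse[of "{enc x}"]
    by (simp del: set_encode_insert)
  then have "2 ^ enc x \<le> enc A" by simp
  then show ?thesis using less_exp[of "enc x"] by linarith
qed

lemma semi_fBall [semi_intros]:
  assumes "comput G" "semi (\<lambda>z. P (fst z) (snd z))"
  shows "semi (\<lambda>x. \<forall>y |\<in>| G x. P x y)"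
proof -
  have "(\<forall>y |\<in>| A. Q y) \<longleftrightarrow> (\<forall>i < enc A. \<not> dec i |\<in>| A \<or> Q (dec i))" for A and Q :: "'b \<Rightarrow> bool"
    using enc_less_if_fmember by (metis dec_enc)
  moreover have "comput (\<lambda>z. G (fst z))"
    by (rule comput_comp[OF assms(1)]) (intro comput_intros)
  ultimately show ?thesis
    by (simp only:) (intro semi_intros semi_decid decid_not decid_fmember comput_intros
        assms(1) semi_comp2[OF assms(2)])
qed

lemma comput_finsert [comput_intros]:
  "comput f \<Longrightarrow> comput g \<Longrightarrow> comput (\<lambda>x. finsert (f x) (g x))"
proof -
  assume *: "comput f" "comput g"
  have "finsert a A = B \<longleftrightarrow> a |\<in>| B \<and> (\<forall>x |\<in>| A. x |\<in>| B) \<and> (\<forall>x |\<in>| B. x = a \<or> x |\<in>| A)"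
    for a :: 'b and A B by auto
  then have "comput (\<lambda>z. finsert (fst z) (snd z) :: 'b fset)"
    by (intro comput_graph, simp only:) (intro semi_intros semi_decid[OF decid_fmember] comput_intros)
  from comput_comp[OF this, of "\<lambda>x. (f x, g x)"] show ?thesis
    by (simp add: comput_intros *)
qed

lemma comput_fimage [comput_intros]:
  assumes "comput (\<lambda>z. h (fst z) (snd z))" "comput G"
  shows "comput (\<lambda>x. h x |`| G x)"
proof (rule comput_graph)
  have eq: "k |`| A = B \<longleftrightarrow> (\<forall>x |\<in>| A. k x |\<in>| B) \<and> (\<forall>y |\<in>| B. \<exists>x. x |\<in>| A \<and> y = k x)"
    for k :: "'b \<Rightarrow> 'c" and A B by auto
  have G: "comput (\<lambda>z. G (u z))" if "comput u" for u :: "'z::coded \<Rightarrow> _"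
    by (rule comput_comp[OF assms(2) that])
  have h: "comput (\<lambda>z. h (u z) (v z))" if "comput u" "comput v" for u v :: "'z::coded \<Rightarrow> _"
    using comput_comp[OF assms(1) comput_Pair[OF that]] by simp
  show "semi (\<lambda>z. h (fst z) |`| G (fst z) = snd z)"
    unfolding eq by (intro semi_intros semi_decid[OF decid_fmember] comput_intros G h)
qed

lemma tc_mult_const: "tc n f \<Longrightarrow> tc n (\<lambda>xs. c * f xs)"
  by (induction c) (auto intro: tc_const tc_add)

lemma comput_tm [comput_intros]:
  assumes "comput f"
  shows "comput (\<lambda>x. Sc (f x))" "comput (\<lambda>x. Neg (f x))"
    "comput (\<lambda>x. Lam (f x))"
    "comput g \<Longrightarrow> comput (\<lambda>x. Eq (f x) (g x))" "comput g \<Longrightarrow> comput (\<lambda>x. Or (f x) (g x))"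
    "comput g \<Longrightarrow> comput (\<lambda>x. f x \<cdot> g x)"
  using assms unfolding comput_def enc_tm_def
  by (simp_all add: tc_add tc_Suc tc_const tc_mult_const tc_prod_encode)

lemma comput_Var [comput_intros]: "comput n \<Longrightarrow> comput (\<lambda>x. Var (n x))"
  unfolding comput_def enc_tm_def by (simp add: tc_add tc_Suc tc_const tc_mult_const)

lemma comput_Sequent [comput_intros]: "comput f \<Longrightarrow> comput g \<Longrightarrow> comput (\<lambda>x. f x \<turnstile> g x)"
  unfolding comput_def by (simp add: enc_sequent_def tc_prod_encode)

lemma comput_num [comput_intros]: "comput f \<Longrightarrow> comput (\<lambda>x. num (f x))"
proof -
  have "rec_nat Zr (\<lambda>_ r. Sc r) n = num n" for n
    by (induction n) (auto simp: num_def)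
  moreover have "comput f \<Longrightarrow> comput (\<lambda>x. rec_nat Zr (\<lambda>_ r. Sc r) (f x))"
    by (intro comput_intros)
  ultimately show "comput f \<Longrightarrow> ?thesis" by simp
qed

section \<open>RGA is semidecidable\<close>

text \<open>\<open>tmap\<close> replaces variables depending on the number of binders above them; \<open>shift\<close>, \<open>inst\<close> and
  \<open>fsub\<close> are instances, so computability needs to be shown only once.\<close>

primrec tmap :: "(nat \<Rightarrow> nat \<Rightarrow> tm) \<Rightarrow> nat \<Rightarrow> tm \<Rightarrow> tm" where
  "tmap F d (Var i) = F d i"
| "tmap F d Bot = Bot"
| "tmap F d Zr = Zr"
| "tmap F d (Sc t) = Sc (tmap F d t)"
| "tmap F d (Eq t u) = Eq (tmap F d t) (tmap F d u)"
| "tmap F d (Neg t) = Neg (tmap F d t)"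
| "tmap F d (Or t u) = Or (tmap F d t) (tmap F d u)"
| "tmap F d (Lam t) = Lam (tmap F (Suc d) t)"
| "tmap F d (t \<cdot> u) = tmap F d t \<cdot> tmap F d u"
| "tmap F d Rec = Rec"
| "tmap F d Univ = Univ"

text \<open>These rules generate the graph of \<open>tmap\<close>, whose recursion over terms is
  thereby reduced to \<open>semi_gen\<close> and \<open>comput_graph\<close>. The parameter
  \<open>p\<close> holds data such as the substituted term, in which computability has to be
  uniform.\<close>

definition tmap_rule ::
  "('p \<Rightarrow> nat \<Rightarrow> nat \<Rightarrow> tm) \<Rightarrow> ('p \<times> nat \<times> tm \<times> tm) list \<Rightarrow> 'p \<times> nat \<times> tm \<times> tm \<Rightarrow> bool" where
  "tmap_rule F ps z \<longleftrightarrow>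
     (\<exists>p d i. ps = [] \<and> z = (p, d, Var i, F p d i))
   \<or> (\<exists>p d t. ps = [] \<and> (t = Bot \<or> t = Zr \<or> t = Rec \<or> t = Univ) \<and> z = (p, d, t, t))
   \<or> (\<exists>p d t t'. ps = [(p, d, t, t')] \<and>
        (z = (p, d, Sc t, Sc t') \<or> z = (p, d, Neg t, Neg t')))
   \<or> (\<exists>p d t t'. ps = [(p, Suc d, t, t')] \<and> z = (p, d, Lam t, Lam t'))
   \<or> (\<exists>p d t t' u u'. ps = [(p, d, t, t'), (p, d, u, u')] \<and>
        (z = (p, d, Eq t u, Eq t' u') \<or> z = (p, d, Or t u, Or t' u') \<or> z = (p, d, t \<cdot> u, t' \<cdot> u')))"

lemma gen_tmap_rule: "gen (tmap_rule F) (p, d, t, r) \<longleftrightarrow> tmap (F p) d t = r"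
proof
  have "tmap (F (fst z)) (fst (snd z)) (fst (snd (snd z))) = snd (snd (snd z))"
    if "gen (tmap_rule F) z" for z
    using that by induction (auto simp: tmap_rule_def)
  then show "gen (tmap_rule F) (p, d, t, r) \<Longrightarrow> tmap (F p) d t = r" by fastforce
next
  have "gen (tmap_rule F) (p, d, t, tmap (F p) d t)"
  proof (induction t arbitrary: d)
    case (Var i) show ?case by (rule gen.gen[of _ "[]"]) (auto simp: tmap_rule_def)
  next
    case Bot show ?case by (rule gen.gen[of _ "[]"]) (auto simp: tmap_rule_def)
  next
    case Zr show ?case by (rule gen.gen[of _ "[]"]) (auto simp: tmap_rule_def)
  next
    case Rec show ?case by (rule gen.gen[of _ "[]"]) (auto simp: tmap_rule_def)
  next
    case Univ show ?case by (rule gen.gen[of _ "[]"]) (auto simp: tmap_rule_def)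
  next
    case (Sc t) show ?case
      by (rule gen.gen[of _ "[(p, d, t, tmap (F p) d t)]"], simp add: tmap_rule_def, simp add: Sc)
  next
    case (Neg t) show ?case
      by (rule gen.gen[of _ "[(p, d, t, tmap (F p) d t)]"], simp add: tmap_rule_def, simp add: Neg)
  next
    case (Lam t) show ?case
      by (rule gen.gen[of _ "[(p, Suc d, t, tmap (F p) (Suc d) t)]"], simp add: tmap_rule_def, simp add: Lam)
  next
    case (Eq t u) show ?case
      by (rule gen.gen[of _ "[(p, d, t, tmap (F p) d t), (p, d, u, tmap (F p) d u)]"],
         simp add: tmap_rule_def, simp add: Eq)
  next
    case (Or t u) show ?case
      by (rule gen.gen[of _ "[(p, d, t, tmap (F p) d t), (p, d, u, tmap (F p) d u)]"],
         simp add: tmap_rule_def, simp add: Or)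
  next
    case (App t u) show ?case
      by (rule gen.gen[of _ "[(p, d, t, tmap (F p) d t), (p, d, u, tmap (F p) d u)]"],
         simp add: tmap_rule_def, simp add: App)
  qed
  then show "tmap (F p) d t = r \<Longrightarrow> gen (tmap_rule F) (p, d, t, r)" by simp
qed

lemma comput_tmap:
  assumes "comput (\<lambda>z. F (fst z) (fst (snd z)) (snd (snd z)))"
    and "comput p" "comput d" "comput t"
  shows "comput (\<lambda>x. tmap (F (p x)) (d x) (t x))"
proof -
  have F: "comput (\<lambda>x. F (u x) (v x) (w x))" if "comput u" "comput v" "comput w"
    for u v w :: "'z::coded \<Rightarrow> _"
    using comput_comp[OF assms(1) comput_Pair[OF that(1) comput_Pair[OF that(2,3)]]] by simp
  have "semi (gen (tmap_rule F))"
    by (rule semi_gen, unfold tmap_rule_def) (intro semi_intros comput_intros F)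
  from semi_comp[OF this, of "\<lambda>z. (fst (fst z), fst (snd (fst z)), snd (snd (fst z)), snd z)"]
  have "semi (\<lambda>z. tmap (F (fst (fst z))) (fst (snd (fst z))) (snd (snd (fst z))) = snd z)"
    unfolding gen_tmap_rule by (simp add: comput_intros)
  from comput_comp[OF comput_graph[OF this], of "\<lambda>x. (p x, d x, t x)"] show ?thesis
    by (simp add: comput_intros assms)
qed

lemma shift_eq_tmap: "shift k t = tmap (\<lambda>d i. Var (if i < d then i else Suc i)) k t"
  by (induction t arbitrary: k) auto

lemma comput_shift [comput_intros]: "comput f \<Longrightarrow> comput g \<Longrightarrow> comput (\<lambda>x. shift (f x) (g x))"
  unfolding shift_eq_tmap
  by (rule comput_tmap[where p = "\<lambda>_. 0 :: nat"]) (intro comput_intros decid_intros | assumption)+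

lemma comput_ups: "comput f \<Longrightarrow> comput g \<Longrightarrow> comput (\<lambda>x. (up ^^ f x) (g x))"
proof -
  assume *: "comput f" "comput g"
  have "rec_nat s (\<lambda>_ r. up r) n = (up ^^ n) s" for n s by (induction n) auto
  moreover have "comput (\<lambda>x. rec_nat (g x) (\<lambda>_ r. up r) (f x))" by (intro comput_intros *)
  ultimately show ?thesis by simp
qed

lemma inst_eq_tmap: "inst k s t =
    tmap (\<lambda>d i. if i < d then Var i else if i = d then (up ^^ (d - k)) s else Var (i - 1)) k t"
proof -
  \<comment> \<open>Under \<open>j\<close> binders the substituted term has been shifted
    \<open>j\<close> times, so the depth reached determines the number of shifts.\<close>
  have "inst (k + j) ((up ^^ j) s) t =
    tmap (\<lambda>d i. if i < d then Var i else if i = d then (up ^^ (d - k)) s else Var (i - 1)) (k + j) t" for j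
  proof (induction t arbitrary: j)
    case (Lam t)
    show ?case using Lam[of "Suc j"] by simp
  qed auto
  from this[of 0] show ?thesis by simp
qed

lemma fsub_eq_tmap: "fsub k s t =
    tmap (\<lambda>d i. if i = d then (up ^^ (d - k)) s else Var i) k t"
proof -
  have "fsub (k + j) ((up ^^ j) s) t =
    tmap (\<lambda>d i. if i = d then (up ^^ (d - k)) s else Var i) (k + j) t" for j
  proof (induction t arbitrary: j)
    case (Lam t)
    show ?case using Lam[of "Suc j"] by simp
  qed auto
  from this[of 0] show ?thesis by simp
qed

lemma comput_inst [comput_intros]:
  "comput k \<Longrightarrow> comput s \<Longrightarrow> comput t \<Longrightarrow> comput (\<lambda>x. inst (k x) (s x) (t x))"
proof -
  assume *: "comput k" "comput s" "comput t"
  have "comput (\<lambda>x. tmap ((\<lambda>p d i. if i < d then Var i else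
        if i = d then (up ^^ (d - fst p)) (snd p) else Var (i - 1)) (k x, s x)) (k x) (t x))"
    by (rule comput_tmap[where p = "\<lambda>x. (k x, s x)"])
       (intro comput_intros comput_ups decid_intros *)+
  then show ?thesis unfolding inst_eq_tmap fst_conv snd_conv .
qed

lemma comput_fsub [comput_intros]:
  "comput k \<Longrightarrow> comput s \<Longrightarrow> comput t \<Longrightarrow> comput (\<lambda>x. fsub (k x) (s x) (t x))"
proof -
  assume *: "comput k" "comput s" "comput t"
  have "comput (\<lambda>x. tmap ((\<lambda>p d i. if i = d then (up ^^ (d - fst p)) (snd p) else Var i)
      (k x, s x)) (k x) (t x))"
    by (rule comput_tmap[where p = "\<lambda>x. (k x, s x)"])
       (intro comput_intros comput_ups decid_intros *)+
  then show ?thesis unfolding fsub_eq_tmap fst_conv snd_conv .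
qed

text \<open>A substituted \<open>Zr\<close> leaves a trace because it is not a variable. Freshness
  thus becomes an equation between computable terms, which makes the side condition of
  \<open>nat_ind\<close> semidecidable.\<close>

lemma fsub_Zr_eq_iff: "fsub i Zr t = t \<longleftrightarrow> i \<notin> fv t"
  by (induction t arbitrary: i) auto

definition step_rule :: "(tm \<times> tm) list \<Rightarrow> tm \<times> tm \<Rightarrow> bool" where
  "step_rule ps z \<longleftrightarrow>
     (\<exists>b t. ps = [] \<and> z = (Lam b \<cdot> t, inst 0 t b))
   \<or> (\<exists>g h. ps = [] \<and> z = (Rec \<cdot> g \<cdot> h \<cdot> Zr, g))
   \<or> (\<exists>g h n. ps = [] \<and> z = (Rec \<cdot> g \<cdot> h \<cdot> Sc (num n), h \<cdot> num n \<cdot> (Rec \<cdot> g \<cdot> h \<cdot> num n)))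
   \<or> (\<exists>t t' u. ps = [(t, t')] \<and> z = (t \<cdot> u, t' \<cdot> u))"

lemma gen_step_rule: "gen step_rule (t, t') \<longleftrightarrow> t \<triangleright> t'"
proof
  have "fst z \<triangleright> snd z" if "gen step_rule z" for z
    using that by induction (auto simp: step_rule_def intro: head_step.intros)
  then show "gen step_rule (t, t') \<Longrightarrow> t \<triangleright> t'" by fastforce
next
  show "gen step_rule (t, t')" if "t \<triangleright> t'"
    using that
  proof induction
    case (app t t' u)
    then show ?case by (intro gen.gen[of _ "[(t, t')]"]) (auto simp: step_rule_def)
  qed (rule gen.gen[of _ "[]"]; auto simp: step_rule_def)+
qed

lemma semi_head_step [semi_intros]:
  "comput f \<Longrightarrow> comput g \<Longrightarrow> semi (\<lambda>x. f x \<triangleright> g x)"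
proof -
  have "semi (gen step_rule)"
    by (rule semi_gen, unfold step_rule_def) (intro semi_intros comput_intros)
  from semi_comp[OF this, of "\<lambda>x. (f x, g x)"] show "comput f \<Longrightarrow> comput g \<Longrightarrow> ?thesis"
    unfolding gen_step_rule by (simp add: comput_intros)
qed

lemma semi_RGA: "semi RGA"
proof -
  have "semi (\<lambda>z. rga_rule (fst z) (snd z))"
    \<comment> \<open>Each rule becomes a disjunct that quantifies existentially over its schematic
      terms and contexts.\<close>
    unfolding rga_rule.simps fsub_Zr_eq_iff[symmetric]
    by (intro semi_intros comput_intros)
  from semi_gen[OF this] show ?thesis
    unfolding derivable_iff_gen[abs_def] .
qed

section \<open>Simultaneous substitution\<close>

definition lift :: "(nat \<Rightarrow> tm) \<Rightarrow> nat \<Rightarrow> tm" where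
  "lift \<sigma> i = (case i of 0 \<Rightarrow> Var 0 | Suc j \<Rightarrow> up (\<sigma> j))"

lemma lift_simps [simp]: "lift \<sigma> 0 = Var 0" "lift \<sigma> (Suc j) = up (\<sigma> j)"
  by (simp_all add: lift_def)

text \<open>All three operations on indices are instances of \<open>sub\<close>, so that the laws of
  substitution are proved once.\<close>

primrec sub :: "(nat \<Rightarrow> tm) \<Rightarrow> tm \<Rightarrow> tm" where
  "sub \<sigma> (Var i) = \<sigma> i"
| "sub \<sigma> Bot = Bot"
| "sub \<sigma> Zr = Zr"
| "sub \<sigma> (Sc t) = Sc (sub \<sigma> t)"
| "sub \<sigma> (Eq t u) = Eq (sub \<sigma> t) (sub \<sigma> u)"
| "sub \<sigma> (Neg t) = Neg (sub \<sigma> t)"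
| "sub \<sigma> (Or t u) = Or (sub \<sigma> t) (sub \<sigma> u)"
| "sub \<sigma> (Lam t) = Lam (sub (lift \<sigma>) t)"
| "sub \<sigma> (t \<cdot> u) = sub \<sigma> t \<cdot> sub \<sigma> u"
| "sub \<sigma> Rec = Rec"
| "sub \<sigma> Univ = Univ"

lemma shift_eq_sub: "shift k t = sub (\<lambda>i. Var (if i < k then i else Suc i)) t"
proof (induction t arbitrary: k)
  case (Lam t)
  have "lift (\<lambda>i. Var (if i < k then i else Suc i)) = (\<lambda>i. Var (if i < Suc k then i else Suc i))"
    by (rule ext) (auto simp: lift_def split: nat.split)
  then show ?case using Lam by simp
qed auto

lemma up_eq_sub: "up t = sub (\<lambda>i. Var (Suc i)) t"
  by (simp add: shift_eq_sub)

text \<open>Composition is treated for a renaming on the right, then on the left, and only then in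
  general: lifting under a binder shifts the substituted terms, and shifts are renamings.\<close>

lemma sub_ren: "sub \<sigma> (sub (\<lambda>i. Var (\<rho> i)) t) = sub (\<lambda>i. \<sigma> (\<rho> i)) t"
proof (induction t arbitrary: \<sigma> \<rho>)
  case (Lam t)
  have "lift (\<lambda>i. Var (\<rho> i)) = (\<lambda>i. Var (case i of 0 \<Rightarrow> 0 | Suc j \<Rightarrow> Suc (\<rho> j)))"
    by (rule ext) (auto simp: lift_def split: nat.split)
  moreover have "(\<lambda>i. lift \<sigma> (case i of 0 \<Rightarrow> 0 | Suc j \<Rightarrow> Suc (\<rho> j))) = lift (\<lambda>i. \<sigma> (\<rho> i))"
    by (rule ext) (auto simp: lift_def split: nat.split)
  ultimately show ?case using Lam by simp
qed auto

lemma sub_lift_up: "sub (lift \<sigma>) (up t) = sub (\<lambda>i. up (\<sigma> i)) t"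
  by (simp add: up_eq_sub[of t] sub_ren)

lemma ren_sub: "sub (\<lambda>i. Var (\<rho> i)) (sub \<sigma> t) = sub (\<lambda>i. sub (\<lambda>i. Var (\<rho> i)) (\<sigma> i)) t"
proof (induction t arbitrary: \<sigma> \<rho>)
  case (Lam t)
  let ?r = "\<lambda>i. case i of 0 \<Rightarrow> 0 | Suc j \<Rightarrow> Suc (\<rho> j)"
  have 1: "lift (\<lambda>i. Var (\<rho> i)) = (\<lambda>i. Var (?r i))"
    by (rule ext) (auto simp: lift_def split: nat.split)
  have "(\<lambda>i. sub (\<lambda>i. Var (?r i)) (lift \<sigma> i)) = lift (\<lambda>i. sub (\<lambda>i. Var (\<rho> i)) (\<sigma> i))"
  proof
    fix i
    show "sub (\<lambda>i. Var (?r i)) (lift \<sigma> i) = lift (\<lambda>i. sub (\<lambda>i. Var (\<rho> i)) (\<sigma> i)) i"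
      by (cases i) (simp_all add: up_eq_sub sub_ren)
  qed
  then show ?case using Lam[of ?r "lift \<sigma>"] 1 by simp
qed simp_all

lemma up_sub: "up (sub \<sigma> t) = sub (\<lambda>i. up (\<sigma> i)) t"
  by (simp add: up_eq_sub ren_sub)

lemma sub_sub: "sub \<sigma> (sub \<tau> t) = sub (\<lambda>i. sub \<sigma> (\<tau> i)) t"
proof (induction t arbitrary: \<sigma> \<tau>)
  case (Lam t)
  have "(\<lambda>i. sub (lift \<sigma>) (lift \<tau> i)) = lift (\<lambda>i. sub \<sigma> (\<tau> i))"
  proof
    show "sub (lift \<sigma>) (lift \<tau> i) = lift (\<lambda>i. sub \<sigma> (\<tau> i)) i" for i
      by (cases i) (simp_all add: sub_lift_up up_sub)
  qed
  then show ?case using Lam[of "lift \<sigma>" "lift \<tau>"] by simp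
qed simp_all

lemma sub_cong: "(\<And>i. i \<in> fv t \<Longrightarrow> \<sigma> i = \<tau> i) \<Longrightarrow> sub \<sigma> t = sub \<tau> t"
proof (induction t arbitrary: \<sigma> \<tau>)
  case (Lam t)
  have "lift \<sigma> i = lift \<tau> i" if "i \<in> fv t" for i
    using that Lam.prems by (cases i) auto
  then show ?case using Lam.IH[of "lift \<sigma>" "lift \<tau>"] by simp
next
  case (Sc t) show ?case using Sc.IH[of \<sigma> \<tau>] Sc.prems by simp
next
  case (Neg t) show ?case using Neg.IH[of \<sigma> \<tau>] Neg.prems by simp
next
  case (Eq t u) show ?case using Eq.IH[of \<sigma> \<tau>] Eq.prems by simp
next
  case (Or t u) show ?case using Or.IH[of \<sigma> \<tau>] Or.prems by simp
next
  case (App t u) show ?case using App.IH[of \<sigma> \<tau>] App.prems by simp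
qed simp_all

lemma sub_Var [simp]: "sub Var t = t"
proof (induction t)
  case (Lam t)
  have "lift Var = Var" by (rule ext) (auto simp: lift_def split: nat.split)
  then show ?case using Lam by simp
qed auto

lemma sub_closed: "fv t = {} \<Longrightarrow> sub \<sigma> t = t"
  using sub_cong[of t \<sigma> Var] by simp

lemma fv_sub: "fv (sub \<sigma> t) = (\<Union>i \<in> fv t. fv (\<sigma> i))"
proof -
  have ren: "fv (sub (\<lambda>i. Var (\<rho> i)) t) = \<rho> ` fv t" for \<rho> t
  proof (induction t arbitrary: \<rho>)
    case (Lam t)
    have "lift (\<lambda>i. Var (\<rho> i)) = (\<lambda>i. Var (case i of 0 \<Rightarrow> 0 | Suc j \<Rightarrow> Suc (\<rho> j)))"
      by (rule ext) (auto simp: lift_def split: nat.split)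
    moreover have "Suc i = (case k of 0 \<Rightarrow> 0 | Suc j \<Rightarrow> Suc (\<rho> j)) \<longleftrightarrow> (\<exists>j. k = Suc j \<and> i = \<rho> j)" for i k
      by (cases k) auto
    ultimately show ?case using Lam by (auto simp: image_iff)
  qed auto
  show ?thesis
  proof (induction t arbitrary: \<sigma>)
    case (Lam t)
    have "Suc j \<in> fv (lift \<sigma> i) \<longleftrightarrow> (\<exists>k. i = Suc k \<and> j \<in> fv (\<sigma> k))" for i j
      by (cases i) (auto simp: up_eq_sub ren)
    then show ?case using Lam by auto
  qed auto
qed

lemma finite_fv: "finite (fv t)"
proof (induction t)
  case (Lam t)
  have "finite (Suc -` fv t)" by (rule finite_vimageI[OF Lam]) simp
  then show ?case by (simp add: vimage_def)
qed auto

lemma fsub_eq_sub: "fsub i s t = sub (Var(i := s)) t"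
proof (induction t arbitrary: i s)
  case (Lam t)
  have "lift (Var(i := s)) = Var(Suc i := up s)"
    by (rule ext) (auto simp: lift_def split: nat.split)
  then show ?case by (simp only: fsub.simps sub.simps Lam)
qed auto

lemma inst_eq_sub: "inst k s t = sub (\<lambda>i. if i < k then Var i else if i = k then s else Var (i - 1)) t"
proof (induction t arbitrary: k s)
  case (Lam t)
  have "lift (\<lambda>i. if i < k then Var i else if i = k then s else Var (i - 1)) =
     (\<lambda>i. if i < Suc k then Var i else if i = Suc k then up s else Var (i - 1))"
    by (rule ext) (auto simp: lift_def split: nat.split)
  then show ?case using Lam by simp
qed auto

lemma sub_inst: "sub \<sigma> (inst 0 t b) = inst 0 (sub \<sigma> t) (sub (lift \<sigma>) b)"
proof -
  have "sub \<sigma> (if i = 0 then t else Var (i - 1)) =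
     sub (\<lambda>i. if i = 0 then sub \<sigma> t else Var (i - 1)) (lift \<sigma> i)" for i
    by (cases i) (simp_all add: up_eq_sub sub_ren)
  then show ?thesis by (simp add: inst_eq_sub sub_sub)
qed

lemma fsub_inst: "fsub i a (inst 0 t b) = inst 0 (fsub i a t) (fsub (Suc i) (up a) b)"
proof -
  have "lift (Var(i := a)) = Var(Suc i := up a)"
    by (rule ext) (auto simp: lift_def split: nat.split)
  then show ?thesis by (simp add: fsub_eq_sub sub_inst)
qed

lemma fsub_fresh: "i \<notin> fv t \<Longrightarrow> fsub i s t = t"
  unfolding fsub_eq_sub using sub_cong[of t "Var(i := s)" Var] by fastforce

lemma fv_num [simp]: "fv (num n) = {}"
  by (induction n) (auto simp: num_def)

lemma num_0: "num 0 = Zr" and num_Suc: "num (Suc n) = Sc (num n)"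
  by (simp_all add: num_def)

lemma sub_num [simp]: "sub \<sigma> (num n) = num n"
  by (simp add: sub_closed)

lemma shift_num [simp]: "shift k (num n) = num n"
  by (simp add: shift_eq_sub)

lemma fsub_num [simp]: "fsub i s (num n) = num n"
  by (simp add: fsub_eq_sub)

lemma head_step_sub: "t \<triangleright> t' \<Longrightarrow> sub \<sigma> t \<triangleright> sub \<sigma> t'"
  by (induction rule: head_step.induct) (auto simp: sub_inst intro: head_step.intros)

lemma apps_simps [simp]: "apps t [] = t" "apps t (u # us) = apps (t \<cdot> u) us"
  by (simp_all add: apps_def)

lemma apps_append: "apps t (us @ vs) = apps (apps t us) vs"
  by (simp add: apps_def)

lemma head_step_apps: "t \<triangleright> t' \<Longrightarrow> apps t us \<triangleright> apps t' us"
  by (induction us arbitrary: t t') (auto intro: head_step.app)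

lemma sub_apps: "sub \<sigma> (apps t us) = apps (sub \<sigma> t) (map (sub \<sigma>) us)"
  by (induction us arbitrary: t) auto

section \<open>Reduction of compiled definitions\<close>

lemma lams_simps: "lams 0 t = t" "lams (Suc n) t = Lam (lams n t)"
  by (simp_all add: lams_def)

lemma sub_lams: "sub \<sigma> (lams n t) = lams n (sub ((lift ^^ n) \<sigma>) t)"
  by (induction n arbitrary: \<sigma>) (auto simp: lams_simps funpow_swap1)

lemma fv_lams: "fv (lams n t) = {i. i + n \<in> fv t}"
  by (induction n arbitrary: t) (auto simp: lams_simps)

lemma fv_apps: "fv (apps t us) = fv t \<union> (\<Union>u \<in> set us. fv u)"
  by (induction us arbitrary: t) auto

text \<open>Index 0 belongs to the innermost binder, hence to the last argument, which is why the
  list is reversed.\<close>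

definition bind_args :: "tm list \<Rightarrow> nat \<Rightarrow> tm" where
  "bind_args ts i = (if i < length ts then rev ts ! i else Var (i - length ts))"

lemma lift_funpow: "(lift ^^ n) \<sigma> i = (if i < n then Var i else sub (\<lambda>j. Var (j + n)) (\<sigma> (i - n)))"
proof (induction n arbitrary: i)
  case (Suc n)
  show ?case
    by (cases i) (auto simp: Suc up_eq_sub sub_ren)
qed simp

text \<open>Every contraction happens at the head of the spine, where the calculus permits it. After
  the first one, the remaining \<open>m\<close> abstractions carry a lifted substitution, and its
  composition with that for the other arguments is \<open>bind_args (t # ts)\<close>.\<close>

lemma beta_steps:
  "length ts = n \<Longrightarrow> head_step\<^sup>*\<^sup>* (apps (lams n b) ts) (sub (bind_args ts) b)"
proof (induction ts arbitrary: n b)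
  case Nil
  then show ?case by (simp add: lams_simps bind_args_def[abs_def])
next
  case (Cons t ts)
  then obtain m where m: "n = Suc m" "length ts = m" by auto
  let ?\<sigma> = "\<lambda>i. if i = 0 then t else Var (i - 1)"
  have "apps (lams n b) (t # ts) \<triangleright> apps (inst 0 t (lams m b)) ts"
    using m by (simp add: lams_simps head_step_apps head_step.beta)
  also have "inst 0 t (lams m b) = lams m (sub ((lift ^^ m) ?\<sigma>) b)"
    by (simp add: inst_eq_sub sub_lams)
  finally have 1: "apps (lams n b) (t # ts) \<triangleright> apps (lams m (sub ((lift ^^ m) ?\<sigma>) b)) ts" .
  have "sub (bind_args ts) ((lift ^^ m) ?\<sigma> i) = bind_args (t # ts) i" for i
    using m(2) by (auto simp: lift_funpow sub_ren bind_args_def nth_append)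
  then have "sub (bind_args ts) (sub ((lift ^^ m) ?\<sigma>) b) = sub (bind_args (t # ts)) b"
    by (simp add: sub_sub)
  then show ?case
    using Cons.IH[OF m(2), of "sub ((lift ^^ m) ?\<sigma>) b"] 1 by (metis converse_rtranclp_into_rtranclp)
qed

lemma sub_args:
  assumes "length ts = n" "\<And>i. i < n \<Longrightarrow> \<sigma> (n - 1 - i + k) = ts ! i"
  shows "map (sub \<sigma>) (args n k) = ts"
  using assms by (intro nth_equalityI) (auto simp: args_def)

lemma fv_cmp: "pr_wf n d \<Longrightarrow> fv (cmp d) = {}"
proof (induction n d rule: pr_wf.induct)
  case (4 n m g hs)
  have "fv (cmp g) = {}" "\<And>h. h \<in> set hs \<Longrightarrow> fv (cmp h) = {}" using 4 by auto
  then show ?case by (auto simp: fv_lams fv_apps args_def)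
next
  case (5 n m g h)
  then have "fv (cmp g) = {}" "fv (cmp h) = {}" by auto
  then show ?case by (auto simp: fv_lams fv_apps args_def)
qed (auto simp: fv_lams)

lemma sub_cmp: "pr_wf n d \<Longrightarrow> sub \<sigma> (cmp d) = cmp d"
  by (simp add: fv_cmp sub_closed)

lemma cmp_PZero: "length ts = n \<Longrightarrow> head_step\<^sup>*\<^sup>* (apps (cmp (PZero n)) ts) Zr"
  using beta_steps[of ts n Zr] by simp

lemma cmp_PSuc: "head_step\<^sup>*\<^sup>* (apps (cmp PSuc) [t]) (Sc t)"
  using beta_steps[of "[t]" 1 "Sc (Var 0)"] by (simp add: lams_simps bind_args_def)

lemma cmp_PProj: "length ts = n \<Longrightarrow> i < n \<Longrightarrow> head_step\<^sup>*\<^sup>* (apps (cmp (PProj n i)) ts) (ts ! i)"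
  using beta_steps[of ts n "Var (n - 1 - i)"] by (simp add: bind_args_def rev_nth)

lemma cmp_PComp:
  assumes "pr_wf n (PComp m g hs)" "length ts = n"
  shows "head_step\<^sup>*\<^sup>* (apps (cmp (PComp m g hs)) ts) (apps (cmp g) (map (\<lambda>h. apps (cmp h) ts) hs))"
proof -
  have "map (sub (bind_args ts)) (args m 0) = ts"
    using assms by (intro sub_args) (auto simp: bind_args_def rev_nth)
  then have "sub (bind_args ts) (apps (cmp g) (map (\<lambda>h. apps (cmp h) (args m 0)) hs))
      = apps (cmp g) (map (\<lambda>h. apps (cmp h) ts) hs)"
    using assms by (auto simp: sub_apps sub_cmp intro!: arg_cong[of _ _ "apps (cmp g)"]) (metis sub_cmp)
  then show ?thesis
    using beta_steps[of ts m "apps (cmp g) (map (\<lambda>h. apps (cmp h) (args m 0)) hs)"] assms by simp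
qed

text \<open>This is the step term of the recursor in a compiled definition once the parameters
  \<open>ts\<close> have been supplied.\<close>

definition rec_body :: "pdef \<Rightarrow> tm list \<Rightarrow> tm" where
  "rec_body h ts = Lam (Lam (apps (cmp h \<cdot> Var 1 \<cdot> Var 0) (map (\<lambda>t. up (up t)) ts)))"

lemma cmp_PRec:
  assumes "pr_wf n (PRec m g h)" "length (t # ts) = n"
  shows "head_step\<^sup>*\<^sup>* (apps (cmp (PRec m g h)) (t # ts)) (Rec \<cdot> apps (cmp g) ts \<cdot> rec_body h ts \<cdot> t)"
proof -
  have m: "length ts = m" using assms by auto
  have "map (sub (bind_args (t # ts))) (args m 0) = ts"
    using m by (intro sub_args) (auto simp: bind_args_def rev_nth nth_append)
  moreover have "map (sub (lift (lift (bind_args (t # ts))))) (args m 2) = map (\<lambda>t. up (up t)) ts"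
    using m by (intro sub_args) (auto simp: bind_args_def rev_nth nth_append)
  ultimately have "sub (bind_args (t # ts)) (Rec \<cdot> apps (cmp g) (args m 0)
      \<cdot> Lam (Lam (apps (cmp h \<cdot> Var 1 \<cdot> Var 0) (args m 2))) \<cdot> Var m)
      = Rec \<cdot> apps (cmp g) ts \<cdot> rec_body h ts \<cdot> t"
    using assms m by (auto simp: sub_apps sub_cmp rec_body_def bind_args_def nth_append)
  then show ?thesis
    using beta_steps[of "t # ts" "Suc m"] m by (metis cmp.simps(5) length_Cons)
qed

lemma rec_body_steps:
  assumes "pr_wf n h"
  shows "head_step\<^sup>*\<^sup>* (rec_body h ts \<cdot> u \<cdot> v) (apps (cmp h) (u # v # ts))"
proof -
  have "sub (bind_args [u, v]) (up (up t)) = t" for t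
    by (simp add: up_eq_sub sub_ren bind_args_def)
  then have "sub (bind_args [u, v]) (apps (cmp h \<cdot> Var 1 \<cdot> Var 0) (map (\<lambda>t. up (up t)) ts))
     = apps (cmp h) (u # v # ts)"
    using assms by (simp add: sub_apps sub_cmp bind_args_def comp_def)
  then show ?thesis
    using beta_steps[of "[u, v]" 2 "apps (cmp h \<cdot> Var 1 \<cdot> Var 0) (map (\<lambda>t. up (up t)) ts)"]
    by (simp add: rec_body_def numeral_2_eq_2 lams_simps)
qed

section \<open>Derived rules of RGA\<close>

lemma derivable0: "R [] j \<Longrightarrow> derivable R j"
  unfolding derivable_iff_gen by (rule gen.gen[of _ "[]"]) auto

lemma derivable1: "R [p] j \<Longrightarrow> derivable R p \<Longrightarrow> derivable R j"
  unfolding derivable_iff_gen by (rule gen.gen[of _ "[p]"]) auto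

lemma derivable2: "R [p, q] j \<Longrightarrow> derivable R p \<Longrightarrow> derivable R q \<Longrightarrow> derivable R j"
  unfolding derivable_iff_gen by (rule gen.gen[of _ "[p, q]"]) auto

lemma derivable3:
  "R [p, q, r] j \<Longrightarrow> derivable R p \<Longrightarrow> derivable R q \<Longrightarrow> derivable R r \<Longrightarrow> derivable R j"
  unfolding derivable_iff_gen by (rule gen.gen[of _ "[p, q, r]"]) auto

lemmas RGA_hyp = derivable0[where R = rga_rule, OF rga_rule.hyp]
  and RGA_weaken = derivable1[where R = rga_rule, OF rga_rule.weaken]
  and RGA_cut = derivable2[where R = rga_rule, OF rga_rule.cut]
  and RGA_subst = derivable1[where R = rga_rule, OF rga_rule.subst]
  and RGA_true_one = derivable1[where R = rga_rule, OF rga_rule.true_one]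
  and RGA_one_true = derivable1[where R = rga_rule, OF rga_rule.one_true]
  and RGA_false_zero = derivable1[where R = rga_rule, OF rga_rule.false_zero]
  and RGA_zero_false = derivable1[where R = rga_rule, OF rga_rule.zero_false]
  and RGA_dnegI = derivable1[where R = rga_rule, OF rga_rule.dnegI]
  and RGA_dnegE = derivable1[where R = rga_rule, OF rga_rule.dnegE]
  and RGA_orI1 = derivable1[where R = rga_rule, OF rga_rule.orI1]
  and RGA_orI2 = derivable1[where R = rga_rule, OF rga_rule.orI2]
  and RGA_norI = derivable2[where R = rga_rule, OF rga_rule.norI]
  and RGA_orE = derivable3[where R = rga_rule, OF rga_rule.orE]
  and RGA_eq_sym = derivable1[where R = rga_rule, OF rga_rule.eq_sym]
  and RGA_eq_subst = derivable2[where R = rga_rule, OF rga_rule.eq_subst]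
  and RGA_neq_sym = derivable1[where R = rga_rule, OF rga_rule.neq_sym]
  and RGA_eq_bool = derivable2[where R = rga_rule, OF rga_rule.eq_bool]
  and RGA_zero_nat = derivable0[where R = rga_rule, OF rga_rule.zero_nat]
  and RGA_suc_natI = derivable1[where R = rga_rule, OF rga_rule.suc_natI]
  and RGA_suc_neq_zero = derivable1[where R = rga_rule, OF rga_rule.suc_neq_zero]
  and RGA_suc_neqI = derivable1[where R = rga_rule, OF rga_rule.suc_neqI]
  and RGA_nat_ind = derivable3[where R = rga_rule, OF rga_rule.nat_ind]
  and RGA_conv_expand = derivable1[where R = rga_rule, OF rga_rule.conv_expand]
  and RGA_conv_reduce = derivable1[where R = rga_rule, OF rga_rule.conv_reduce]
  and RGA_conv_neg = derivable1[where R = rga_rule, OF rga_rule.conv_neg]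
  and RGA_conv_eq = derivable1[where R = rga_rule, OF rga_rule.conv_eq]
  and RGA_rec_eq = derivable2[where R = rga_rule, OF rga_rule.rec_eq]
  and RGA_allI = derivable1[where R = rga_rule, OF rga_rule.allI]
  and RGA_nallI = derivable2[where R = rga_rule, OF rga_rule.nallI]

section \<open>Equality, numerals and structural rules in RGA\<close>

lemma RGA_mono: "RGA (\<Gamma> \<turnstile> c) \<Longrightarrow> \<Gamma> |\<subseteq>| \<Delta> \<Longrightarrow> RGA (\<Delta> \<turnstile> c)"
proof -
  assume *: "RGA (\<Gamma> \<turnstile> c)" "\<Gamma> |\<subseteq>| \<Delta>"
  have "RGA (\<Delta>' |\<union>| \<Gamma> \<turnstile> c)" for \<Delta>'
    by (induction \<Delta>') (simp_all add: *(1) RGA_weaken)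
  from this[of \<Delta>] show ?thesis using *(2) by (simp add: sup_absorb1)
qed

lemma fresh_var: "\<exists>i. i \<notin> fv t"
  by (rule ex_new_if_finite[OF infinite_UNIV_nat finite_fv])

text \<open>Reflexivity is not free, since \<open>Eq a a\<close> asserts that \<open>a\<close>
  denotes a number. Rewriting \<open>b\<close> back to \<open>a\<close> on the right of the given
  equation yields it.\<close>

lemma RGA_eq_nat: "RGA (\<Gamma> \<turnstile> Eq a b) \<Longrightarrow> RGA (\<Gamma> \<turnstile> isN a)"
proof -
  assume *: "RGA (\<Gamma> \<turnstile> Eq a b)"
  obtain i where "i \<notin> fv a" using fresh_var by blast
  then show ?thesis
    using RGA_eq_subst[OF RGA_eq_sym[OF *], of i "Eq a (Var i)"] * by (simp add: fsub_fresh)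
qed

lemma RGA_eq_trans: "RGA (\<Gamma> \<turnstile> Eq a b) \<Longrightarrow> RGA (\<Gamma> \<turnstile> Eq b c) \<Longrightarrow> RGA (\<Gamma> \<turnstile> Eq a c)"
proof -
  assume *: "RGA (\<Gamma> \<turnstile> Eq a b)" "RGA (\<Gamma> \<turnstile> Eq b c)"
  obtain i where "i \<notin> fv a" using fresh_var by blast
  then show ?thesis
    using RGA_eq_subst[OF *(2), of i "Eq a (Var i)"] *(1) by (simp add: fsub_fresh)
qed

lemma RGA_eq_Sc: "RGA (\<Gamma> \<turnstile> Eq a b) \<Longrightarrow> RGA (\<Gamma> \<turnstile> Eq (Sc a) (Sc b))"
proof -
  assume *: "RGA (\<Gamma> \<turnstile> Eq a b)"
  obtain i where "i \<notin> fv a" using fresh_var by blast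
  then show ?thesis
    using RGA_eq_subst[OF *, of i "Eq (Sc a) (Sc (Var i))"] RGA_suc_natI[OF RGA_eq_nat[OF *]]
    by (simp add: fsub_fresh)
qed

lemma RGA_neq_cong: "RGA (\<Gamma> \<turnstile> Eq a a') \<Longrightarrow> RGA (\<Gamma> \<turnstile> Neq a b) \<Longrightarrow> RGA (\<Gamma> \<turnstile> Neq a' b)"
proof -
  assume *: "RGA (\<Gamma> \<turnstile> Eq a a')" "RGA (\<Gamma> \<turnstile> Neq a b)"
  obtain i where "i \<notin> fv b" using fresh_var by blast
  then show ?thesis
    using RGA_eq_subst[OF *(1), of i "Neq (Var i) b"] *(2) by (simp add: fsub_fresh)
qed

lemma RGA_num_nat: "RGA (\<Gamma> \<turnstile> isN (num n))"
  by (induction n) (auto simp: num_0 num_Suc intro: RGA_zero_nat RGA_suc_natI)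

lemma RGA_num_neq: "m \<noteq> n \<Longrightarrow> RGA (\<Gamma> \<turnstile> Neq (num m) (num n))"
proof (induction m arbitrary: n)
  case 0
  then obtain k where "n = Suc k" by (cases n) auto
  then show ?case
    using RGA_neq_sym[OF RGA_suc_neq_zero[OF RGA_num_nat]] by (simp add: num_0 num_Suc)
next
  case (Suc m)
  then show ?case
    by (cases n) (auto simp: num_0 num_Suc intro: RGA_suc_neq_zero[OF RGA_num_nat] RGA_suc_neqI)
qed

lemma RGA_conv_eq_trans: "c \<triangleright> c' \<Longrightarrow> RGA (\<Gamma> \<turnstile> Eq c' d) \<Longrightarrow> RGA (\<Gamma> \<turnstile> Eq c d)"
  by (meson RGA_conv_eq RGA_eq_nat RGA_eq_trans)

lemma RGA_steps_nat: "head_step\<^sup>*\<^sup>* c c' \<Longrightarrow> RGA (\<Gamma> \<turnstile> isN c') \<Longrightarrow> RGA (\<Gamma> \<turnstile> isN c)"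
  by (induction rule: converse_rtranclp_induct) (auto intro: RGA_conv_eq RGA_eq_nat)

lemma RGA_cut_context:
  "RGA (\<Gamma> \<turnstile> c) \<Longrightarrow> \<forall>g |\<in>| \<Gamma>. RGA ({||} \<turnstile> g) \<Longrightarrow> RGA ({||} \<turnstile> c)"
proof (induction \<Gamma>)
  case (insert g \<Gamma>)
  have "RGA (\<Gamma> \<turnstile> g)" using insert.prems RGA_mono[of "{||}" g \<Gamma>] by simp
  then show ?case using insert RGA_cut by (meson finsertCI)
qed

text \<open>As all inserted terms are closed, the variables can be replaced one after the other
  without interference, and a sequent has only finitely many free ones.\<close>

lemma RGA_sub:
  assumes "RGA (\<Gamma> \<turnstile> c)" "\<And>i. fv (\<sigma> i) = {}"
  shows "RGA (sub \<sigma> |`| \<Gamma> \<turnstile> sub \<sigma> c)"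
proof -
  define \<tau> where "\<tau> n i = (if i < n then \<sigma> i else Var i)" for n i
  have *: "fsub n (\<sigma> n) (sub (\<tau> n) t) = sub (\<tau> (Suc n)) t" for n t
    by (auto simp: fsub_eq_sub sub_sub \<tau>_def sub_closed assms(2) less_Suc_eq intro!: sub_cong)
  have n: "RGA (sub (\<tau> n) |`| \<Gamma> \<turnstile> sub (\<tau> n) c)" for n
  proof (induction n)
    case 0
    have "\<tau> 0 = Var" by (simp add: \<tau>_def fun_eq_iff)
    then show ?case using assms(1) by (simp add: fset.map_ident_strong)
  next
    case (Suc n)
    show ?case using RGA_subst[OF Suc, of n "\<sigma> n"]
      by (simp add: * fset.map_comp comp_def)
  qed
  have "finite (fv c \<union> (\<Union>t \<in> fset \<Gamma>. fv t))" by (simp add: finite_fv)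
  then obtain n where "\<And>i. i \<in> fv c \<union> (\<Union>t \<in> fset \<Gamma>. fv t) \<Longrightarrow> i < n"
    using finite_nat_set_iff_bounded by metis
  then have "sub (\<tau> n) t = sub \<sigma> t" if "t = c \<or> t |\<in>| \<Gamma>" for t
    using that by (intro sub_cong) (auto simp: \<tau>_def)
  then show ?thesis using n[of n] by (metis (no_types, lifting) fset.map_cong0)
qed

section \<open>Grounded evaluation\<close>

text \<open>Truth is evaluation to 1 and falsity is evaluation to 0. As in Kleene's slash, a true universal must
  also be provable, which is what turns semantic disjunction into the disjunction property of RGA. The
  recursor fires when its argument merely evaluates to a numeral: equal terms are interchangeable
  in RGA, so the syntactic condition of \<open>head_step\<close> would not be sound for \<open>eq_subst\<close>.\<close>

inductive eval :: "tm \<Rightarrow> nat \<Rightarrow> bool" and red :: "tm \<Rightarrow> tm \<Rightarrow> bool" where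
  Zr: "eval Zr 0"
| Sc: "eval t n \<Longrightarrow> eval (Sc t) (Suc n)"
| Eq: "eval t m \<Longrightarrow> eval u n \<Longrightarrow> eval (Eq t u) (if m = n then 1 else 0)"
| Neg0: "eval t 0 \<Longrightarrow> eval (Neg t) 1"
| Neg1: "eval t 1 \<Longrightarrow> eval (Neg t) 0"
| OrL: "eval t 1 \<Longrightarrow> eval (Or t u) 1"
| OrR: "eval u 1 \<Longrightarrow> eval (Or t u) 1"
| Or0: "eval t 0 \<Longrightarrow> eval u 0 \<Longrightarrow> eval (Or t u) 0"
| Univ1: "RGA ({||} \<turnstile> Univ \<cdot> f) \<Longrightarrow> (\<And>n. eval (f \<cdot> num n) 1) \<Longrightarrow> eval (Univ \<cdot> f) 1"
| Univ0: "eval (f \<cdot> num n) 0 \<Longrightarrow> eval (Univ \<cdot> f) 0"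
| red: "red t t' \<Longrightarrow> eval t' n \<Longrightarrow> eval t n"
| beta: "red (Lam b \<cdot> t) (inst 0 t b)"
| rec0: "eval a 0 \<Longrightarrow> red (Rec \<cdot> g \<cdot> h \<cdot> a) g"
| recS: "eval a (Suc n) \<Longrightarrow> red (Rec \<cdot> g \<cdot> h \<cdot> a) (h \<cdot> num n \<cdot> (Rec \<cdot> g \<cdot> h \<cdot> num n))"
| app: "red t t' \<Longrightarrow> red (t \<cdot> u) (t' \<cdot> u)"

section \<open>Inversion and determinism of evaluation\<close>

inductive_cases red_simpsE: "red Zr t" "red (Sc a) t" "red (Eq a b) t" "red (Neg a) t" "red (Or a b) t"
  "red Bot t" "red (Var i) t" "red (Lam b) t" "red Rec t" "red Univ t"

inductive_cases red_AppE: "red (a \<cdot> b) t"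

lemma red_value [simp]: "\<not> red Zr t" "\<not> red (Sc a) t" "\<not> red (Eq a b) t" "\<not> red (Neg a) t"
  "\<not> red (Or a b) t" "\<not> red Bot t" "\<not> red (Var i) t" "\<not> red (Lam b) t" "\<not> red Rec t" "\<not> red Univ t"
  by (auto elim: red_simpsE)

lemma red_partial [simp]: "\<not> red (Univ \<cdot> f) t" "\<not> red (Rec \<cdot> g) t" "\<not> red (Rec \<cdot> g \<cdot> h) t"
  by (auto elim!: red_AppE)

inductive_cases eval_ZrE: "eval Zr n" and eval_ScE: "eval (Sc t) n" and eval_EqE: "eval (Eq t u) n"
  and eval_NegE: "eval (Neg t) n" and eval_OrE: "eval (Or t u) n" and eval_AppE: "eval (t \<cdot> u) n"
  and eval_BotE: "eval Bot n" and eval_VarE: "eval (Var i) n"  and eval_LamE: "eval (Lam t) n"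
  and eval_RecE: "eval Rec n" and eval_UnivE: "eval Univ n"

lemma eval_Eq_iff: "eval (Eq t u) n \<longleftrightarrow> (\<exists>k l. eval t k \<and> eval u l \<and> n = (if k = l then 1 else 0))"
proof
  assume "eval (Eq t u) n"
  then show "\<exists>k l. eval t k \<and> eval u l \<and> n = (if k = l then 1 else 0)"
    by (rule eval_EqE) (blast, simp)
next
  assume "\<exists>k l. eval t k \<and> eval u l \<and> n = (if k = l then 1 else 0)"
  then show "eval (Eq t u) n" by (elim exE conjE) (simp only: eval_red.Eq)
qed

lemma eval_Neg_iff: "eval (Neg t) n \<longleftrightarrow> eval t 0 \<and> n = 1 \<or> eval t 1 \<and> n = 0"
proof
  assume "eval (Neg t) n"
  then show "eval t 0 \<and> n = 1 \<or> eval t 1 \<and> n = 0" by (rule eval_NegE) simp_all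
qed (elim disjE conjE; simp only: eval_red.Neg0 eval_red.Neg1)

lemma eval_Or_iff: "eval (Or t u) n \<longleftrightarrow>
    (eval t 1 \<or> eval u 1) \<and> n = 1 \<or> eval t 0 \<and> eval u 0 \<and> n = 0"
proof
  assume "eval (Or t u) n"
  then show "(eval t 1 \<or> eval u 1) \<and> n = 1 \<or> eval t 0 \<and> eval u 0 \<and> n = 0"
    by (rule eval_OrE) simp_all
qed (elim disjE conjE; simp only: eval_red.OrL eval_red.OrR eval_red.Or0)

lemma eval_Univ_iff: "eval (Univ \<cdot> f) n \<longleftrightarrow>
    RGA ({||} \<turnstile> Univ \<cdot> f) \<and> (\<forall>k. eval (f \<cdot> num k) 1) \<and> n = 1 \<or> (\<exists>k. eval (f \<cdot> num k) 0) \<and> n = 0"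
proof
  assume "eval (Univ \<cdot> f) n"
  then show "RGA ({||} \<turnstile> Univ \<cdot> f) \<and> (\<forall>k. eval (f \<cdot> num k) 1) \<and> n = 1 \<or>
      (\<exists>k. eval (f \<cdot> num k) 0) \<and> n = 0"
    by (rule eval_AppE) (simp, blast, simp)
qed (elim disjE conjE exE; simp only: eval_red.Univ1 eval_red.Univ0 simp_thms)

lemma eval_simps [simp]:
  "eval Zr n \<longleftrightarrow> n = 0"
  "eval (Sc t) n \<longleftrightarrow> (\<exists>k. n = Suc k \<and> eval t k)"
  "\<not> eval Bot n" "\<not> eval (Var i) n" "\<not> eval (Lam t) n" "\<not> eval Rec n" "\<not> eval Univ n"
  by (auto intro: eval_red.Zr eval_red.Sc
      elim: eval_ZrE eval_ScE eval_BotE eval_VarE eval_LamE eval_RecE eval_UnivE)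

lemmas eval_iffs = eval_Eq_iff eval_Neg_iff eval_Or_iff eval_Univ_iff

lemma red_App: "red (t \<cdot> u) v \<longleftrightarrow> (\<exists>b. t = Lam b \<and> v = inst 0 u b)
    \<or> (\<exists>g h. t = Rec \<cdot> g \<cdot> h \<and> eval u 0 \<and> v = g)
    \<or> (\<exists>g h n. t = Rec \<cdot> g \<cdot> h \<and> eval u (Suc n) \<and> v = h \<cdot> num n \<cdot> (Rec \<cdot> g \<cdot> h \<cdot> num n))
    \<or> (\<exists>t'. red t t' \<and> v = t' \<cdot> u)"
  by (auto intro: eval_red.beta eval_red.rec0 eval_red.recS eval_red.app elim!: red_AppE)

lemma eval_num [simp]: "eval (num m) n \<longleftrightarrow> n = m"
  by (induction m arbitrary: n) (auto simp: num_0 num_Suc)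

text \<open>Values and reducts have to be shown unique together, because the value of its last
  argument decides how a recursor reduces. For disjunctions and universals, a true and a false
  verdict would meet at a common subterm or instance, where the induction hypothesis excludes
  it.\<close>

lemma eval_red_det:
  shows "eval t m \<Longrightarrow> eval t n \<Longrightarrow> m = n" and "red t t' \<Longrightarrow> red t t'' \<Longrightarrow> t' = t''"
proof (induction arbitrary: n and t'' rule: eval_red.inducts)
  case (red t t' m)
  from red.prems show ?case
  proof cases
    case (red t1)
    then show ?thesis using red.IH by blast
  qed (use red.hyps in auto)
next
  case (beta b t)
  then show ?case unfolding red_App by auto
next
  case (rec0 a g h)
  from rec0.prems rec0.IH show ?case unfolding red_App by auto
next
  case (recS a n g h)
  from recS.prems recS.IH show ?case unfolding red_App by auto
next
  case (app t t' u)
  \<comment> \<open>A function that reduces further is neither an abstraction nor a recursor with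
    two arguments, so only the rule \<open>app\<close> can have produced the other reduct.\<close>
  from app.prems app.hyps app.IH show ?case unfolding red_App by (metis red_value(8) red_partial(3))
next
  case (Sc t k)
  from Sc.prems obtain k' where "eval t k'" "n = Suc k'" by auto
  then show ?case using Sc.IH by blast
next
  case (Eq t k u l)
  from Eq.prems obtain k' l' where "eval t k'" "eval u l'" "n = (if k' = l' then 1 else 0)"
    unfolding eval_iffs by blast
  then show ?case using Eq.IH by blast
next
  case (Neg0 t) then show ?case unfolding eval_iffs by (metis zero_neq_one)
next
  case (Neg1 t) then show ?case unfolding eval_iffs by (metis zero_neq_one)
next
  case (OrL t u) then show ?case unfolding eval_iffs by (metis zero_neq_one)
next
  case (OrR t u) then show ?case unfolding eval_iffs by (metis zero_neq_one)
next
  case (Or0 t u) then show ?case unfolding eval_iffs by (metis zero_neq_one)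
next
  case (Univ1 f) then show ?case unfolding eval_iffs by (metis zero_neq_one)
next
  case (Univ0 f k) then show ?case unfolding eval_iffs by (metis zero_neq_one)
qed simp

lemma eval_red_iff: "red t t' \<Longrightarrow> eval t n \<longleftrightarrow> eval t' n"
proof
  assume *: "red t t'" "eval t n"
  from *(2) show "eval t' n"
    by cases (use * eval_red_det(2) in \<open>auto\<close>)
qed (rule eval_red.red)

lemma head_step_red: "t \<triangleright> t' \<Longrightarrow> red t t'"
  by (induction rule: head_step.induct) (auto intro: eval_red.intros)

lemma eval_head_steps: "head_step\<^sup>*\<^sup>* t t' \<Longrightarrow> eval t n \<longleftrightarrow> eval t' n"
  by (induction rule: rtranclp_induct) (auto dest: head_step_red eval_red_iff)

section \<open>Terms with a value do not act as functions\<close>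

lemma red_apps: "red t t' \<Longrightarrow> red (apps t us) (apps t' us)"
  by (induction us arbitrary: t t') (auto intro: eval_red.app)

lemma fsub_apps: "fsub i s (apps t us) = apps (fsub i s t) (map (fsub i s) us)"
  by (induction us arbitrary: t) auto

lemma apps_snoc: "apps t (us @ [u]) = apps t us \<cdot> u"
  by (simp add: apps_append)

text \<open>An irreducible head stays irreducible under arguments unless it is an abstraction or an
  incomplete recursor, and a value could then only come from \<open>Univ\<close>. The hypotheses
  exclude \<open>Rec\<close> with up to two arguments, as further ones could complete a
  redex.\<close>

lemma eval_stuck_value:
  assumes "\<And>t. \<not> red a t" "\<And>b. a \<noteq> Lam b" "\<And>g h. a \<noteq> Rec \<cdot> g \<cdot> h" "\<And>g. a \<noteq> Rec \<cdot> g"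
    "a \<noteq> Rec" "a \<noteq> Univ"
  shows "\<not> eval (apps a (u # us)) n"
proof -
  have head: "apps a vs = Lam b \<Longrightarrow> False" "apps a vs = Rec \<Longrightarrow> False" "apps a vs = Univ \<Longrightarrow> False"
    for vs b using assms by (cases vs rule: rev_cases; simp add: apps_snoc)+
  have head2: "apps a vs = Rec \<cdot> g \<Longrightarrow> False" for vs g
    using assms head(2) by (cases vs rule: rev_cases) (auto simp: apps_snoc)
  have head3: "apps a vs = Rec \<cdot> g \<cdot> h \<Longrightarrow> False" for vs g h
    using assms head2 by (cases vs rule: rev_cases) (auto simp: apps_snoc)
  have red: "\<not> red (apps a vs) t" for vs t
  proof (induction vs arbitrary: t rule: rev_induct)
    case (snoc v vs)
    then show ?case using head head3 unfolding apps_snoc red_App by blast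
  qed (simp add: assms(1))
  obtain vs v where "u # us = vs @ [v]" by (metis list.distinct(1) rev_exhaust)
  moreover have "\<not> eval (apps a vs \<cdot> v) n"
    using red[of "vs @ [v]"] head(3)[of vs] by (auto simp: apps_snoc elim: eval_AppE)
  ultimately show ?thesis by (metis apps_snoc)
qed

text \<open>Head reduction of the application runs through the reductions of \<open>a\<close>, which
  end in a term of one of the shapes that \<open>eval\<close> gives a value directly, and none of
  these can consume an argument.\<close>

lemma eval_stuck:
  assumes "eval a m"
  shows "\<not> eval (apps a (u # us)) n"
  using assms
proof (induction a m rule: eval_red.inducts(1)[where ?P2.0 = "\<lambda>_ _. True"])
  case (red t t' m)
  then show ?case using eval_red_iff[OF red_apps, of t t'] by blast
qed (rule TrueI | rule eval_stuck_value; simp)+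

text \<open>Both sides of a provable equation denote numbers, so a reduction of a function cannot be
  recorded as an equation. The claim for \<open>red\<close> therefore speaks about fully applied
  terms and carries the trailing arguments \<open>us\<close>.\<close>

lemma RGA_eval_red:
  shows "eval t n \<Longrightarrow> RGA ({||} \<turnstile> Eq t (num n))"
    and "red t t' \<Longrightarrow> RGA ({||} \<turnstile> Eq (apps t' us) (num k)) \<Longrightarrow> RGA ({||} \<turnstile> Eq (apps t us) (num k))"
proof (induction arbitrary: and us k rule: eval_red.inducts)
  case Zr
  show ?case using RGA_zero_nat by (simp add: num_0)
next
  case (Sc t n)
  then show ?case using RGA_eq_Sc by (simp add: num_Suc)
next
  case (Eq t m u n)
  show ?case
  proof (cases "m = n")
    case True
    then have "RGA ({||} \<turnstile> Eq t u)"
      using Eq.IH RGA_eq_trans RGA_eq_sym by blast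
    then show ?thesis using True RGA_true_one by simp
  next
    case False
    then have "RGA ({||} \<turnstile> Neq t u)"
      using RGA_neq_cong[OF RGA_eq_sym[OF Eq.IH(1)] RGA_neq_sym[OF
          RGA_neq_cong[OF RGA_eq_sym[OF Eq.IH(2)] RGA_num_neq]]] by blast
    then show ?thesis using False RGA_false_zero by simp
  qed
next
  case (Neg0 t)
  then show ?case using RGA_zero_false RGA_true_one by blast
next
  case (Neg1 t)
  then show ?case using RGA_one_true RGA_dnegI RGA_false_zero by blast
next
  case (OrL t u)
  then show ?case using RGA_one_true RGA_orI1 RGA_true_one by blast
next
  case (OrR t u)
  then show ?case using RGA_one_true RGA_orI2 RGA_true_one by blast
next
  case (Or0 t u)
  then show ?case using RGA_zero_false RGA_norI RGA_false_zero by blast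
next
  case (Univ1 f)
  then show ?case using RGA_true_one by blast
next
  case (Univ0 f n)
  then show ?case using RGA_zero_false RGA_nallI RGA_num_nat RGA_false_zero by blast
next
  case (red t t' n)
  then show ?case using red.IH(1)[of "[]"] by simp
next
  case (beta b t)
  then show ?case using RGA_conv_eq_trans head_step_apps head_step.beta by meson
next
  case (rec0 a g h)
  \<comment> \<open>The calculus reduces only at the literal \<open>Zr\<close>. The equation is
    proved for \<open>Zr\<close> and then rewritten to the provably equal \<open>a\<close>, with
    \<open>Var i\<close> marking the place.\<close>
  obtain i where i: "i \<notin> fv (apps (g \<cdot> h) us)" using fresh_var by blast
  have "RGA ({||} \<turnstile> Eq (apps (Rec \<cdot> g \<cdot> h \<cdot> Zr) us) (num k))"
    using rec0.prems RGA_conv_eq_trans head_step_apps head_step.rec_zero by meson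
  then show ?case
    using RGA_eq_subst[OF RGA_eq_sym[OF rec0.IH], of i "Eq (apps (Rec \<cdot> g \<cdot> h \<cdot> Var i) us) (num k)"] i
    by (simp add: fsub_apps fsub_fresh num_0 fv_apps map_idI)
next
  case (recS a n g h)
  obtain i where i: "i \<notin> fv (apps (g \<cdot> h) us)" using fresh_var by blast
  have "RGA ({||} \<turnstile> Eq (apps (Rec \<cdot> g \<cdot> h \<cdot> Sc (num n)) us) (num k))"
    using recS.prems RGA_conv_eq_trans head_step_apps head_step.rec_suc by meson
  then show ?case
    using RGA_eq_subst[OF RGA_eq_sym[OF recS.IH], of i "Eq (apps (Rec \<cdot> g \<cdot> h \<cdot> Var i) us) (num k)"] i
    by (simp add: fsub_apps fsub_fresh num_Suc fv_apps map_idI)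
next
  case (app t t' u)
  then show ?case using app.IH[of "u # us"] by simp
qed

lemma RGA_eval_true: "eval t 1 \<Longrightarrow> RGA ({||} \<turnstile> t)"
  using RGA_eval_red(1) RGA_one_true by blast

section \<open>Replacing a subterm by one of equal value\<close>

fun head :: "tm \<Rightarrow> tm" where
  "head (t \<cdot> u) = head t"
| "head t = t"

lemma head_apps: "\<exists>us. t = apps (head t) us"
proof (induction t rule: head.induct)
  case (1 t u)
  then show ?case by (metis apps_snoc head.simps(1))
qed (auto intro: exI[of _ "[]"])

text \<open>The simulation below breaks down only when the replaced term stands in head position of an
  application; there the application has no value at all.\<close>

lemma eval_fsub_head:
  assumes "eval a k" "eval b k" "eval (fsub i a p) n" "head p = Var i"
  shows "eval (fsub i b p) n"
proof -
  obtain us where p: "p = apps (Var i) us" using head_apps[of p] assms(4) by auto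
  show ?thesis
  proof (cases us)
    case Nil
    then show ?thesis using p assms eval_red_det(1) by fastforce
  next
    case (Cons v vs)
    then show ?thesis
      using eval_stuck[OF assms(1)] assms(3) unfolding p by (simp add: fsub_apps)
  qed
qed

lemma fsub_eq_cases:
  "Zr = fsub i a p \<Longrightarrow> head p \<noteq> Var i \<Longrightarrow> p = Zr"
  "Sc t = fsub i a p \<Longrightarrow> head p \<noteq> Var i \<Longrightarrow> \<exists>q. p = Sc q \<and> t = fsub i a q"
  "Eq t u = fsub i a p \<Longrightarrow> head p \<noteq> Var i \<Longrightarrow> \<exists>q r. p = Eq q r \<and> t = fsub i a q \<and> u = fsub i a r"
  "Neg t = fsub i a p \<Longrightarrow> head p \<noteq> Var i \<Longrightarrow> \<exists>q. p = Neg q \<and> t = fsub i a q"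
  "Or t u = fsub i a p \<Longrightarrow> head p \<noteq> Var i \<Longrightarrow> \<exists>q r. p = Or q r \<and> t = fsub i a q \<and> u = fsub i a r"
  "t \<cdot> u = fsub i a p \<Longrightarrow> head p \<noteq> Var i \<Longrightarrow>
     \<exists>q r. p = q \<cdot> r \<and> t = fsub i a q \<and> u = fsub i a r \<and> head q \<noteq> Var i"
  "Lam b = fsub i a p \<Longrightarrow> head p \<noteq> Var i \<Longrightarrow> \<exists>q. p = Lam q \<and> b = fsub (Suc i) (up a) q"
  "Rec = fsub i a p \<Longrightarrow> head p \<noteq> Var i \<Longrightarrow> p = Rec"
  "Univ = fsub i a p \<Longrightarrow> head p \<noteq> Var i \<Longrightarrow> p = Univ"
  by (cases p; auto split: if_splits)+

text \<open>The evaluation of \<open>fsub i a p\<close> is replayed for \<open>fsub i b p\<close>.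
  As long as the head of the pattern is not the hole \<open>Var i\<close>, the pattern has the shape
  that the last rule requires; a reduct is again a filled pattern, so the simulation
  continues.\<close>

lemma eval_red_fsub:
  assumes "eval a k" "eval b k"
  shows "eval t n \<Longrightarrow> t = fsub i a p \<Longrightarrow> eval (fsub i b p) n"
    and "red t t' \<Longrightarrow> t = fsub i a q \<Longrightarrow> head q \<noteq> Var i \<Longrightarrow>
      \<exists>q'. t' = fsub i a q' \<and> red (fsub i b q) (fsub i b q')"
proof (induction arbitrary: p and q rule: eval_red.inducts)
  note wlog = eval_fsub_head[OF assms, of i]
  \<comment> \<open>Terms of equal value are provably equal, so \<open>eq_subst\<close> transfers
    the provability clause of a true universal.\<close>
  have univ: "RGA ({||} \<turnstile> Univ \<cdot> fsub i b f)" if "RGA ({||} \<turnstile> Univ \<cdot> fsub i a f)" for f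
  proof -
    have "RGA ({||} \<turnstile> Eq a b)"
      using RGA_eval_red(1)[OF assms(1)] RGA_eval_red(1)[OF assms(2)] RGA_eq_sym RGA_eq_trans by blast
    from RGA_eq_subst[OF this, of i "Univ \<cdot> f"] that show ?thesis by simp
  qed
  {
    case Zr
    then show ?case using wlog[of p 0] fsub_eq_cases(1)[of i a p]
      by (cases "head p = Var i") (metis eval_red.Zr fsub.simps(3))+
  next
    case (Sc t n)
    show ?case
    proof (cases "head p = Var i")
      case True
      then show ?thesis using wlog[of p] Sc.hyps Sc.prems eval_red.Sc by metis
    next
      case False
      then obtain q where "p = Sc q" "t = fsub i a q" using fsub_eq_cases(2)[OF Sc.prems] by blast
      then show ?thesis using Sc.IH by simp
    qed
  next
    case (Eq t m u n)
    show ?case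
    proof (cases "head p = Var i")
      case True
      then show ?thesis using wlog[of p] Eq.hyps Eq.prems eval_red.Eq by metis
    next
      case False
      then obtain q r where "p = Eq q r" "t = fsub i a q" "u = fsub i a r"
        using fsub_eq_cases(3)[OF Eq.prems] by blast
      then show ?thesis using Eq.IH eval_red.Eq[of "fsub i b q" m "fsub i b r" n] by simp
    qed
  next
    case (Neg0 t)
    show ?case
    proof (cases "head p = Var i")
      case True
      then show ?thesis using wlog[of p] Neg0.hyps Neg0.prems eval_red.Neg0 by metis
    next
      case False
      then obtain q where "p = Neg q" "t = fsub i a q" using fsub_eq_cases(4)[OF Neg0.prems] by blast
      then show ?thesis using Neg0.IH by (simp add: eval_iffs)
    qed
  next
    case (Neg1 t)
    show ?case
    proof (cases "head p = Var i")
      case True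
      then show ?thesis using wlog[of p] Neg1.hyps Neg1.prems eval_red.Neg1 by metis
    next
      case False
      then obtain q where "p = Neg q" "t = fsub i a q" using fsub_eq_cases(4)[OF Neg1.prems] by blast
      then show ?thesis using Neg1.IH by (simp add: eval_iffs)
    qed
  next
    case (OrL t u)
    show ?case
    proof (cases "head p = Var i")
      case True
      then show ?thesis using wlog[of p] OrL.hyps OrL.prems eval_red.OrL by metis
    next
      case False
      then obtain q r where "p = Or q r" "t = fsub i a q" "u = fsub i a r"
        using fsub_eq_cases(5)[OF OrL.prems] by blast
      then show ?thesis using OrL.IH by (simp add: eval_iffs)
    qed
  next
    case (OrR u t)
    show ?case
    proof (cases "head p = Var i")
      case True
      then show ?thesis using wlog[of p] OrR.hyps OrR.prems eval_red.OrR by metis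
    next
      case False
      then obtain q r where "p = Or q r" "t = fsub i a q" "u = fsub i a r"
        using fsub_eq_cases(5)[OF OrR.prems] by blast
      then show ?thesis using OrR.IH by (simp add: eval_iffs)
    qed
  next
    case (Or0 t u)
    show ?case
    proof (cases "head p = Var i")
      case True
      then show ?thesis using wlog[of p] Or0.hyps Or0.prems eval_red.Or0 by metis
    next
      case False
      then obtain q r where "p = Or q r" "t = fsub i a q" "u = fsub i a r"
        using fsub_eq_cases(5)[OF Or0.prems] by blast
      then show ?thesis using Or0.IH by (simp add: eval_iffs)
    qed
  next
    case (Univ1 f)
    show ?case
    proof (cases "head p = Var i")
      case True
      then show ?thesis using wlog[of p] Univ1.hyps Univ1.prems eval_red.Univ1 by metis
    next
      case False
      then obtain q where q: "p = Univ \<cdot> q" "f = fsub i a q"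
        using fsub_eq_cases(6)[OF Univ1.prems] fsub_eq_cases(9) by blast
      then have "eval (fsub i b q \<cdot> num n) 1" for n
        using Univ1.IH[of n "q \<cdot> num n"] by simp
      then show ?thesis using q univ Univ1.hyps by (simp add: eval_iffs)
    qed
  next
    case (Univ0 f n)
    show ?case
    proof (cases "head p = Var i")
      case True
      then show ?thesis using wlog[of p] Univ0.hyps Univ0.prems eval_red.Univ0 by metis
    next
      case False
      then obtain q where q: "p = Univ \<cdot> q" "f = fsub i a q"
        using fsub_eq_cases(6)[OF Univ0.prems] fsub_eq_cases(9) by blast
      then have "eval (fsub i b q \<cdot> num n) 0"
        using Univ0.IH[of "q \<cdot> num n"] by simp
      then show ?thesis using q by (auto simp: eval_iffs)
    qed
  next
    case (red t t' n)
    show ?case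
    proof (cases "head p = Var i")
      case True
      then show ?thesis using wlog[of p] red.hyps red.prems eval_red.red by metis
    next
      case False
      then obtain p' where "t' = fsub i a p'" "red (fsub i b p) (fsub i b p')"
        using red.IH(1) red.prems by blast
      then show ?thesis using red.IH(2) eval_red.red by blast
    qed
  next
    case (beta u t)
    then obtain r s where q: "q = Lam r \<cdot> s" "u = fsub (Suc i) (up a) r" "t = fsub i a s"
      using fsub_eq_cases(6)[OF beta.prems] fsub_eq_cases(7) by blast
    then show ?case
      by (intro exI[of _ "inst 0 s r"]) (simp add: fsub_inst eval_red.beta)
  next
    case (rec0 c g h)
    then obtain q1 q2 q3 where q: "q = Rec \<cdot> q1 \<cdot> q2 \<cdot> q3" "g = fsub i a q1" "h = fsub i a q2" "c = fsub i a q3"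
      using fsub_eq_cases(6,8) by metis
    then show ?case using rec0.IH eval_red.rec0 by (intro exI[of _ q1]) simp
  next
    case (recS c n g h)
    then obtain q1 q2 q3 where q: "q = Rec \<cdot> q1 \<cdot> q2 \<cdot> q3" "g = fsub i a q1" "h = fsub i a q2" "c = fsub i a q3"
      using fsub_eq_cases(6,8) by metis
    then show ?case using recS.IH eval_red.recS
      by (intro exI[of _ "q2 \<cdot> num n \<cdot> (Rec \<cdot> q1 \<cdot> q2 \<cdot> num n)"]) simp
  next
    case (app t t' u)
    then obtain r s where q: "q = r \<cdot> s" "t = fsub i a r" "u = fsub i a s" "head r \<noteq> Var i"
      using fsub_eq_cases(6)[OF app.prems] by blast
    then obtain r' where "t' = fsub i a r'" "red (fsub i b r) (fsub i b r')"
      using app.IH by blast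
    then show ?case using q eval_red.app by (intro exI[of _ "r' \<cdot> s"]) simp
  }
qed

lemma eval_fsub_cong:
  "eval a k \<Longrightarrow> eval b k \<Longrightarrow> eval (fsub i a p) n \<Longrightarrow> eval (fsub i b p) n"
  using eval_red_fsub(1) by blast

section \<open>Soundness of RGA\<close>

lemma eval_isN: "eval (isN t) 1 \<longleftrightarrow> (\<exists>k. eval t k)"
  unfolding eval_Eq_iff using eval_red_det(1) by fastforce

lemma eval_Eq_1: "eval (Eq t u) 1 \<longleftrightarrow> (\<exists>k. eval t k \<and> eval u k)"
  unfolding eval_Eq_iff by auto

lemma eval_Eq_0: "eval (Eq t u) 0 \<longleftrightarrow> (\<exists>k l. eval t k \<and> eval u l \<and> k \<noteq> l)"
  unfolding eval_Eq_iff by auto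

lemma eval_Neg_1: "eval (Neg t) 1 \<longleftrightarrow> eval t 0" and eval_Neg_0: "eval (Neg t) 0 \<longleftrightarrow> eval t 1"
  unfolding eval_Neg_iff by auto

lemma eval_Or_1: "eval (Or t u) 1 \<longleftrightarrow> eval t 1 \<or> eval u 1"
  and eval_Or_0: "eval (Or t u) 0 \<longleftrightarrow> eval t 0 \<and> eval u 0"
  unfolding eval_Or_iff by auto

lemma eval_Univ_0: "eval (Univ \<cdot> f) 0 \<longleftrightarrow> (\<exists>k. eval (f \<cdot> num k) 0)"
  and eval_Univ_1: "eval (Univ \<cdot> f) 1 \<longleftrightarrow> RGA ({||} \<turnstile> Univ \<cdot> f) \<and> (\<forall>k. eval (f \<cdot> num k) 1)"
  unfolding eval_Univ_iff by auto

lemmas eval_truth = eval_Eq_1 eval_Eq_0 eval_Neg_1 eval_Neg_0 eval_Or_1 eval_Or_0 eval_Univ_0 eval_Univ_1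

lemmas eval_truth' = eval_truth[unfolded One_nat_def]

lemma eval_consistent: "eval t 0 \<Longrightarrow> eval t 1 \<Longrightarrow> False"
  using eval_red_det(1) by fastforce

lemma sub_fsub: "sub \<sigma> (fsub i s t) = sub (\<sigma>(i := sub \<sigma> s)) t"
  by (auto simp: fsub_eq_sub sub_sub intro: sub_cong)

lemma eval_sub_cong:
  assumes "\<And>j. fv (\<sigma> j) = {}" "eval a k" "eval b k" "eval (sub (\<sigma>(i := a)) p) n"
  shows "eval (sub (\<sigma>(i := b)) p) n"
proof -
  \<comment> \<open>All terms supplied by \<open>\<sigma>\<close> are closed, so index 0 is
    available as the hole.\<close>
  have "fsub 0 s (sub (\<sigma>(i := Var 0)) p) = sub (\<sigma>(i := s)) p" for s
    using assms(1) by (auto simp: fsub_eq_sub sub_sub sub_closed intro!: sub_cong)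
  then show ?thesis
    using eval_fsub_cong[OF assms(2,3), of 0 "sub (\<sigma>(i := Var 0)) p" n] assms(4) by simp
qed

lemma eval_App_cong: "eval a k \<Longrightarrow> eval b k \<Longrightarrow> eval (f \<cdot> a) n \<Longrightarrow> eval (f \<cdot> b) n"
proof -
  assume *: "eval a k" "eval b k" "eval (f \<cdot> a) n"
  obtain i where "i \<notin> fv f" using fresh_var by blast
  then show ?thesis using eval_fsub_cong[OF *(1,2), of i "f \<cdot> Var i" n] *(3)
    by (simp add: fsub_fresh)
qed

text \<open>\<open>recS\<close> hands a numeral to the step term, whereas \<open>rec_eq\<close>
  hands it \<open>m\<close> itself; the two may be exchanged because they have the same
  value.\<close>

lemma eval_Rec_Sc:
  assumes "eval m k" "eval (h \<cdot> m \<cdot> (Rec \<cdot> g \<cdot> h \<cdot> m)) v"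
  shows "eval (Rec \<cdot> g \<cdot> h \<cdot> Sc m) v"
proof -
  obtain i where "i \<notin> fv (g \<cdot> h)" using fresh_var by blast
  then have "eval (h \<cdot> num k \<cdot> (Rec \<cdot> g \<cdot> h \<cdot> num k)) v"
    using eval_fsub_cong[of m k "num k" i "h \<cdot> Var i \<cdot> (Rec \<cdot> g \<cdot> h \<cdot> Var i)" v] assms
    by (simp add: fsub_fresh)
  moreover have "red (Rec \<cdot> g \<cdot> h \<cdot> Sc m) (h \<cdot> num k \<cdot> (Rec \<cdot> g \<cdot> h \<cdot> num k))"
    using assms(1) by (intro eval_red.recS) simp
  ultimately show ?thesis using eval_red.red by blast
qed

definition scons :: "tm \<Rightarrow> (nat \<Rightarrow> tm) \<Rightarrow> nat \<Rightarrow> tm" where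
  "scons s \<sigma> i = (case i of 0 \<Rightarrow> s | Suc j \<Rightarrow> \<sigma> j)"

lemma scons_0 [simp]: "scons s \<sigma> 0 = s"
  by (simp add: scons_def)

lemma sub_scons_up [simp]: "sub (scons s \<sigma>) (up t) = sub \<sigma> t"
  by (simp add: up_eq_sub sub_ren scons_def)

text \<open>Variables range over arbitrary closed terms, including those without a value, as
  \<open>subst\<close> inserts arbitrary terms; numerical variables are marked by hypotheses
  \<open>isN\<close>.\<close>

definition valid :: "sequent \<Rightarrow> bool" where
  "valid j \<longleftrightarrow> (case j of (\<Gamma> \<turnstile> c) \<Rightarrow> \<forall>\<sigma>. (\<forall>i. fv (\<sigma> i) = {}) \<longrightarrow>
     (\<forall>g |\<in>| \<Gamma>. eval (sub \<sigma> g) 1) \<longrightarrow> eval (sub \<sigma> c) 1)"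

lemma validD:
  "valid (\<Gamma> \<turnstile> c) \<Longrightarrow> (\<And>i. fv (\<sigma> i) = {}) \<Longrightarrow> (\<And>g. g |\<in>| \<Gamma> \<Longrightarrow> eval (sub \<sigma> g) 1) \<Longrightarrow> eval (sub \<sigma> c) 1"
  unfolding valid_def by simp

text \<open>Besides validity of the premises, derivability of the conclusion is assumed: at
  \<open>allI\<close> the valid premise yields only the truth of all instances, not that the
  universal is provable.\<close>

lemma rga_rule_valid:
  assumes rule: "rga_rule ps (\<Gamma> \<turnstile> c)" and prems: "\<And>p. p \<in> set ps \<Longrightarrow> valid p"
    and RGA: "RGA (\<Gamma> \<turnstile> c)"
    and closed: "\<And>i. fv (\<sigma> i) = {}" and ctx: "\<And>g. g |\<in>| \<Gamma> \<Longrightarrow> eval (sub \<sigma> g) 1"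
  shows "eval (sub \<sigma> c) 1"
proof -
  have V: "eval (sub \<sigma> a) 1" if "(\<Gamma> \<turnstile> a) \<in> set ps" for a
    using validD[OF prems[OF that] closed ctx] .
  have ext: "eval (sub \<sigma> a) 1" if "(finsert b \<Gamma> \<turnstile> a) \<in> set ps" "eval (sub \<sigma> b) 1" for a b
    using validD[OF prems[OF that(1)] closed] ctx that(2) by fastforce
  have closed_sub: "fv (sub \<sigma> s) = {}" for s using closed by (simp add: fv_sub)
  have closed_upd: "fv ((\<sigma>(i := s)) j) = {}" if "fv s = {}" for i j s
    using closed that by simp
  have closed_scons: "fv (scons (num k) \<sigma> j) = {}" for j k
    using closed by (cases j) (simp_all add: scons_def)
  from rule show ?thesis
  proof cases
    case (hyp \<Gamma>') then show ?thesis using ctx by simp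
  next
    case (weaken \<Gamma>' a)
    then show ?thesis using validD[OF prems closed] ctx by simp
  next
    case (cut a) then show ?thesis using V[of a] ext[of a c] by simp
  next
    case (subst \<Gamma>' c' i s)
    have "eval (sub (\<sigma>(i := sub \<sigma> s)) c') 1"
    proof (rule validD[OF prems closed_upd[OF closed_sub]])
      show "(\<Gamma>' \<turnstile> c') \<in> set ps" using subst by simp
      show "eval (sub (\<sigma>(i := sub \<sigma> s)) g) 1" if "g |\<in>| \<Gamma>'" for g
        using ctx[of "fsub i s g"] that subst by (simp add: sub_fsub)
    qed
    then show ?thesis using subst by (simp add: sub_fsub)
  next
    case (true_one a) then show ?thesis using V[of a] by (auto simp: eval_truth')
  next
    case one_true then show ?thesis using V[of "Eq c (num 1)"] by (auto simp: eval_truth')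
  next
    case (false_zero a) then show ?thesis using V[of "Neg a"] by (auto simp: eval_truth')
  next
    case (zero_false a) then show ?thesis using V[of "Eq a (num 0)"] by (auto simp: eval_truth')
  next
    case (explode a)
    then show ?thesis using V[of "Neg a"] V[of a] eval_consistent by (simp add: eval_truth') blast
  next
    case (dnegI a) then show ?thesis using V[of a] by (simp add: eval_truth')
  next
    case dnegE then show ?thesis using V[of "Neg (Neg c)"] by (simp add: eval_truth')
  next
    case (orI1 a b) then show ?thesis using V[of a] by (simp add: eval_truth')
  next
    case (orI2 b a) then show ?thesis using V[of b] by (simp add: eval_truth')
  next
    case (norI a b) then show ?thesis using V[of "Neg a"] V[of "Neg b"] by (simp add: eval_truth')
  next
    case (orE a b)
    then show ?thesis using V[of "Or a b"] ext[of a c] ext[of b c] by (auto simp: eval_truth')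
  next
    case (norE1 a b) then show ?thesis using V[of "Neg (Or a b)"] by (simp add: eval_truth')
  next
    case (norE2 a b) then show ?thesis using V[of "Neg (Or a b)"] by (simp add: eval_truth')
  next
    case (nat_refl a) then show ?thesis using V[of "isN a"] by simp
  next
    case (eq_sym a b) then show ?thesis using V[of "Eq a b"] by (auto simp: eval_truth')
  next
    case (eq_subst a b i p)
    then obtain k where "eval (sub \<sigma> a) k" "eval (sub \<sigma> b) k"
      using V[of "Eq a b"] by (auto simp: eval_truth')
    from eval_sub_cong[OF closed this] show ?thesis
      using V[of "fsub i a p"] eq_subst by (simp add: sub_fsub)
  next
    case (neq_sym a b) then show ?thesis using V[of "Neq a b"] by (auto simp: eval_truth')
  next
    case (eq_bool a b)
    then obtain k l where "eval (sub \<sigma> a) k" "eval (sub \<sigma> b) l"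
      using V[of "isN a"] V[of "isN b"] by (auto simp: eval_truth')
    then show ?thesis using eq_bool by (cases "k = l") (auto simp: eval_truth')
  next
    case (eq_boolE a b)
    then show ?thesis using V[of "isB (Eq a b)"] by (auto simp: eval_truth')
  next
    case zero_nat then show ?thesis by (simp add: eval_truth')
  next
    case (suc_natI a) then show ?thesis using V[of "isN a"] by (auto simp: eval_truth')
  next
    case (suc_natE a) then show ?thesis using V[of "isN (Sc a)"] by (auto simp: eval_truth')
  next
    case (suc_neq_zero a) then show ?thesis using V[of "isN a"] by (auto simp: eval_truth')
  next
    case (suc_neqI a b) then show ?thesis using V[of "Neq a b"] by (auto simp: eval_truth')
  next
    case (suc_neqE a b) then show ?thesis using V[of "Neq (Sc a) (Sc b)"] by (auto simp: eval_truth')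
  next
    case (suc_inj a b) then show ?thesis using V[of "Eq (Sc a) (Sc b)"] by (auto simp: eval_truth')
  next
    case bot_nat then show ?thesis using V[of "isN Bot"] by (auto simp: eval_truth')
  next
    case (nat_ind i d a)
    have fresh: "sub (\<sigma>(i := s)) g = sub \<sigma> g" if "g |\<in>| \<Gamma>" for s g
      using nat_ind(3) that by (auto intro!: sub_cong)
    \<comment> \<open>Induction on the standard numbers; the hypothesis \<open>isN (Var i)\<close>
      of the premise holds because the variable is set to a numeral. The result is then carried from
      the numeral of the value of \<open>a\<close> to \<open>a\<close> itself.\<close>
    have "eval (sub (\<sigma>(i := num n)) d) 1" for n
    proof (induction n)
      case 0
      then show ?case using V[of "fsub i Zr d"] nat_ind by (simp add: sub_fsub num_0 fun_upd_def)
    next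
      case (Suc n)
      then have IH: "eval (sub (\<sigma>(i := num n)) d) 1" by (simp add: fun_upd_def)
      have "eval (sub (\<sigma>(i := num n)) (fsub i (Sc (Var i)) d)) 1"
      proof (rule validD[OF prems, of "finsert (isN (Var i)) (finsert d \<Gamma>)"])
        show "\<And>g. g |\<in>| finsert (isN (Var i)) (finsert d \<Gamma>) \<Longrightarrow> eval (sub (\<sigma>(i := num n)) g) 1"
          using IH ctx fresh by (auto simp: eval_isN[unfolded One_nat_def])
      qed (use nat_ind closed_upd in auto)
      then show ?case by (simp add: sub_fsub num_Suc fun_upd_def cong: if_cong)
    qed
    moreover obtain k where "eval (sub \<sigma> a) k"
      using V[of "isN a"] nat_ind by (auto simp: eval_truth')
    ultimately show ?thesis
      using eval_sub_cong[OF closed, of "num k" k "sub \<sigma> a"] nat_ind by (simp add: sub_fsub)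
  next
    case (conv_expand c')
    then show ?thesis using V[of c'] eval_red_iff[OF head_step_red[OF head_step_sub]] by simp
  next
    case (conv_reduce c')
    then show ?thesis using V[of c'] eval_red_iff[OF head_step_red[OF head_step_sub]] by simp
  next
    case (conv_neg d d')
    then show ?thesis
      using V[of "Neg d"] eval_red_iff[OF head_step_red[OF head_step_sub]] by (simp add: eval_truth')
  next
    case (conv_eq d d')
    then show ?thesis
      using V[of "isN d'"] eval_red_iff[OF head_step_red[OF head_step_sub], of d d' \<sigma>]
      by (auto simp: eval_truth')
  next
    case (rec_eq m h g)
    obtain k v where "eval (sub \<sigma> m) k" "eval (sub \<sigma> (h \<cdot> m \<cdot> (Rec \<cdot> g \<cdot> h \<cdot> m))) v"
      using V[of "isN m"] V[of "isN (h \<cdot> m \<cdot> (Rec \<cdot> g \<cdot> h \<cdot> m))"] rec_eq by (auto simp: eval_truth')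
    then show ?thesis
      using rec_eq eval_Rec_Sc[of "sub \<sigma> m" k "sub \<sigma> h" "sub \<sigma> g" v]
      by (auto simp: eval_truth' intro!: exI[of _ v])
  next
    case (allI f)
    have "RGA (sub \<sigma> |`| \<Gamma> \<turnstile> sub \<sigma> (Univ \<cdot> f))"
      using RGA_sub[OF RGA closed] allI by simp
    \<comment> \<open>True hypotheses are provable by \<open>RGA_eval_true\<close>, so the
      instantiated context can be cut away.\<close>
    then have 1: "RGA ({||} \<turnstile> Univ \<cdot> sub \<sigma> f)"
      using RGA_cut_context RGA_eval_true ctx by fastforce
    have "eval (sub (scons (num k) \<sigma>) (up f \<cdot> Var 0)) 1" for k
    proof (rule validD[OF prems, of "finsert (isN (Var 0)) (up |`| \<Gamma>)"])
      show "\<And>g. g |\<in>| finsert (isN (Var 0)) (up |`| \<Gamma>) \<Longrightarrow> eval (sub (scons (num k) \<sigma>) g) 1"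
        using ctx by (auto simp: eval_isN[unfolded One_nat_def])
    qed (use allI closed_scons in auto)
    then show ?thesis using 1 allI by (simp add: eval_truth')
  next
    case (allE f a)
    obtain k where "eval (sub \<sigma> a) k" "eval (sub \<sigma> f \<cdot> num k) 1"
      using V[of "isN a"] V[of "Univ \<cdot> f"] allE by (auto simp: eval_truth')
    then show ?thesis using eval_App_cong[of "num k" k] allE by simp
  next
    case (nallI f a)
    obtain k where "eval (sub \<sigma> a) k" "eval (sub \<sigma> f \<cdot> sub \<sigma> a) 0"
      using V[of "isN a"] V[of "Neg (f \<cdot> a)"] nallI by (auto simp: eval_truth')
    then show ?thesis using eval_App_cong[of _ k "num k"] nallI by (auto simp: eval_truth')
  next
    case (nallE f)
    obtain k where k: "eval (sub \<sigma> f \<cdot> num k) 0"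
      using V[of "Neg (Univ \<cdot> f)"] nallE by (auto simp: eval_truth')
    have "eval (sub (scons (num k) \<sigma>) (up c)) 1"
    proof (rule validD[OF prems, of "finsert (isN (Var 0)) (finsert (Neg (up f \<cdot> Var 0)) (up |`| \<Gamma>))"])
      show "\<And>g. g |\<in>| finsert (isN (Var 0)) (finsert (Neg (up f \<cdot> Var 0)) (up |`| \<Gamma>)) \<Longrightarrow>
          eval (sub (scons (num k) \<sigma>) g) 1"
        using ctx k by (auto simp: eval_isN[unfolded One_nat_def] eval_Neg_1[unfolded One_nat_def])
    qed (use nallE closed_scons in auto)
    then show ?thesis by simp
  qed
qed

lemma RGA_valid: "RGA j \<Longrightarrow> valid j"
proof -
  have "valid j \<and> RGA j" if "gen rga_rule j" for j
    using that
  proof induction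
    case (gen ps j)
    have "RGA j" using gen by (auto simp: derivable_iff_gen intro: gen.gen)
    moreover obtain \<Gamma> c where "j = (\<Gamma> \<turnstile> c)" by (cases j)
    ultimately show ?case using gen rga_rule_valid unfolding valid_def[of j] by auto
  qed
  then show "RGA j \<Longrightarrow> valid j" by (simp add: derivable_iff_gen)
qed

lemma RGA_sound: "RGA ({||} \<turnstile> c) \<Longrightarrow> fv c = {} \<Longrightarrow> eval c 1"
  using validD[OF RGA_valid, of "{||}" c "\<lambda>_. Zr"] by (simp add: sub_closed)

section \<open>Search sentences\<close>

lemma eval_cmp:
  assumes "pr_wf n d" "list_all2 eval ts xs" "length ts = n"
  shows "eval (apps (cmp d) ts) (pr_eval d xs)"
  using assms
proof (induction n d arbitrary: ts xs rule: pr_wf.induct)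
  case (1 n m)
  then show ?case using eval_head_steps[OF cmp_PZero, of ts m] by simp
next
  case (2 n)
  then obtain t x where "ts = [t]" "xs = [x]" "eval t x"
    by (cases ts; cases xs) auto
  then show ?case using eval_head_steps[OF cmp_PSuc, of t] by simp
next
  case (3 n m i)
  then show ?case using eval_head_steps[OF cmp_PProj, of ts m i] by (simp add: list_all2_nthD)
next
  case (4 n m g hs)
  have "list_all2 eval (map (\<lambda>h. apps (cmp h) ts) hs) (map (\<lambda>h. pr_eval h xs) hs)"
    using 4 by (auto simp: list.rel_map intro!: list.rel_refl_strong)
  then show ?case
    using 4 eval_head_steps[OF cmp_PComp, of n m g hs ts] by simp
next
  case (5 n m g h)
  then obtain t us x ys where ts: "ts = t # us" "xs = x # ys" "eval t x" "list_all2 eval us ys"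
    by (cases ts; cases xs) auto
  let ?R = "Rec \<cdot> apps (cmp g) us \<cdot> rec_body h us"
  let ?r = "rec_nat (pr_eval g ys) (\<lambda>m r. pr_eval h (m # r # ys))"
  have m: "n = Suc m" "length us = m" "pr_wf m g" "pr_wf (m + 2) h" using 5 ts by auto
  \<comment> \<open>The claim covers every term of value \<open>x\<close>, since \<open>recS\<close>
    continues with a numeral in place of the original argument.\<close>
  have "eval (?R \<cdot> t) (?r x)" if "eval t x" for t x
    using that
  proof (induction x arbitrary: t rule: nat.induct)
    case zero
    have "eval (apps (cmp g) us) (pr_eval g ys)" using 5 m ts by blast
    then show ?case using eval_red.red[OF eval_red.rec0[OF zero]] by simp
  next
    case (Suc x)
    have "eval (?R \<cdot> num x) (?r x)" using Suc.IH by simp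
    then have "eval (apps (cmp h) (num x # ?R \<cdot> num x # us)) (pr_eval h (x # ?r x # ys))"
      using m ts by (intro "5.IH"(2)) auto
    then show ?case
      using eval_red.red[OF eval_red.recS[OF Suc.prems]] eval_head_steps[OF rec_body_steps[OF m(4)]]
      by simp
  qed
  then show ?case
    using eval_head_steps[OF cmp_PRec[OF "5.prems"(1), of t us]] ts m by simp
qed

text \<open>The argument terms may be open, since the premise of ATI needs the claim for a variable
  assumed numerical; knowing each numeral instance would not give it. The context is generalized
  because the case \<open>PRec\<close> is an induction inside RGA, whose step has two more
  hypotheses.\<close>

lemma RGA_cmp_nat:
  assumes "pr_wf n d" "length ts = n" "\<And>t. t \<in> set ts \<Longrightarrow> RGA (\<Gamma> \<turnstile> isN t)"
  shows "RGA (\<Gamma> \<turnstile> isN (apps (cmp d) ts))"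
  using assms
proof (induction n d arbitrary: ts \<Gamma> rule: pr_wf.induct)
  case (1 n m)
  then show ?case using RGA_steps_nat[OF cmp_PZero RGA_zero_nat, of ts m] by simp
next
  case (2 n)
  then obtain t where "ts = [t]" by (cases ts) auto
  then show ?case using 2 RGA_steps_nat[OF cmp_PSuc RGA_suc_natI, of \<Gamma> t] by simp
next
  case (3 n m i)
  then show ?case using RGA_steps_nat[OF cmp_PProj, of ts m i] by simp
next
  case (4 n m g hs)
  have "RGA (\<Gamma> \<turnstile> isN (apps (cmp g) (map (\<lambda>h. apps (cmp h) ts) hs)))"
    using 4 by (intro "4.IH"(1)) auto
  then show ?case
    using 4 RGA_steps_nat[OF cmp_PComp, of n m g hs ts] by simp
next
  case (5 n m g h)
  then obtain t us where ts: "ts = t # us" by (cases ts) auto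
  have m: "n = Suc m" "length us = m" "pr_wf m g" "pr_wf (m + 2) h" using 5 ts by auto
  define G where "G = apps (cmp g) us"
  define B where "B = rec_body h us"
  have "finite (fv (G \<cdot> B) \<union> (\<Union>g \<in> fset \<Gamma>. fv g))" by (simp add: finite_fv)
  from ex_new_if_finite[OF infinite_UNIV_nat this]
  obtain i where i: "i \<notin> fv (G \<cdot> B)" "\<forall>g |\<in>| \<Gamma>. i \<notin> fv g" by auto
  have fresh: "fsub i s (Rec \<cdot> G \<cdot> B \<cdot> Var i) = Rec \<cdot> G \<cdot> B \<cdot> s" for s
    using i(1) by (simp add: fsub_fresh)
  let ?c = "isN (Rec \<cdot> G \<cdot> B \<cdot> Var i)"
  let ?\<Delta> = "finsert (isN (Var i)) (finsert ?c \<Gamma>)"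
  have "RGA (\<Gamma> \<turnstile> fsub i t ?c)"
  proof (rule RGA_nat_ind[OF i(2)])
    have "RGA (\<Gamma> \<turnstile> isN G)" unfolding G_def using 5 m ts by simp
    then show "RGA (\<Gamma> \<turnstile> fsub i Zr ?c)"
      using RGA_eq_nat[OF RGA_conv_eq[OF head_step.rec_zero]] fresh by simp
    have v: "RGA (?\<Delta> \<turnstile> isN (Var i))" "RGA (?\<Delta> \<turnstile> ?c)"
      by (rule RGA_hyp, rule RGA_weaken, rule RGA_hyp)
    have "RGA (?\<Delta> \<turnstile> isN u)" if "u \<in> set us" for u
      using "5.prems"(3)[of u] that ts by (auto intro: RGA_weaken)
    then have "RGA (?\<Delta> \<turnstile> isN (apps (cmp h) (Var i # Rec \<cdot> G \<cdot> B \<cdot> Var i # us)))"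
      using m v by (intro "5.IH"(2)) auto
    then have "RGA (?\<Delta> \<turnstile> isN (B \<cdot> Var i \<cdot> (Rec \<cdot> G \<cdot> B \<cdot> Var i)))"
      unfolding B_def by (rule RGA_steps_nat[OF rec_body_steps[OF m(4)]])
    then have "RGA (?\<Delta> \<turnstile> isN (Rec \<cdot> G \<cdot> B \<cdot> Sc (Var i)))"
      using RGA_eq_nat[OF RGA_rec_eq[OF v(1)]] by simp
    then show "RGA (?\<Delta> \<turnstile> fsub i (Sc (Var i)) ?c)"
      using fresh by simp
    show "RGA (\<Gamma> \<turnstile> isN t)" using 5 ts by simp
  qed
  then have "RGA (\<Gamma> \<turnstile> isN (Rec \<cdot> G \<cdot> B \<cdot> t))" using fresh by simp
  then show ?case
    using RGA_steps_nat[OF cmp_PRec[OF "5.prems"(1), of t us]] ts m G_def B_def by simp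
qed

section \<open>Status of search sentences\<close>

lemma RGA_isB_expand:
  assumes "c \<triangleright> c'" "RGA (\<Gamma> \<turnstile> isB c')"
  shows "RGA (\<Gamma> \<turnstile> isB c)"
proof (rule RGA_orE[OF assms(2)])
  show "RGA (finsert c' \<Gamma> \<turnstile> isB c)"
    by (rule RGA_orI1, rule RGA_conv_expand[OF assms(1)], rule RGA_hyp)
  \<comment> \<open>Conversion under \<open>Neg\<close> goes only from \<open>c\<close> to
    \<open>c'\<close>. For the other direction, falsity is expressed as an equation with 0, which
    can be prefixed by the step.\<close>
  have "RGA (finsert (Neg c') \<Gamma> \<turnstile> Eq c' (num 0))"
    by (rule RGA_false_zero, rule RGA_hyp)
  then show "RGA (finsert (Neg c') \<Gamma> \<turnstile> isB c)"
    by (rule RGA_orI2[OF RGA_zero_false[OF RGA_conv_eq_trans[OF assms(1)]]])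
qed

lemma RGA_isB_reduce:
  assumes "c \<triangleright> c'" "RGA (\<Gamma> \<turnstile> isB c)"
  shows "RGA (\<Gamma> \<turnstile> isB c')"
proof (rule RGA_orE[OF assms(2)])
  show "RGA (finsert c \<Gamma> \<turnstile> isB c')"
    by (rule RGA_orI1, rule RGA_conv_reduce[OF assms(1)], rule RGA_hyp)
  show "RGA (finsert (Neg c) \<Gamma> \<turnstile> isB c')"
    by (rule RGA_orI2, rule RGA_conv_neg[OF assms(1)], rule RGA_hyp)
qed

lemma RGA_isB_Neg: "RGA (\<Gamma> \<turnstile> isB c) \<Longrightarrow> RGA (\<Gamma> \<turnstile> isB (Neg c))"
  by (erule RGA_orE) (rule RGA_orI2, rule RGA_dnegI, rule RGA_hyp, rule RGA_orI1, rule RGA_hyp)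

lemma RGA_isB_NegE: "RGA (\<Gamma> \<turnstile> isB (Neg c)) \<Longrightarrow> RGA (\<Gamma> \<turnstile> isB c)"
  by (erule RGA_orE) (rule RGA_orI2, rule RGA_hyp, rule RGA_orI1, rule RGA_dnegE, rule RGA_hyp)

definition rmat :: "pdef \<Rightarrow> nat \<Rightarrow> tm" where
  "rmat d n = Lam (Eq (cmp d \<cdot> num n \<cdot> Var 0) Zr)"

lemma inst_cmp: "pr_wf n d \<Longrightarrow> inst k s (cmp d) = cmp d"
  by (simp add: inst_eq_sub sub_cmp)

lemma inst_num [simp]: "inst k s (num n) = num n"
  by (simp add: inst_eq_sub)

lemma fv_rmat: "pr_wf 2 d \<Longrightarrow> fv (rmat d n) = {}"
  by (auto simp: rmat_def fv_cmp)

lemma fv_rrep: "pr_wf 2 d \<Longrightarrow> fv (rrep d) = {}"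
  by (auto simp: rrep_def fv_cmp)

lemma rrep_step: "pr_wf 2 d \<Longrightarrow> rrep d \<cdot> num n \<triangleright> Neg (Univ \<cdot> rmat d n)"
  unfolding rrep_def rmat_def
  using head_step.beta[of "Neg (Univ \<cdot> Lam (Eq (cmp d \<cdot> Var 1 \<cdot> Var 0) Zr))" "num n"]
  by (simp add: inst_cmp)

lemma rmat_step: "pr_wf 2 d \<Longrightarrow> rmat d n \<cdot> t \<triangleright> Eq (cmp d \<cdot> num n \<cdot> t) Zr"
  unfolding rmat_def
  using head_step.beta[of "Eq (cmp d \<cdot> num n \<cdot> Var 0) Zr" t] by (simp add: inst_cmp)

lemma RGA_isB_rrep_iff:
  "pr_wf 2 d \<Longrightarrow> RGA (\<Gamma> \<turnstile> isB (rrep d \<cdot> num n)) \<longleftrightarrow> RGA (\<Gamma> \<turnstile> isB (Univ \<cdot> rmat d n))"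
  using RGA_isB_expand[OF rrep_step] RGA_isB_reduce[OF rrep_step] RGA_isB_Neg RGA_isB_NegE by blast

text \<open>The matrix at a variable is an equation between two terms that provably denote numbers,
  so \<open>eq_bool\<close> decides it; the status is then carried back through the beta
  steps.\<close>

lemma RGA_ati_premise:
  assumes "pr_wf 2 d"
  shows "RGA ({||} \<turnstile> Univ \<cdot> Lam (isB (up (rmat d n) \<cdot> Var 0)))"
proof (rule RGA_allI)
  have up: "up (rmat d n) = rmat d n" "shift 1 (rmat d n) = rmat d n"
    using assms by (simp_all add: shift_eq_sub sub_closed fv_rmat)
  let ?\<Gamma> = "finsert (isN (Var 0)) (up |`| {||})"
  have "RGA (?\<Gamma> \<turnstile> isN (apps (cmp d) [num n, Var 0]))"
    by (rule RGA_cmp_nat[OF assms]) (auto intro: RGA_num_nat RGA_hyp)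
  then have "RGA (?\<Gamma> \<turnstile> isB (Eq (cmp d \<cdot> num n \<cdot> Var 0) Zr))"
    using RGA_eq_bool[OF _ RGA_zero_nat] by simp
  then have "RGA (?\<Gamma> \<turnstile> isB (rmat d n \<cdot> Var 0))"
    by (rule RGA_isB_expand[OF rmat_step[OF assms]])
  moreover have "up (Lam (isB (up (rmat d n) \<cdot> Var 0))) \<cdot> Var 0 \<triangleright> isB (rmat d n \<cdot> Var 0)"
    using head_step.beta[of "isB (rmat d n \<cdot> Var 0)" "Var 0"] assms up
    by (simp add: inst_eq_sub sub_closed fv_rmat)
  ultimately show "RGA (?\<Gamma> \<turnstile> up (Lam (isB (up (rmat d n) \<cdot> Var 0))) \<cdot> Var 0)"
    using RGA_conv_expand by blast
qed

lemma eval_rmat: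
  assumes "presents d f"
  shows "eval (rmat d n \<cdot> num k) v \<longleftrightarrow> v = (if f n k = 0 then 1 else 0)"
proof -
  have d: "pr_wf 2 d" "pr_eval d [n, k] = f n k" using assms by (auto simp: presents_def)
  have "eval (cmp d \<cdot> num n \<cdot> num k) w \<longleftrightarrow> w = f n k" for w
    using eval_cmp[OF d(1), of "[num n, num k]" "[n, k]"] d(2) eval_red_det(1) by auto
  then show ?thesis
    unfolding eval_red_iff[OF head_step_red[OF rmat_step[OF d(1)]]] eval_Eq_iff by simp
qed

text \<open>These are implications only: the sentence of a search that never hits has a value just
  when RGA proves the universal.\<close>

lemma eval_rrep:
  assumes "presents d f"
  shows "eval (rrep d \<cdot> num n) 0 \<Longrightarrow> f n k = 0" "eval (rrep d \<cdot> num n) 1 \<Longrightarrow> \<exists>k. f n k \<noteq> 0"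
proof -
  have "eval (rrep d \<cdot> num n) v \<longleftrightarrow> eval (Neg (Univ \<cdot> rmat d n)) v" for v
    using assms by (intro eval_red_iff head_step_red rrep_step) (simp add: presents_def)
  then show "eval (rrep d \<cdot> num n) 0 \<Longrightarrow> f n k = 0" "eval (rrep d \<cdot> num n) 1 \<Longrightarrow> \<exists>k. f n k \<noteq> 0"
    by (auto simp: eval_truth' eval_rmat[OF assms] split: if_splits)
qed

text \<open>The assumed status rules out a missing value: by soundness the sentence is true or
  false, truth would exhibit a hit, and so a search without hits makes it false and hence
  refutable.\<close>

lemma RGA_refutes_iff:
  assumes "presents d f" "RGA ({||} \<turnstile> isB (rrep d \<cdot> num n))"
  shows "RGA ({||} \<turnstile> Neg (rrep d \<cdot> num n)) \<longleftrightarrow> (\<forall>k. f n k = 0)"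
proof
  have closed: "fv (rrep d \<cdot> num n) = {}" using assms by (simp add: fv_rrep presents_def)
  {
    assume "RGA ({||} \<turnstile> Neg (rrep d \<cdot> num n))"
    then have "eval (rrep d \<cdot> num n) 0"
      using RGA_sound[of "Neg (rrep d \<cdot> num n)"] closed by (simp add: eval_truth')
    then show "\<forall>k. f n k = 0" using eval_rrep(1)[OF assms(1)] by blast
  next
    assume "\<forall>k. f n k = 0"
    then have "\<not> eval (rrep d \<cdot> num n) 1" using eval_rrep(2)[OF assms(1)] by metis
    moreover have "eval (isB (rrep d \<cdot> num n)) 1" using RGA_sound[OF assms(2)] closed by simp
    ultimately have "eval (Neg (rrep d \<cdot> num n)) 1" by (simp add: eval_truth')
    then show "RGA ({||} \<turnstile> Neg (rrep d \<cdot> num n))" by (rule RGA_eval_true)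
  }
qed

section \<open>The diagonal argument\<close>

lemma semi_imp_partrec1:
  fixes P :: "nat \<Rightarrow> bool"
  assumes "semi P"
  shows "\<exists>\<psi>. partrec1 \<psi> \<and> (\<forall>x. \<psi> x \<noteq> None \<longleftrightarrow> P x)"
proof -
  obtain q where q: "decid q" "\<And>x. P x \<longleftrightarrow> (\<exists>k::nat. q (x, k))" using semiE[OF assms] by blast
  let ?c = "\<lambda>x k. if q (x, k) then 0 else 1 :: nat"
  have "tc 2 (\<lambda>xs. prod_encode (xs ! 1, xs ! 0))"
    by (simp add: tc_prod_encode tc_proj)
  from tc_comp1[OF q(1)[unfolded decid_def comput_def] this]
  have "tc 2 (\<lambda>xs. ?c (xs ! 1) (xs ! 0))" by (simp add: dec_prod)
  then obtain F where F: "partrec (Suc 1) F"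
    "\<And>xs. length xs = 2 \<Longrightarrow> F xs = Some (?c (xs ! 1) (xs ! 0))"
    unfolding tc_def by (auto simp: numeral_2_eq_2)
  let ?\<psi> = "\<lambda>xs. if \<exists>k. mu_at F xs k then Some (THE k. mu_at F xs k) else None"
  have F': "F [k, x] = Some (?c x k)" for k x using F(2)[of "[k, x]"] by simp
  have "(\<exists>k. mu_at F [x] k) \<longleftrightarrow> P x" for x
  proof
    assume "P x"
    then obtain k where "q (x, k)" using q(2) by blast
    then have "q (x, LEAST k. q (x, k))" by (rule LeastI)
    then have "mu_at F [x] (LEAST k. q (x, k))"
      unfolding mu_at_def F' using not_less_Least by auto
    then show "\<exists>k. mu_at F [x] k" ..
  next
    assume "\<exists>k. mu_at F [x] k"
    then show "P x" unfolding mu_at_def F' q(2) by (auto split: if_splits)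
  qed
  then have "\<forall>x. ?\<psi> [x] \<noteq> None \<longleftrightarrow> P x" by simp
  moreover have "partrec1 (\<lambda>x. ?\<psi> [x])"
    unfolding partrec1_def using partrec.mu[OF F(1)] by blast
  ultimately show ?thesis by blast
qed

lemma sfApp_status_underivable:
  assumes "standard_enumeration \<phi>" "step_predicate \<phi> H" "presents sf (sfApp H)"
  shows "\<exists>n. \<not> RGA ({||} \<turnstile> isB (rrep sf \<cdot> num n))"
proof (rule ccontr)
  assume "\<nexists>n. \<not> RGA ({||} \<turnstile> isB (rrep sf \<cdot> num n))"
  then have RGA: "RGA ({||} \<turnstile> isB (rrep sf \<cdot> num n))" for n by blast
  \<comment> \<open>On pairs of numbers \<open>enc\<close> is the Cantor pairing, so this is the
    search sentence at the code of \<open>(x, x)\<close>.\<close>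
  let ?P = "\<lambda>x. RGA ({||} \<turnstile> Neg (rrep sf \<cdot> num (enc (x, x))))"
  have "(\<exists>k. H x x k) \<longleftrightarrow> \<phi> x x \<noteq> None" for x
    using assms(2) unfolding step_predicate_def by blast
  moreover have "(\<forall>k. sfApp H (enc (x, x)) k = 0) \<longleftrightarrow> \<not> (\<exists>k. H x x k)" for x :: nat
    by (simp add: sfApp_def enc_prod_def)
  ultimately have P: "?P x \<longleftrightarrow> \<phi> x x = None" for x
    unfolding RGA_refutes_iff[OF assms(3) RGA] by simp
  have "semi ?P"
    by (rule semi_comp[OF semi_RGA]) (intro comput_intros)
  then obtain \<psi> where \<psi>: "partrec1 \<psi>" "\<And>x. \<psi> x \<noteq> None \<longleftrightarrow> ?P x"
    using semi_imp_partrec1 by blast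
  then obtain e where "\<psi> = \<phi> e"
    using assms(1) unfolding standard_enumeration_def by blast
  \<comment> \<open>At its own index \<open>e\<close> the function would be defined exactly if it is
    undefined.\<close>
  then show False using \<psi>(2)[of e] P[of e] by (cases "\<phi> e e") simp_all
qed

section \<open>OGA strictly extends RGA\<close>

lemma derivable_mono: "(\<And>ps j. R ps j \<Longrightarrow> S ps j) \<Longrightarrow> derivable R j \<Longrightarrow> derivable S j"
  unfolding derivable_def is_proof_def by blast

lemma OGA_extends_RGA: "RGA j \<Longrightarrow> OGA j"
  by (rule derivable_mono) (auto simp: oga_rule_def)

lemma OGA_isB_Univ_rmat: "pr_wf 2 d \<Longrightarrow> OGA ({||} \<turnstile> isB (Univ \<cdot> rmat d n))"
  by (rule derivable1[OF _ OGA_extends_RGA[OF RGA_ati_premise]]) (auto simp: oga_rule_def intro: ati_rule.ati)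

text \<open>ATI yields the status of the universal itself; the passage to the redex
  \<open>rrep d \<cdot> num n\<close> is a derivation in RGA from that status as a hypothesis,
  joined to it by a cut.\<close>

lemma OGA_isB_rrep:
  assumes "pr_wf 2 d"
  shows "OGA ({||} \<turnstile> isB (rrep d \<cdot> num n))"
proof (rule derivable2[where R = oga_rule])
  show "oga_rule [{||} \<turnstile> isB (Univ \<cdot> rmat d n),
      finsert (isB (Univ \<cdot> rmat d n)) {||} \<turnstile> isB (rrep d \<cdot> num n)] ({||} \<turnstile> isB (rrep d \<cdot> num n))"
    unfolding oga_rule_def using rga_rule.cut by blast
  show "OGA (finsert (isB (Univ \<cdot> rmat d n)) {||} \<turnstile> isB (rrep d \<cdot> num n))"
    using assms RGA_hyp by (simp add: OGA_extends_RGA RGA_isB_rrep_iff)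
qed (rule OGA_isB_Univ_rmat[OF assms])

text \<open>This is the exact sense in which the extension consists of status judgments: ATI can be
  replaced by axioms of status form. The induction keeps OGA-derivability next to the new
  derivability, because a conclusion of ATI qualifies as an axiom only as a theorem of OGA.\<close>

lemma OGA_iff_RGA_with_status:
  "OGA j \<longleftrightarrow> derivable (\<lambda>ps k. rga_rule ps k \<or> (ps = [] \<and> all_status k \<and> OGA k)) j"
  (is "_ \<longleftrightarrow> derivable ?S j")
proof
  have "gen ?S j \<and> gen oga_rule j" if "gen oga_rule j" for j
    using that
  proof induction
    case (gen ps j)
    then have OGA: "gen oga_rule j" by (auto intro: gen.gen)
    show ?case
    proof (cases "rga_rule ps j")
      case True
      then show ?thesis using gen OGA by (auto intro: gen.gen[of ?S ps])
    next
      case False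
      then have "all_status j"
        using gen(1) by (auto simp: oga_rule_def all_status_def elim: ati_rule.cases)
      then have "?S [] j" using OGA by (simp add: derivable_iff_gen)
      then have "gen ?S j" by (rule gen.gen[where ps = "[]"]) simp
      then show ?thesis using OGA by blast
    qed
  qed
  then show "OGA j \<Longrightarrow> derivable ?S j" by (simp add: derivable_iff_gen)
next
  have "gen oga_rule j" if "gen ?S j" for j
    using that
  proof induction
    case (gen ps j)
    from gen(1) consider "rga_rule ps j" | "OGA j" by blast
    then show ?case
    proof cases
      case 1
      then have "oga_rule ps j" by (simp add: oga_rule_def)
      then show ?thesis using gen(2) by (auto intro: gen.gen)
    qed (simp add: derivable_iff_gen)
  qed
  then show "derivable ?S j \<Longrightarrow> OGA j" by (simp add: derivable_iff_gen)
qed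

theorem corollary5p1:
  fixes \<phi> :: "nat \<Rightarrow> nat \<Rightarrow> nat option"
    and H :: "nat \<Rightarrow> nat \<Rightarrow> nat \<Rightarrow> bool"
    and sf :: pdef
  assumes "standard_enumeration \<phi>"
    and "step_predicate \<phi> H"
    and "presents sf (sfApp H)"
  shows
    "(\<forall>j. RGA j \<longrightarrow> OGA j)
   \<and> (\<exists>n. OGA ({||} \<turnstile> isB (rrep sf \<cdot> num n)) \<and> \<not> RGA ({||} \<turnstile> isB (rrep sf \<cdot> num n)))
   \<and> (\<forall>j. OGA j \<longleftrightarrow> derivable (\<lambda>ps k. rga_rule ps k \<or> (ps = [] \<and> all_status k \<and> OGA k)) j)
   \<and> (\<forall>ps j. ati_rule ps j \<longrightarrow> all_status j \<and> (\<forall>\<Gamma> u. j \<noteq> (\<Gamma> \<turnstile> Univ \<cdot> u)))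
   \<and> (\<exists>ps j. ati_rule ps j \<and> (\<forall>p \<in> set ps. OGA p) \<and> OGA j \<and> \<not> RGA j)"
proof -
  have wf: "pr_wf 2 sf" using assms(3) by (simp add: presents_def)
  obtain n where n: "\<not> RGA ({||} \<turnstile> isB (rrep sf \<cdot> num n))"
    using sfApp_status_underivable[OF assms] by blast
  \<comment> \<open>The status of \<open>rrep sf \<cdot> num n\<close> and that of
    \<open>Univ \<cdot> ?u\<close> are interderivable in RGA, so the instance of ATI itself
    witnesses the gap.\<close>
  let ?u = "rmat sf n"
  have "ati_rule [{||} \<turnstile> Univ \<cdot> Lam (isB (up ?u \<cdot> Var 0))] ({||} \<turnstile> isB (Univ \<cdot> ?u))"
    by (rule ati_rule.ati)
  moreover have "OGA ({||} \<turnstile> Univ \<cdot> Lam (isB (up ?u \<cdot> Var 0)))"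
    by (rule OGA_extends_RGA[OF RGA_ati_premise[OF wf]])
  moreover have "\<not> RGA ({||} \<turnstile> isB (Univ \<cdot> ?u))"
    using n RGA_isB_rrep_iff[OF wf] by blast
  ultimately have "\<exists>ps j. ati_rule ps j \<and> (\<forall>p \<in> set ps. OGA p) \<and> OGA j \<and> \<not> RGA j"
    using OGA_isB_Univ_rmat[OF wf] by (metis empty_iff empty_set set_ConsD)
  moreover have "ati_rule ps j \<Longrightarrow> all_status j \<and> (\<forall>\<Gamma> u. j \<noteq> (\<Gamma> \<turnstile> Univ \<cdot> u))" for ps j
    by (auto simp: all_status_def elim: ati_rule.cases)
  ultimately show ?thesis
    using OGA_extends_RGA OGA_iff_RGA_with_status OGA_isB_rrep[OF wf] n by blast
qed

end
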